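(* Let $X$ be the geometric realization of a tree, let $(T,\pi)$ be a cellular merge tree with exactly one leaf, and let $D$ be the barcode associated to $T$. Then $\mathrm{MT}^{-1}(T)=\mathrm{PH}^{-1}(D)$, and both are contractible.
   Context: Trees: a tree is a finite connected acyclic graph. In a rooted tree $(T',r)$ edges are oriented away from $r$; a leaf is a vertex different from $r$ adjacent to exactly one other vertex (if $T'=\{r\}$, then $r$ counts as the unique leaf). Cellular merge tree: $(T,\pi)$ where $T=T'\sqcup[0,1)/(r\sim 0)$ for a geometric realization of a rooted tree $(T',r)$ and $\pi:T\to\mathbb{R}$ is continuous, strictly decreasing along edges of $T'$ oriented away from the root and strictly increasing to infinity along $[0,1)$. Merge tree of a function: for continuous $f:X\to\mathbb{R}$, $\mathrm{MT}(f)$ is the quotient of $\{(x,t)\in X\times\mathbb{R}:t\geq f(x)\}$ by $(x,t)\sim(y,t)$ whenever $x,y$ lie in the same connected component of $f^{-1}(-\infty,t]$, with $\pi_f$ induced by $(x,t)\mapsto t$. $\mathrm{MT}^{-1}(T)$ is the space of continuous $f:X\to\mathbb{R}$ such that $(\mathrm{MT}(f),\pi_f)\cong(T,\pi)$ (homeomorphism commuting with the maps to $\mathbb{R}$), with the supremum metric. Barcodes: homology is over a fixed field. $f$ is pfd if $H_i(f^{-1}(-\infty,t])$ is finite dimensional for all $i$ and $t$. In that case $\mathrm{PH}(f)$ denotes the degree-$0$ barcode of $f$, i.e. the multiset of intervals in the interval-module decomposition of $t\mapsto H_0(f^{-1}(-\infty,t])$ (higher degrees vanish on a tree). The barcode of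 a merge tree $(T,\pi)$ is the degree-$0$ barcode of $\pi$. $\mathrm{PH}^{-1}(D)$ is the space of pfd continuous $f:X\to\mathbb{R}$ with $\mathrm{PH}(f)=D$, with the supremum metric. *)

theory Defs
  imports "HOL-Analysis.Analysis" "HOL-Homology.Homology"
begin

definition adjacency :: "'v set set \<Rightarrow> ('v \<times> 'v) set" where
  "adjacency E = {(u, v). {u, v} \<in> E}"

definition finite_graph :: "'v set \<Rightarrow> 'v set set \<Rightarrow> bool" where
  "finite_graph V E \<longleftrightarrow> finite V \<and> (\<forall>e\<in>E. e \<subseteq> V \<and> card e = 2)"

definition connected_graph :: "'v set \<Rightarrow> 'v set set \<Rightarrow> bool" where
  "connected_graph V E \<longleftrightarrow> V \<noteq> {} \<and> (\<forall>u\<in>V. \<forall>v\<in>V. (u, v) \<in> (adjacency E)\<^sup>*)"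

definition graph_cycle :: "'v set set \<Rightarrow> 'v list \<Rightarrow> bool" where
  "graph_cycle E p \<longleftrightarrow> 3 \<le> length p \<and> distinct p \<and>
     (\<forall>i<length p. {p ! i, p ! (Suc i mod length p)} \<in> E)"

definition is_tree :: "'v set \<Rightarrow> 'v set set \<Rightarrow> bool" where
  "is_tree V E \<longleftrightarrow> finite_graph V E \<and> connected_graph V E \<and> \<not> (\<exists>p. graph_cycle E p)"

definition graph_dist :: "'v set set \<Rightarrow> 'v \<Rightarrow> 'v \<Rightarrow> nat" where
  "graph_dist E u v = (LEAST n. (u, v) \<in> adjacency E ^^ n)"

text \<open>In a tree the ends of an edge have different distances to the root;
  the edge is oriented towards the end that is further away.\<close>

definition edge_away :: "'v set set \<Rightarrow> 'v \<Rightarrow> 'v \<Rightarrow> 'v \<Rightarrow> bool" where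
  "edge_away E r u v \<longleftrightarrow> {u, v} \<in> E \<and> graph_dist E r u < graph_dist E r v"

definition leaves :: "'v set \<Rightarrow> 'v set set \<Rightarrow> 'v \<Rightarrow> 'v set" where
  "leaves V E r =
     (if V = {r} then {r} else {v \<in> V. v \<noteq> r \<and> card {w. {v, w} \<in> E} = 1})"

text \<open>Points of the realization are given by barycentric coordinates. For finite \<open>V\<close>
  the product topology induces the usual topology.\<close>

definition realization_set :: "'v set \<Rightarrow> 'v set set \<Rightarrow> ('v \<Rightarrow> real) set" where
  "realization_set V E =
     {x. (\<forall>v. 0 \<le> x v) \<and> (\<exists>e \<in> (\<lambda>v. {v}) ` V \<union> E. {v. x v \<noteq> 0} \<subseteq> e) \<and> (\<Sum>v\<in>V. x v) = 1}"

definition realization :: "'v set \<Rightarrow> 'v set set \<Rightarrow> ('v \<Rightarrow> real) topology" where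
  "realization V E = subtopology (powertop_real UNIV) (realization_set V E)"

text \<open>The point of the edge from \<open>u\<close> to \<open>v\<close> with parameter \<open>s\<close>; for \<open>u = v\<close> it is the
  vertex \<open>u\<close>.\<close>

definition edge_point :: "'v \<Rightarrow> 'v \<Rightarrow> real \<Rightarrow> 'v \<Rightarrow> real" where
  "edge_point u v s = (\<lambda>w. (1 - s) * of_bool (w = u) + s * of_bool (w = v))"

definition vertex_point :: "'v \<Rightarrow> 'v \<Rightarrow> real" where
  "vertex_point v = (\<lambda>w. of_bool (w = v))"

definition disjoint_union_topology :: "'a topology \<Rightarrow> 'b topology \<Rightarrow> ('a + 'b) topology" where
  "disjoint_union_topology X Y =
     topology (\<lambda>U. openin X (Inl -` U) \<and> openin Y (Inr -` U))"

lemma openin_disjoint_union_topology: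
  "openin (disjoint_union_topology X Y) U \<longleftrightarrow> openin X (Inl -` U) \<and> openin Y (Inr -` U)"
proof -
  have "istopology (\<lambda>U. openin X (Inl -` U) \<and> openin Y (Inr -` U))"
    unfolding istopology_def by (auto simp: vimage_Int vimage_Union)
  then show ?thesis
    by (simp add: disjoint_union_topology_def topology_inverse')
qed

lemma topspace_disjoint_union_topology:
  "topspace (disjoint_union_topology X Y) = Inl ` topspace X \<union> Inr ` topspace Y"
proof
  have "openin X (Inl -` topspace (disjoint_union_topology X Y)) \<and>
    openin Y (Inr -` topspace (disjoint_union_topology X Y))"
    using openin_topspace[of "disjoint_union_topology X Y"]
    unfolding openin_disjoint_union_topology .
  then have "Inl -` topspace (disjoint_union_topology X Y) \<subseteq> topspace X"
    "Inr -` topspace (disjoint_union_topology X Y) \<subseteq> topspace Y"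
    using openin_subset by blast+
  then have *: "x \<in> topspace X" if "Inl x \<in> topspace (disjoint_union_topology X Y)" for x
    using that by blast
  have **: "y \<in> topspace Y" if "Inr y \<in> topspace (disjoint_union_topology X Y)" for y
    using that \<open>Inr -` _ \<subseteq> _\<close> by blast
  show "topspace (disjoint_union_topology X Y) \<subseteq> Inl ` topspace X \<union> Inr ` topspace Y"
  proof
    fix z
    assume "z \<in> topspace (disjoint_union_topology X Y)"
    then show "z \<in> Inl ` topspace X \<union> Inr ` topspace Y"
      by (cases z) (use * ** in auto)
  qed
  have "Inl -` (Inl ` topspace X \<union> Inr ` topspace Y) = topspace X"
    "Inr -` (Inl ` topspace X \<union> Inr ` topspace Y) = topspace Y"
    by auto
  then have "openin (disjoint_union_topology X Y) (Inl ` topspace X \<union> Inr ` topspace Y)"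
    by (simp add: openin_disjoint_union_topology)
  then show "Inl ` topspace X \<union> Inr ` topspace Y \<subseteq> topspace (disjoint_union_topology X Y)"
    by (rule openin_subset)
qed

definition quotient_topology :: "'a topology \<Rightarrow> ('a \<times> 'a) set \<Rightarrow> 'a set topology" where
  "quotient_topology X R =
     topology (\<lambda>U. U \<subseteq> topspace X // R \<and> openin X {x \<in> topspace X. R `` {x} \<in> U})"

lemma openin_quotient_topology:
  "openin (quotient_topology X R) U \<longleftrightarrow>
     U \<subseteq> topspace X // R \<and> openin X {x \<in> topspace X. R `` {x} \<in> U}"
proof -
  have "istopology (\<lambda>U. U \<subseteq> topspace X // R \<and> openin X {x \<in> topspace X. R `` {x} \<in> U})"
    unfolding istopology_def
  proof (intro conjI allI impI)
    fix U V
    assume "U \<subseteq> topspace X // R \<and> openin X {x \<in> topspace X. R `` {x} \<in> U}"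
      "V \<subseteq> topspace X // R \<and> openin X {x \<in> topspace X. R `` {x} \<in> V}"
    moreover have "{x \<in> topspace X. R `` {x} \<in> U \<inter> V} =
      {x \<in> topspace X. R `` {x} \<in> U} \<inter> {x \<in> topspace X. R `` {x} \<in> V}"
      by auto
    ultimately show "U \<inter> V \<subseteq> topspace X // R" "openin X {x \<in> topspace X. R `` {x} \<in> U \<inter> V}"
      by auto
  next
    fix \<U>
    assume U: "\<forall>U\<in>\<U>. U \<subseteq> topspace X // R \<and> openin X {x \<in> topspace X. R `` {x} \<in> U}"
    then show "\<Union>\<U> \<subseteq> topspace X // R" by blast
    have "{x \<in> topspace X. R `` {x} \<in> \<Union>\<U>} =
      (\<Union>U\<in>\<U>. {x \<in> topspace X. R `` {x} \<in> U})"
      by auto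
    with U show "openin X {x \<in> topspace X. R `` {x} \<in> \<Union>\<U>}"
      by auto
  qed
  then show ?thesis
    by (simp add: quotient_topology_def topology_inverse')
qed

lemma topspace_quotient_topology: "topspace (quotient_topology X R) = topspace X // R"
proof
  show "topspace (quotient_topology X R) \<subseteq> topspace X // R"
    using openin_topspace[of "quotient_topology X R"]
    unfolding openin_quotient_topology by blast
  have "{x \<in> topspace X. R `` {x} \<in> topspace X // R} = topspace X"
    by (auto intro: quotientI)
  then have "openin (quotient_topology X R) (topspace X // R)"
    by (simp add: openin_quotient_topology)
  then show "topspace X // R \<subseteq> topspace (quotient_topology X R)"
    by (rule openin_subset)
qed

lemma quotient_map_quotient_topology:
  "quotient_map X (quotient_topology X R) (\<lambda>x. R `` {x})"
  unfolding quotient_map_def topspace_quotient_topology openin_quotient_topology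
  by (auto simp: quotient_def)

definition glue_rel :: "'v set \<Rightarrow> 'v set set \<Rightarrow> 'v \<Rightarrow> ((('v \<Rightarrow> real) + real) \<times> (('v \<Rightarrow> real) + real)) set"
  where
  "glue_rel V E r =
     Id_on (topspace (disjoint_union_topology (realization V E) (top_of_set {0..<1}))) \<union>
     {(Inl (vertex_point r), Inr 0), (Inr 0, Inl (vertex_point r))}"

definition merge_tree_space :: "'v set \<Rightarrow> 'v set set \<Rightarrow> 'v \<Rightarrow> (('v \<Rightarrow> real) + real) set topology"
  where
  "merge_tree_space V E r =
     quotient_topology
       (disjoint_union_topology (realization V E) (top_of_set {0..<1})) (glue_rel V E r)"

definition cellular_merge_tree ::
  "'v set \<Rightarrow> 'v set set \<Rightarrow> 'v \<Rightarrow> ((('v \<Rightarrow> real) + real) set \<Rightarrow> real) \<Rightarrow> bool" where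
  "cellular_merge_tree V E r \<pi> \<longleftrightarrow>
     is_tree V E \<and> r \<in> V \<and>
     continuous_map (merge_tree_space V E r) euclideanreal \<pi> \<and>
     (\<forall>u v. edge_away E r u v \<longrightarrow>
        strict_antimono_on {0..1} (\<lambda>s. \<pi> (glue_rel V E r `` {Inl (edge_point u v s)}))) \<and>
     strict_mono_on {0..<1} (\<lambda>s. \<pi> (glue_rel V E r `` {Inr s})) \<and>
     filterlim (\<lambda>s. \<pi> (glue_rel V E r `` {Inr s})) at_top (at_left 1)"

definition sublevel :: "'a topology \<Rightarrow> ('a \<Rightarrow> real) \<Rightarrow> real \<Rightarrow> 'a topology" where
  "sublevel X f t = subtopology X {x \<in> topspace X. f x \<le> t}"

definition epigraph :: "'a topology \<Rightarrow> ('a \<Rightarrow> real) \<Rightarrow> ('a \<times> real) topology" where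
  "epigraph X f =
     subtopology (prod_topology X euclideanreal) {(x, t). x \<in> topspace X \<and> f x \<le> t}"

definition MT_rel :: "'a topology \<Rightarrow> ('a \<Rightarrow> real) \<Rightarrow> (('a \<times> real) \<times> ('a \<times> real)) set" where
  "MT_rel X f = {((x, s), (y, t)). s = t \<and> connected_component_of (sublevel X f t) x y}"

definition MT :: "'a topology \<Rightarrow> ('a \<Rightarrow> real) \<Rightarrow> ('a \<times> real) set topology" where
  "MT X f = quotient_topology (epigraph X f) (MT_rel X f)"

definition MT_height :: "('a \<times> real) set \<Rightarrow> real" where
  "MT_height C = (THE t. t \<in> snd ` C)"

definition isomorphic_over_real ::
  "'a topology \<Rightarrow> ('a \<Rightarrow> real) \<Rightarrow> 'b topology \<Rightarrow> ('b \<Rightarrow> real) \<Rightarrow> bool" where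
  "isomorphic_over_real S \<sigma> T \<tau> \<longleftrightarrow>
     (\<exists>h. homeomorphic_map S T h \<and> (\<forall>x\<in>topspace S. \<tau> (h x) = \<sigma> x))"

text \<open>A function on \<open>X\<close> is represented by its extension by \<open>undefined\<close>, as in \<^const>\<open>cfunspace\<close>.\<close>

definition MT_fiber :: "'a topology \<Rightarrow> 'b topology \<Rightarrow> ('b \<Rightarrow> real) \<Rightarrow> ('a \<Rightarrow> real) set" where
  "MT_fiber X T \<tau> =
     {f \<in> extensional (topspace X). continuous_map X euclideanreal f \<and>
        isomorphic_over_real (MT X f) MT_height T \<tau>}"

type_synonym ('k, 'a) field_chain = "((nat \<Rightarrow> real) \<Rightarrow> 'a) \<Rightarrow>\<^sub>0 'k"

definition field_chains :: "nat \<Rightarrow> 'a topology \<Rightarrow> ('k::field, 'a) field_chain set" where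
  "field_chains p X = {c. Poly_Mapping.keys c \<subseteq> singular_simplex_set p X}"

definition field_boundary :: "nat \<Rightarrow> ('k::field, 'a) field_chain \<Rightarrow> ('k, 'a) field_chain" where
  "field_boundary p c =
     (if p = 0 then 0
      else \<Sum>\<sigma>\<in>Poly_Mapping.keys c. \<Sum>k\<le>p.
             Poly_Mapping.single (singular_face p k \<sigma>) ((-1) ^ k * Poly_Mapping.lookup c \<sigma>))"

definition field_cycles :: "nat \<Rightarrow> 'a topology \<Rightarrow> ('k::field, 'a) field_chain set" where
  "field_cycles p X = {c \<in> field_chains p X. field_boundary p c = 0}"

definition field_boundaries :: "nat \<Rightarrow> 'a topology \<Rightarrow> ('k::field, 'a) field_chain set" where
  "field_boundaries p X = field_boundary (Suc p) ` field_chains (Suc p) X"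

text \<open>Vector spaces are \<^typ>\<open>('k, 'v) module\<close> records, whose ring multiplication and unit
  play no role. Homology classes are cosets of the space of boundaries.\<close>

definition field_homology ::
  "nat \<Rightarrow> 'a topology \<Rightarrow> ('k::field, ('k, 'a) field_chain set) module" where
  "field_homology p X =
     \<lparr>carrier = (\<lambda>z. {z + b |b. b \<in> field_boundaries p X}) ` field_cycles p X,
      mult = undefined, one = undefined,
      zero = field_boundaries p X,
      add = (\<lambda>A B. {a + b |a b. a \<in> A \<and> b \<in> B}),
      smult = (\<lambda>c A. {Poly_Mapping.map ((*) c) a + b |a b. a \<in> A \<and> b \<in> field_boundaries p X})\<rparr>"

definition finite_dimensional :: "('k, 'v) module \<Rightarrow> bool" where
  "finite_dimensional M \<longleftrightarrow>
     (\<exists>B. finite B \<and> B \<subseteq> carrier M \<and>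
        (\<forall>x\<in>carrier M. \<exists>a. x = (\<Oplus>\<^bsub>M\<^esub>b\<in>B. a b \<odot>\<^bsub>M\<^esub> b)))"

record ('k, 'v) persistence_module =
  pspace :: "real \<Rightarrow> ('k, 'v) module"
  pmap :: "real \<Rightarrow> real \<Rightarrow> 'v \<Rightarrow> 'v"

definition persistence_iso ::
  "('k, 'v) persistence_module \<Rightarrow> ('k, 'w) persistence_module \<Rightarrow> bool" where
  "persistence_iso M N \<longleftrightarrow>
     (\<exists>\<phi>. (\<forall>t. bij_betw (\<phi> t) (carrier (pspace M t)) (carrier (pspace N t)) \<and>
             (\<forall>x\<in>carrier (pspace M t). \<forall>y\<in>carrier (pspace M t).
                \<phi> t (x \<oplus>\<^bsub>pspace M t\<^esub> y) = \<phi> t x \<oplus>\<^bsub>pspace N t\<^esub> \<phi> t y) \<and>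
             (\<forall>a. \<forall>x\<in>carrier (pspace M t).
                \<phi> t (a \<odot>\<^bsub>pspace M t\<^esub> x) = a \<odot>\<^bsub>pspace N t\<^esub> \<phi> t x)) \<and>
          (\<forall>s t. s \<le> t \<longrightarrow>
             (\<forall>x\<in>carrier (pspace M s). \<phi> t (pmap M s t x) = pmap N s t (\<phi> s x))))"

definition interval_module :: "real set \<Rightarrow> ('k::field, 'k) persistence_module" where
  "interval_module I =
     \<lparr>pspace = (\<lambda>t. \<lparr>carrier = (if t \<in> I then UNIV else {0}), mult = undefined, one = undefined,
                     zero = 0, add = (+), smult = (*)\<rparr>),
      pmap = (\<lambda>s t x. if s \<in> I \<and> t \<in> I then x else 0)\<rparr>"

definition persistence_direct_sum ::
  "'j set \<Rightarrow> ('j \<Rightarrow> ('k, 'v) persistence_module) \<Rightarrow> ('k, 'j \<Rightarrow> 'v) persistence_module" where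
  "persistence_direct_sum J M =
     \<lparr>pspace = (\<lambda>t. \<lparr>carrier = {x \<in> \<Pi>\<^sub>E j\<in>J. carrier (pspace (M j) t).
                               finite {j \<in> J. x j \<noteq> \<zero>\<^bsub>pspace (M j) t\<^esub>}},
                     mult = undefined, one = undefined,
                     zero = (\<lambda>j\<in>J. \<zero>\<^bsub>pspace (M j) t\<^esub>),
                     add = (\<lambda>x y. \<lambda>j\<in>J. x j \<oplus>\<^bsub>pspace (M j) t\<^esub> y j),
                     smult = (\<lambda>a x. \<lambda>j\<in>J. a \<odot>\<^bsub>pspace (M j) t\<^esub> x j)\<rparr>),
      pmap = (\<lambda>s t x. \<lambda>j\<in>J. pmap (M j) s t (x j))\<rparr>"

text \<open>The maps are induced by the inclusions of sublevel sets: a coset of boundaries in the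
  smaller set is sent to the coset of boundaries in the larger one that contains it.\<close>

definition sublevel_homology ::
  "nat \<Rightarrow> 'a topology \<Rightarrow> ('a \<Rightarrow> real) \<Rightarrow>
     ('k::field, ('k, 'a) field_chain set) persistence_module" where
  "sublevel_homology p X f =
     \<lparr>pspace = (\<lambda>t. field_homology p (sublevel X f t)),
      pmap = (\<lambda>s t A. {a + b |a b. a \<in> A \<and> b \<in> field_boundaries p (sublevel X f t)})\<rparr>"

text \<open>A barcode assigns its multiplicity to each interval. It may have infinitely many
  intervals, so it is not a \<open>multiset\<close>. A persistence module determines at most one barcode.\<close>

type_synonym barcode = "real set \<Rightarrow> nat"

definition is_barcode_of :: "barcode \<Rightarrow> ('k::field, 'v) persistence_module \<Rightarrow> bool" where
  "is_barcode_of D M \<longleftrightarrow>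
     (\<forall>I. 0 < D I \<longrightarrow> is_interval I \<and> I \<noteq> {}) \<and>
     persistence_iso M
       (persistence_direct_sum {(I, n). n < D I} (\<lambda>(I, n). interval_module I))"

definition has_PH0 :: "'k::field itself \<Rightarrow> 'a topology \<Rightarrow> ('a \<Rightarrow> real) \<Rightarrow> barcode \<Rightarrow> bool" where
  "has_PH0 K X f D \<longleftrightarrow>
     is_barcode_of D (sublevel_homology 0 X f :: ('k, ('k, 'a) field_chain set) persistence_module)"

definition pfd :: "'k::field itself \<Rightarrow> 'a topology \<Rightarrow> ('a \<Rightarrow> real) \<Rightarrow> bool" where
  "pfd K X f \<longleftrightarrow>
     (\<forall>i t. finite_dimensional
        (field_homology i (sublevel X f t) :: ('k, ('k, 'a) field_chain set) module))"

definition PH_fiber :: "'k::field itself \<Rightarrow> 'a topology \<Rightarrow> barcode \<Rightarrow> ('a \<Rightarrow> real) set" where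
  "PH_fiber K X D =
     {f \<in> extensional (topspace X). continuous_map X euclideanreal f \<and>
        pfd K X f \<and> has_PH0 K X f D}"

text \<open>For compact \<open>X\<close> the metric space \<^term>\<open>cfunspace X euclidean_metric\<close> consists of all
  continuous real functions on \<open>X\<close>.\<close>

definition sup_topology :: "'a topology \<Rightarrow> ('a \<Rightarrow> real) set \<Rightarrow> ('a \<Rightarrow> real) topology" where
  "sup_topology X S = mtopology_of (submetric (cfunspace X euclidean_metric) S)"

text \<open>The library counts the empty space as contractible; here a contractible space is
  nonempty.\<close>

definition contractible_nonempty :: "'a topology \<Rightarrow> bool" where
  "contractible_nonempty X \<longleftrightarrow> topspace X \<noteq> {} \<and> contractible_space X"

end

theory Submission
  imports Defs
begin

text \<open>
  A rooted tree with one leaf is a path, so \<open>\<pi>\<close> maps the merge tree homeomorphically onto a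
  half-line \<open>[m, \<infinity>)\<close> (\<open>one_leaf_merge_tree_homeomorphic\<close>). Both fibres then consist of the
  continuous functions whose sublevel sets are connected, and nonempty exactly from level \<open>m\<close> on.

  For the merge tree this holds because the points of \<open>MT(f)\<close> at height \<open>t\<close> are the
  components of the sublevel set at level \<open>t\<close>: over a half-line there is exactly one of them for
  every \<open>t \<ge> m\<close>, and conversely a function with such sublevel sets has a continuous section of
  the height, given by any of its minima (\<open>isomorphic_MT_iff_connected_sublevels\<close>).

  For the barcode, homology in degree zero counts path components. The persistence module is
  isomorphic to the interval module of \<open>[m, \<infinity>)\<close> if and only if the sublevel sets are path
  connected and nonempty exactly from level \<open>m\<close> on (\<open>persistence_iso_interval_module_iff\<close>); the
  module of \<open>\<pi>\<close> is of this kind, hence so is the module of any function with the same barcode.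
  On a tree connected sets are contractible (\<open>tree_realization_subsets\<close>), so that "connected" and
  "path connected" agree for sublevel sets, and their homology is finite dimensional in every
  degree. The vanishing of the higher homology over the field is derived from integral homology:
  a chain contraction, chosen inductively on the simplices, keeps its defining identity after a
  change of coefficients (\<open>contractible_field_cycle_bounds\<close>).

  Finally, the rescaling \<open>m + s (f - m)\<close> with \<open>s > 0\<close> has the same sublevel sets as \<open>f\<close> up to
  a change of the level, and the constant function \<open>m\<close> has connected sublevel sets, too. So the
  common fibre is star-shaped with centre \<open>m\<close>, and the straight-line homotopy contracts it
  (\<open>contractible_star_shaped_function_space\<close>).
\<close>

section \<open>Chains over a field\<close>

text \<open>Scalar multiplication on finitely supported functions with values in a field.\<close>

abbreviation scale_chain :: "'k::field \<Rightarrow> ('b \<Rightarrow>\<^sub>0 'k) \<Rightarrow> ('b \<Rightarrow>\<^sub>0 'k)" where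
  "scale_chain c x \<equiv> Poly_Mapping.map ((*) c) x"

lemma lookup_scale_chain [simp]:
  "Poly_Mapping.lookup (scale_chain c x) i = c * Poly_Mapping.lookup x i"
  by (simp add: map.rep_eq when_def)

lemma keys_scale_chain_subset: "Poly_Mapping.keys (scale_chain c x) \<subseteq> Poly_Mapping.keys x"
  by (auto simp: in_keys_iff)

lemma scale_chain_add: "scale_chain c (x + y) = scale_chain c x + scale_chain c y"
  by (rule poly_mapping_eqI) (simp add: lookup_add algebra_simps)

lemma scale_chain_sum: "scale_chain c (sum g A) = (\<Sum>i\<in>A. scale_chain c (g i))"
  by (rule poly_mapping_eqI) (simp add: lookup_sum sum_distrib_left)

lemma scale_chain_scale: "scale_chain a (scale_chain b x) = scale_chain (a * b) x"
  by (rule poly_mapping_eqI) (simp add: mult.assoc)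

lemma scale_chain_zero_right [simp]: "scale_chain c 0 = 0"
  by (rule poly_mapping_eqI) simp

lemma scale_chain_one [simp]: "scale_chain 1 x = x"
  by (rule poly_mapping_eqI) simp

text \<open>The linear map with prescribed values on the basis.\<close>

definition extend_linear :: "('b \<Rightarrow> 'a \<Rightarrow>\<^sub>0 'k::field) \<Rightarrow> ('b \<Rightarrow>\<^sub>0 'k) \<Rightarrow> 'a \<Rightarrow>\<^sub>0 'k" where
  "extend_linear b x = (\<Sum>i\<in>Poly_Mapping.keys x. scale_chain (Poly_Mapping.lookup x i) (b i))"

lemma extend_linear_superset:
  assumes "finite A" "Poly_Mapping.keys x \<subseteq> A"
  shows "extend_linear b x = (\<Sum>i\<in>A. scale_chain (Poly_Mapping.lookup x i) (b i))"
  unfolding extend_linear_def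
proof (rule sum.mono_neutral_left)
  show "\<forall>i\<in>A - Poly_Mapping.keys x. scale_chain (Poly_Mapping.lookup x i) (b i) = 0"
    by (auto simp: in_keys_iff intro!: poly_mapping_eqI)
qed (use assms in auto)

lemma extend_linear_add: "extend_linear b (x + y) = extend_linear b x + extend_linear b y"
proof -
  let ?A = "Poly_Mapping.keys x \<union> Poly_Mapping.keys y"
  have "extend_linear b (x + y) = (\<Sum>i\<in>?A. scale_chain (Poly_Mapping.lookup (x + y) i) (b i))"
    by (rule extend_linear_superset) (use keys_add [of x y] in auto)
  also have "\<dots> = (\<Sum>i\<in>?A. scale_chain (Poly_Mapping.lookup x i) (b i)) +
                  (\<Sum>i\<in>?A. scale_chain (Poly_Mapping.lookup y i) (b i))"
    unfolding sum.distrib [symmetric]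
    by (intro sum.cong poly_mapping_eqI) (auto simp: lookup_add algebra_simps)
  also have "\<dots> = extend_linear b x + extend_linear b y"
    by (simp add: extend_linear_superset [of ?A])
  finally show ?thesis .
qed

lemma extend_linear_scale: "extend_linear b (scale_chain c x) = scale_chain c (extend_linear b x)"
proof -
  have "extend_linear b (scale_chain c x) =
      (\<Sum>i\<in>Poly_Mapping.keys x. scale_chain (Poly_Mapping.lookup (scale_chain c x) i) (b i))"
    by (rule extend_linear_superset) (use keys_scale_chain_subset [of c x] in auto)
  then show ?thesis
    by (simp add: extend_linear_def scale_chain_sum scale_chain_scale)
qed

lemma extend_linear_0 [simp]: "extend_linear b 0 = 0"
  by (simp add: extend_linear_def)

lemma extend_linear_diff: "extend_linear b (x - y) = extend_linear b x - extend_linear b y"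
  using extend_linear_add [of b "x - y" y] by simp

lemma extend_linear_sum: "extend_linear b (sum g A) = (\<Sum>i\<in>A. extend_linear b (g i))"
  by (induction A rule: infinite_finite_induct) (auto simp: extend_linear_add)

lemma extend_linear_single [simp]: "extend_linear b (Poly_Mapping.single i c) = scale_chain c (b i)"
  by (cases "c = 0") (auto simp: extend_linear_def intro!: poly_mapping_eqI)

lemma extend_linear_singles: "extend_linear (\<lambda>i. Poly_Mapping.single i 1) x = x"
proof (rule poly_mapping_eqI)
  fix j
  show "Poly_Mapping.lookup (extend_linear (\<lambda>i. Poly_Mapping.single i 1) x) j = Poly_Mapping.lookup x j"
    by (cases "j \<in> Poly_Mapping.keys x")
      (auto simp: extend_linear_def lookup_sum lookup_single when_def in_keys_iff
        if_distrib [of "\<lambda>a. _ * a"] sum.delta cong: if_cong)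
qed

lemma extend_linear_extend_linear:
  "extend_linear f (extend_linear g x) = extend_linear (\<lambda>i. extend_linear f (g i)) x"
  by (simp add: extend_linear_def [of g] extend_linear_def [of "\<lambda>i. extend_linear f (g i)"]
      extend_linear_sum extend_linear_scale)

lemma extend_linear_cong:
  assumes "\<And>i. i \<in> Poly_Mapping.keys x \<Longrightarrow> f i = g i"
  shows "extend_linear f x = extend_linear g x"
  using assms by (simp add: extend_linear_def)

lemma extend_linear_minus_fun:
  "extend_linear (\<lambda>i. f i - g i) x = extend_linear f x - extend_linear g x"
  by (rule poly_mapping_eqI)
    (simp add: extend_linear_def lookup_sum lookup_minus right_diff_distrib sum_subtractf)

lemma keys_extend_linear:
  "Poly_Mapping.keys (extend_linear b x) \<subseteq> (\<Union>i\<in>Poly_Mapping.keys x. Poly_Mapping.keys (b i))"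
  unfolding extend_linear_def
  by (rule order_trans [OF keys_sum]) (use keys_scale_chain_subset in fast)

text \<open>The linear functional with prescribed values on the basis.\<close>

definition weighted_sum :: "('b \<Rightarrow> 'k::field) \<Rightarrow> ('b \<Rightarrow>\<^sub>0 'k) \<Rightarrow> 'k" where
  "weighted_sum w x = (\<Sum>i\<in>Poly_Mapping.keys x. Poly_Mapping.lookup x i * w i)"

lemma weighted_sum_superset:
  assumes "finite A" "Poly_Mapping.keys x \<subseteq> A"
  shows "weighted_sum w x = (\<Sum>i\<in>A. Poly_Mapping.lookup x i * w i)"
  unfolding weighted_sum_def
  by (rule sum.mono_neutral_left) (use assms in \<open>auto simp: in_keys_iff\<close>)

lemma weighted_sum_add: "weighted_sum w (x + y) = weighted_sum w x + weighted_sum w y"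
proof -
  let ?A = "Poly_Mapping.keys x \<union> Poly_Mapping.keys y"
  have "weighted_sum w (x + y) = (\<Sum>i\<in>?A. Poly_Mapping.lookup (x + y) i * w i)"
    by (rule weighted_sum_superset) (use keys_add [of x y] in auto)
  also have "\<dots> = weighted_sum w x + weighted_sum w y"
    by (simp add: weighted_sum_superset [of ?A] lookup_add algebra_simps sum.distrib)
  finally show ?thesis .
qed

lemma weighted_sum_scale: "weighted_sum w (scale_chain c x) = c * weighted_sum w x"
proof -
  have "weighted_sum w (scale_chain c x) =
      (\<Sum>i\<in>Poly_Mapping.keys x. Poly_Mapping.lookup (scale_chain c x) i * w i)"
    by (rule weighted_sum_superset) (use keys_scale_chain_subset [of c x] in auto)
  then show ?thesis
    by (simp add: weighted_sum_def sum_distrib_left mult.assoc)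
qed

lemma weighted_sum_0 [simp]: "weighted_sum w 0 = 0"
  by (simp add: weighted_sum_def)

lemma weighted_sum_diff: "weighted_sum w (x - y) = weighted_sum w x - weighted_sum w y"
  using weighted_sum_add [of w "x - y" y] by simp

lemma weighted_sum_sum: "weighted_sum w (sum g A) = (\<Sum>i\<in>A. weighted_sum w (g i))"
  by (induction A rule: infinite_finite_induct) (auto simp: weighted_sum_add)

lemma weighted_sum_single [simp]: "weighted_sum w (Poly_Mapping.single i c) = c * w i"
  by (cases "c = 0") (auto simp: weighted_sum_def)

text \<open>The change of coefficients from the integers to the field.\<close>

abbreviation of_int_chain :: "('b \<Rightarrow>\<^sub>0 int) \<Rightarrow> ('b \<Rightarrow>\<^sub>0 'k::field)" where
  "of_int_chain c \<equiv> Poly_Mapping.map of_int c"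

lemma lookup_of_int_chain [simp]:
  "Poly_Mapping.lookup (of_int_chain c) i = of_int (Poly_Mapping.lookup c i)"
  by (simp add: map.rep_eq when_def)

lemma of_int_chain_diff: "of_int_chain (a - b) = of_int_chain a - of_int_chain b"
  by (rule poly_mapping_eqI) (simp add: lookup_minus)

lemma of_int_chain_sum: "of_int_chain (sum g A) = (\<Sum>i\<in>A. of_int_chain (g i))"
  by (rule poly_mapping_eqI) (simp add: lookup_sum)

lemma of_int_chain_0 [simp]: "of_int_chain 0 = 0"
  by (rule poly_mapping_eqI) simp

lemma of_int_chain_of [simp]: "of_int_chain (frag_of a) = Poly_Mapping.single a 1"
  by (rule poly_mapping_eqI) (simp add: lookup_single when_def)

lemma keys_of_int_chain: "Poly_Mapping.keys (of_int_chain c) \<subseteq> Poly_Mapping.keys c"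
  by (auto simp: in_keys_iff)

lemma of_int_chain_extend:
  "(of_int_chain (frag_extend f c) :: 'a \<Rightarrow>\<^sub>0 'k::field) =
     extend_linear (\<lambda>i. of_int_chain (f i)) (of_int_chain c)"
  using subset_UNIV [of "Poly_Mapping.keys c"]
  by (induction c rule: frag_induction)
    (auto simp: frag_extend_diff of_int_chain_diff extend_linear_diff)

lemma field_boundary_eq_extend:
  assumes "p \<noteq> 0"
  shows "field_boundary p (c :: ('k::field, 'a) field_chain) =
    extend_linear (\<lambda>\<sigma>. \<Sum>k\<le>p. Poly_Mapping.single (singular_face p k \<sigma>) ((-1) ^ k)) c"
proof -
  have "scale_chain a (\<Sum>k\<le>p. Poly_Mapping.single (singular_face p k \<sigma>) ((-1) ^ k)) =
    (\<Sum>k\<le>p. Poly_Mapping.single (singular_face p k \<sigma>) ((-1) ^ k * a))" for \<sigma> :: "(nat \<Rightarrow> real) \<Rightarrow> 'a" and a :: 'k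
    unfolding scale_chain_sum by (intro sum.cong poly_mapping_eqI) (auto simp: lookup_single when_def)
  then show ?thesis
    using assms by (simp add: field_boundary_def extend_linear_def)
qed

lemma field_boundary_0 [simp]: "field_boundary p 0 = 0"
  by (simp add: field_boundary_def)

lemma field_boundary_add: "field_boundary p (x + y) = field_boundary p x + field_boundary p y"
  by (cases "p = 0") (simp_all add: field_boundary_eq_extend extend_linear_add field_boundary_def [of 0])

lemma field_boundary_scale: "field_boundary p (scale_chain c x) = scale_chain c (field_boundary p x)"
  by (cases "p = 0") (simp_all add: field_boundary_eq_extend extend_linear_scale field_boundary_def [of 0])

lemma field_boundary_of_int_chain:
  "field_boundary p (of_int_chain c :: ('k::field, 'a) field_chain) = of_int_chain (chain_boundary p c)"
proof (cases "p = 0")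
  case False
  have "of_int_chain (frag_cmul ((-1) ^ k) (frag_of x)) = (Poly_Mapping.single x ((-1) ^ k) :: ('k, 'a) field_chain)"
    for k :: nat and x :: "(nat \<Rightarrow> real) \<Rightarrow> 'a"
    by (rule poly_mapping_eqI) (simp add: lookup_single when_def)
  then show ?thesis
    using False
    by (simp add: field_boundary_eq_extend chain_boundary_def of_int_chain_extend of_int_chain_sum)
qed (simp add: field_boundary_def chain_boundary_def)

lemma field_chains_add: "x \<in> field_chains p X \<Longrightarrow> y \<in> field_chains p X \<Longrightarrow> x + y \<in> field_chains p X"
  unfolding field_chains_def using keys_add [of x y] by blast

lemma field_chains_diff: "x \<in> field_chains p X \<Longrightarrow> y \<in> field_chains p X \<Longrightarrow> x - y \<in> field_chains p X"
  unfolding field_chains_def using keys_diff [of x y] by blast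

lemma field_chains_scale: "x \<in> field_chains p X \<Longrightarrow> scale_chain c x \<in> field_chains p X"
  unfolding field_chains_def using keys_scale_chain_subset [of c x] by blast

lemma field_chains_0 [simp]: "0 \<in> field_chains p X"
  by (simp add: field_chains_def)

lemma field_chains_single: "singular_simplex p X \<sigma> \<Longrightarrow> Poly_Mapping.single \<sigma> c \<in> field_chains p X"
  by (simp add: field_chains_def)

lemma field_chains_of_int_chain:
  "singular_chain p X c \<Longrightarrow> of_int_chain c \<in> field_chains p X"
  unfolding field_chains_def singular_chain_def mem_Collect_eq
  by (rule order_trans [OF keys_of_int_chain])

lemma field_chains_extend_linear:
  assumes "c \<in> field_chains p X" "\<And>\<sigma>. singular_simplex p X \<sigma> \<Longrightarrow> f \<sigma> \<in> field_chains q Y"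
  shows "extend_linear f c \<in> field_chains q Y"
  using assms keys_extend_linear [of f c] unfolding field_chains_def by blast

lemma field_chains_mono:
  assumes "S \<subseteq> T"
  shows "field_chains p (subtopology X S) \<subseteq> field_chains p (subtopology X T)"
proof -
  have "singular_simplex_set p (subtopology X S) \<subseteq> singular_simplex_set p (subtopology X T)"
    using assms by (force simp: singular_simplex_def continuous_map_in_subtopology)
  then show ?thesis
    unfolding field_chains_def by blast
qed

section \<open>Vanishing of the higher homology of a contractible space\<close>

text \<open>By homotopy invariance a cycle is homologous to its image under a constant map, and in a
  one-point space every cycle of positive degree bounds.\<close>

lemma contractible_integral_cycle_bounds:
  assumes "contractible_space X" "p \<noteq> 0" and c: "singular_chain p X c" and dc: "chain_boundary p c = 0"
  obtains d where "singular_chain (Suc p) X d" "chain_boundary (Suc p) d = c"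
proof (cases "topspace X = {}")
  case True
  then have "singular_simplex_set p X = {}"
    using nonempty_standard_simplex [of p]
    by (auto simp: singular_simplex_def continuous_map_def topspace_standard_simplex)
  then have "Poly_Mapping.keys c = {}"
    using c unfolding singular_chain_def by blast
  then have "singular_chain (Suc p) X 0" "chain_boundary (Suc p) 0 = c"
    by (simp_all add: singular_chain_def)
  then show ?thesis
    using that by blast
next
  case False
  obtain a where h: "homotopic_with (\<lambda>x. True) X X id (\<lambda>x. a)"
    using assms(1) unfolding contractible_space_def by blast
  have aX: "a \<in> topspace X"
    using homotopic_with_imp_continuous_maps [OF h] False by (auto simp: continuous_map_def)
  have c': "singular_relcycle p X {} c"
    using c dc by (simp add: singular_relcycle singular_chain_def)
  have 1: "homologous_rel p X {} (chain_map p id c) (chain_map p (\<lambda>x. a) c)"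
    by (rule homotopic_imp_homologous_rel_chain_maps [OF _ c']) (use h in \<open>simp add: homotopic_with_def\<close>)
  have *: "continuous_map X (subtopology X {a}) (\<lambda>x. a)"
    using aX by (simp add: continuous_map_in_subtopology)
  have "singular_relcycle p (subtopology X {a}) {} (chain_map p (\<lambda>x. a) c)"
    by (rule singular_relcycle_chain_map [OF c' *]) auto
  then have "singular_relboundary p (subtopology X {a}) {} (chain_map p (\<lambda>x. a) c)"
    using singular_boundary_eq_cycle_singleton [of "subtopology X {a}" a p] aX assms(2) by auto
  then have 2: "singular_relboundary p X {} (chain_map p (\<lambda>x. a) c)"
    by (auto simp: singular_boundary singular_chain_subtopology)
  have "chain_map p id c = c"
    using c by (rule chain_map_ident)
  then have "singular_relboundary p X {} ((c - chain_map p (\<lambda>x. a) c) + chain_map p (\<lambda>x. a) c)"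
    using 1 2 unfolding homologous_rel_def by (intro singular_relboundary_add) auto
  then show ?thesis
    using that by (auto simp: singular_boundary)
qed

lemma chain_boundary_extend:
  "chain_boundary q (frag_extend K c) = frag_extend (\<lambda>i. chain_boundary q (K i)) c"
  using subset_UNIV [of "Poly_Mapping.keys c"]
  by (induction c rule: frag_induction) (auto simp: frag_extend_diff chain_boundary_diff)

lemma frag_extend_minus_fun: "frag_extend (\<lambda>i. f i - g i) c = frag_extend f c - frag_extend g c"
  using subset_UNIV [of "Poly_Mapping.keys c"]
  by (induction c rule: frag_induction) (auto simp: frag_extend_diff)

lemma frag_extend_chain_boundary:
  "frag_extend K (chain_boundary p c) = frag_extend (\<lambda>\<sigma>. frag_extend K (chain_boundary p (frag_of \<sigma>))) c"
  using subset_UNIV [of "Poly_Mapping.keys c"]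
  by (induction c rule: frag_induction) (auto simp: frag_extend_diff chain_boundary_diff)

text \<open>The component \<open>K\<close> of a chain contraction that leads from degree \<open>p\<close> to degree
  \<open>p + 1\<close>, given on the basis of simplices. The condition is the part of the contraction
  identity that mentions no other component: extended linearly, \<open>K\<close> is a section of the
  boundary map over the boundaries of degree \<open>p\<close>.\<close>

definition splits_boundaries ::
  "nat \<Rightarrow> 'a topology \<Rightarrow> (((nat \<Rightarrow> real) \<Rightarrow> 'a) \<Rightarrow> 'a chain) \<Rightarrow> bool" where
  "splits_boundaries p X K \<longleftrightarrow>
     (\<forall>\<sigma>. singular_simplex p X \<sigma> \<longrightarrow> singular_chain (Suc p) X (K \<sigma>)) \<and>
     (\<forall>\<tau>. singular_simplex (Suc p) X \<tau> \<longrightarrow>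
        chain_boundary (Suc p) (frag_extend K (chain_boundary (Suc p) (frag_of \<tau>))) =
        chain_boundary (Suc p) (frag_of \<tau>))"

lemma path_connected_0_simplices_homologous:
  assumes X: "path_connected_space X" "topspace X \<noteq> {}"
  obtains \<sigma>0 K where "singular_simplex 0 X \<sigma>0"
    and "\<And>\<sigma>. singular_simplex 0 X \<sigma> \<Longrightarrow> singular_chain (Suc 0) X (K \<sigma>)"
    and "\<And>\<sigma>. singular_simplex 0 X \<sigma> \<Longrightarrow> chain_boundary (Suc 0) (K \<sigma>) = frag_of \<sigma> - frag_of \<sigma>0"
proof -
  obtain a where a: "a \<in> topspace X"
    using X by blast
  define \<sigma>0 where "\<sigma>0 = restrict (\<lambda>_. a) (standard_simplex 0)"
  have \<sigma>0: "singular_simplex 0 X \<sigma>0"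
    using a unfolding singular_simplex_def \<sigma>0_def
    by (auto intro!: continuous_map_eq [of _ X "\<lambda>_. a"])
  have "\<exists>d. singular_chain (Suc 0) X d \<and> chain_boundary (Suc 0) d = frag_of \<sigma> - frag_of \<sigma>0"
    if "singular_simplex 0 X \<sigma>" for \<sigma>
    using iso_integer_zeroth_homology_group_aux [OF X(1) that \<sigma>0]
    by (simp add: homologous_rel_def singular_boundary)
  then show ?thesis
    using that [OF \<sigma>0] by metis
qed

lemma splits_boundaries_0:
  assumes X: "path_connected_space X" "topspace X \<noteq> {}"
  shows "\<exists>K. splits_boundaries 0 X K"
proof -
  obtain \<sigma>0 K where K: "\<And>\<sigma>. singular_simplex 0 X \<sigma> \<Longrightarrow> singular_chain (Suc 0) X (K \<sigma>)"
    "\<And>\<sigma>. singular_simplex 0 X \<sigma> \<Longrightarrow> chain_boundary (Suc 0) (K \<sigma>) = frag_of \<sigma> - frag_of \<sigma>0"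
    using path_connected_0_simplices_homologous [OF X] by metis
  have "chain_boundary (Suc 0) (frag_extend K (chain_boundary (Suc 0) (frag_of \<tau>))) =
        chain_boundary (Suc 0) (frag_of \<tau>)" if "singular_simplex (Suc 0) X \<tau>" for \<tau>
  proof -
    have "singular_simplex 0 X (singular_face (Suc 0) k \<tau>)" if "k \<le> 1" for k
      using singular_simplex_singular_face [OF \<open>singular_simplex (Suc 0) X \<tau>\<close>, of k] that by simp
    moreover have "chain_boundary (Suc 0) (frag_of \<tau>) =
        frag_of (singular_face (Suc 0) 0 \<tau>) - frag_of (singular_face (Suc 0) 1 \<tau>)"
      by (simp add: chain_boundary_of)
    ultimately show ?thesis
      by (simp add: frag_extend_diff chain_boundary_diff K)
  qed
  then show ?thesis
    using K(1) by (auto simp: splits_boundaries_def)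
qed

text \<open>For a simplex \<open>\<sigma>\<close> the chain \<open>\<sigma> - K (\<partial> \<sigma>)\<close> is a cycle, hence the boundary of some
  \<open>K' \<sigma>\<close>. The equation \<open>\<partial> (K' \<sigma>) = \<sigma> - K (\<partial> \<sigma>)\<close> is an identity between integral chains
  on basis elements, so it survives the passage to any coefficients.\<close>

lemma splits_boundaries_step:
  assumes X: "contractible_space X" and K: "splits_boundaries p X K"
  obtains K' where "\<And>\<sigma>. singular_simplex (Suc p) X \<sigma> \<Longrightarrow> singular_chain (Suc (Suc p)) X (K' \<sigma>)"
    and "\<And>\<sigma>. singular_simplex (Suc p) X \<sigma> \<Longrightarrow> chain_boundary (Suc (Suc p)) (K' \<sigma>) =
           frag_of \<sigma> - frag_extend K (chain_boundary (Suc p) (frag_of \<sigma>))"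
    and "splits_boundaries (Suc p) X K'"
proof -
  have "\<exists>d. singular_chain (Suc (Suc p)) X d \<and> chain_boundary (Suc (Suc p)) d =
           frag_of \<sigma> - frag_extend K (chain_boundary (Suc p) (frag_of \<sigma>))"
    if \<sigma>: "singular_simplex (Suc p) X \<sigma>" for \<sigma>
  proof -
    let ?c = "frag_of \<sigma> - frag_extend K (chain_boundary (Suc p) (frag_of \<sigma>))"
    have c\<sigma>: "singular_chain (Suc p) X (frag_of \<sigma>)"
      using \<sigma> by (simp add: singular_chain_of)
    then have "singular_chain p X (chain_boundary (Suc p) (frag_of \<sigma>))"
      using singular_chain_boundary by fastforce
    then have "singular_chain (Suc p) X (frag_extend K (chain_boundary (Suc p) (frag_of \<sigma>)))"
      using K by (intro singular_chain_extend) (auto simp: splits_boundaries_def singular_chain_def)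
    with c\<sigma> have "singular_chain (Suc p) X ?c"
      by (rule singular_chain_diff)
    moreover have "chain_boundary (Suc p) ?c = 0"
      using K \<sigma> by (simp add: chain_boundary_diff splits_boundaries_def)
    ultimately show ?thesis
      using contractible_integral_cycle_bounds [OF X, of "Suc p" ?c] by blast
  qed
  then obtain K' where K': "\<And>\<sigma>. singular_simplex (Suc p) X \<sigma> \<Longrightarrow> singular_chain (Suc (Suc p)) X (K' \<sigma>)"
    "\<And>\<sigma>. singular_simplex (Suc p) X \<sigma> \<Longrightarrow> chain_boundary (Suc (Suc p)) (K' \<sigma>) =
           frag_of \<sigma> - frag_extend K (chain_boundary (Suc p) (frag_of \<sigma>))"
    by metis
  have "chain_boundary (Suc (Suc p)) (frag_extend K' (chain_boundary (Suc (Suc p)) (frag_of \<tau>))) =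
        chain_boundary (Suc (Suc p)) (frag_of \<tau>)" if \<tau>: "singular_simplex (Suc (Suc p)) X \<tau>" for \<tau>
  proof -
    let ?c = "chain_boundary (Suc (Suc p)) (frag_of \<tau>)"
    have c: "singular_chain (Suc p) X ?c"
      using \<tau> singular_chain_boundary [of "Suc (Suc p)" X "frag_of \<tau>"] by (simp add: singular_chain_of)
    have "chain_boundary (Suc (Suc p)) (frag_extend K' ?c) =
        frag_extend (\<lambda>\<sigma>. frag_of \<sigma> - frag_extend K (chain_boundary (Suc p) (frag_of \<sigma>))) ?c"
      unfolding chain_boundary_extend
      by (rule frag_extend_eq) (use c K'(2) in \<open>auto simp: singular_chain_def\<close>)
    also have "\<dots> = ?c - frag_extend K (chain_boundary (Suc p) ?c)"
      unfolding frag_extend_minus_fun frag_expansion [symmetric]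
      using frag_extend_chain_boundary [of K "Suc p" ?c] by metis
    also have "chain_boundary (Suc p) ?c = 0"
      using chain_boundary_boundary_alt [of "Suc p" X "frag_of \<tau>"] \<tau> by (simp add: singular_chain_of)
    finally show ?thesis
      by simp
  qed
  then show ?thesis
    using that [OF K'] K'(1) unfolding splits_boundaries_def by blast
qed

lemma splits_boundaries_exists:
  assumes "contractible_space X" "topspace X \<noteq> {}"
  shows "\<exists>K. splits_boundaries p X K"
proof (induction p)
  case 0
  show ?case
    using splits_boundaries_0 [OF contractible_imp_path_connected_space] assms by blast
next
  case (Suc p)
  then show ?case
    using splits_boundaries_step [OF assms(1)] by metis
qed

lemma singular_simplex_topspace_empty:
  assumes "topspace X = {}"
  shows "\<not> singular_simplex p X \<sigma>"
  using assms nonempty_standard_simplex [of p]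
  by (auto simp: singular_simplex_def continuous_map_def topspace_standard_simplex)

lemma field_chains_topspace_empty:
  assumes "topspace X = {}"
  shows "field_chains p X = {0}"
proof -
  have "singular_simplex_set p X = {}"
    using singular_simplex_topspace_empty [OF assms] by blast
  then show ?thesis
    unfolding field_chains_def by (simp only: subset_empty keys_eq_empty) simp
qed

text \<open>Applied to a cycle \<open>z\<close> over the field, the contraction identity
  \<open>\<partial> (K' z) = z - K (\<partial> z)\<close> exhibits \<open>z\<close> as a boundary.\<close>

lemma contractible_field_cycle_bounds:
  assumes X: "contractible_space X" and z: "(z :: ('k::field, 'a) field_chain) \<in> field_cycles (Suc p) X"
  shows "z \<in> field_boundaries (Suc p) X"
proof (cases "topspace X = {}")
  case True
  then have "z = field_boundary (Suc (Suc p)) 0"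
    using z by (simp add: field_cycles_def field_chains_topspace_empty)
  then show ?thesis
    unfolding field_boundaries_def by (rule image_eqI) simp
next
  case False
  obtain K where "splits_boundaries p X K"
    using splits_boundaries_exists [OF X False] by blast
  then obtain K' where K': "\<And>\<sigma>. singular_simplex (Suc p) X \<sigma> \<Longrightarrow> singular_chain (Suc (Suc p)) X (K' \<sigma>)"
    "\<And>\<sigma>. singular_simplex (Suc p) X \<sigma> \<Longrightarrow> chain_boundary (Suc (Suc p)) (K' \<sigma>) =
           frag_of \<sigma> - frag_extend K (chain_boundary (Suc p) (frag_of \<sigma>))"
    using splits_boundaries_step [OF X] by metis
  define w where "w = extend_linear (\<lambda>\<sigma>. of_int_chain (K' \<sigma>)) z"
  have zX: "z \<in> field_chains (Suc p) X" and dz: "field_boundary (Suc p) z = 0"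
    using z by (auto simp: field_cycles_def)
  have wX: "w \<in> field_chains (Suc (Suc p)) X"
    unfolding w_def using zX
    by (rule field_chains_extend_linear) (intro field_chains_of_int_chain K'(1))
  have "field_boundary (Suc (Suc p)) w =
      extend_linear (\<lambda>\<sigma>. field_boundary (Suc (Suc p)) (of_int_chain (K' \<sigma>))) z"
    unfolding w_def by (simp add: field_boundary_eq_extend extend_linear_extend_linear)
  also have "\<dots> = extend_linear (\<lambda>\<sigma>. Poly_Mapping.single \<sigma> 1 -
      extend_linear (\<lambda>i. of_int_chain (K i)) (field_boundary (Suc p) (Poly_Mapping.single \<sigma> 1))) z"
  proof (rule extend_linear_cong)
    fix \<sigma> assume "\<sigma> \<in> Poly_Mapping.keys z"
    then have \<sigma>: "singular_simplex (Suc p) X \<sigma>"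
      using zX by (auto simp: field_chains_def)
    have "field_boundary (Suc p) (Poly_Mapping.single \<sigma> (1::'k)) =
        of_int_chain (chain_boundary (Suc p) (frag_of \<sigma>))"
      unfolding field_boundary_of_int_chain [symmetric] by simp
    then show "field_boundary (Suc (Suc p)) (of_int_chain (K' \<sigma>)) = Poly_Mapping.single \<sigma> (1::'k) -
      extend_linear (\<lambda>i. of_int_chain (K i)) (field_boundary (Suc p) (Poly_Mapping.single \<sigma> 1))"
      by (simp add: field_boundary_of_int_chain K'(2) [OF \<sigma>] of_int_chain_diff of_int_chain_extend)
  qed
  also have "\<dots> = z - extend_linear (\<lambda>i. of_int_chain (K i)) (field_boundary (Suc p) z)"
    unfolding extend_linear_minus_fun extend_linear_singles
    by (simp add: field_boundary_eq_extend extend_linear_extend_linear)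
  also have "\<dots> = z"
    by (simp add: dz)
  finally show ?thesis
    unfolding field_boundaries_def using wX by (metis imageI)
qed

section \<open>Homology in degree zero\<close>

lemma field_cycles_0: "field_cycles 0 X = field_chains 0 X"
  by (simp add: field_cycles_def field_boundary_def)

lemma field_boundaries_zero_mem [simp]: "0 \<in> field_boundaries p X"
  unfolding field_boundaries_def by (rule image_eqI [of _ _ 0]) simp_all

lemma field_boundaries_add:
  "x \<in> field_boundaries p X \<Longrightarrow> y \<in> field_boundaries p X \<Longrightarrow> x + y \<in> field_boundaries p X"
  unfolding field_boundaries_def by (auto simp: field_boundary_add [symmetric] intro!: imageI field_chains_add)

lemma field_boundaries_scale:
  "x \<in> field_boundaries p X \<Longrightarrow> scale_chain c x \<in> field_boundaries p X"
  unfolding field_boundaries_def by (auto simp: field_boundary_scale [symmetric] intro!: imageI field_chains_scale)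

lemma field_boundaries_minus: "x \<in> field_boundaries p X \<Longrightarrow> - x \<in> field_boundaries p X"
proof -
  assume "x \<in> field_boundaries p X"
  moreover have "scale_chain (- 1) x = - x"
    by (rule poly_mapping_eqI) simp
  ultimately show ?thesis
    using field_boundaries_scale by metis
qed

lemma field_boundaries_mono:
  assumes "S \<subseteq> T"
  shows "field_boundaries p (subtopology X S) \<subseteq> field_boundaries p (subtopology X T)"
  unfolding field_boundaries_def using field_chains_mono [OF assms] by (rule image_mono)

text \<open>The homology class of a cycle \<open>z\<close>.\<close>

abbreviation homology_coset :: "nat \<Rightarrow> 'a topology \<Rightarrow> ('k::field, 'a) field_chain \<Rightarrow> ('k, 'a) field_chain set" where
  "homology_coset p X z \<equiv> {z + b |b. b \<in> field_boundaries p X}"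

lemma carrier_field_homology:
  "carrier (field_homology p X) = homology_coset p X ` field_cycles p X"
  by (simp add: field_homology_def)

lemma add_homology_coset:
  "homology_coset p X z \<oplus>\<^bsub>field_homology p X\<^esub> homology_coset p X w = homology_coset p X (z + w)"
  (is "?l = ?r")
proof
  show "?l \<subseteq> ?r"
  proof
    fix x assume "x \<in> ?l"
    then obtain b c where "b \<in> field_boundaries p X" "c \<in> field_boundaries p X" "x = (z + b) + (w + c)"
      by (auto simp: field_homology_def)
    then have "b + c \<in> field_boundaries p X" "x = (z + w) + (b + c)"
      by (auto simp: field_boundaries_add algebra_simps)
    then show "x \<in> ?r"
      by blast
  qed
  show "?r \<subseteq> ?l"
  proof
    fix x assume "x \<in> ?r"
    then obtain b where b: "b \<in> field_boundaries p X" "x = (z + b) + (w + 0)"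
      by (auto simp: algebra_simps)
    then have "z + b \<in> homology_coset p X z" "w + 0 \<in> homology_coset p X w"
      using field_boundaries_zero_mem by blast+
    moreover have "?l = {c + d |c d. c \<in> homology_coset p X z \<and> d \<in> homology_coset p X w}"
      by (simp add: field_homology_def)
    ultimately show "x \<in> ?l"
      using b(2) by blast
  qed
qed

lemma smult_homology_coset:
  "a \<odot>\<^bsub>field_homology p X\<^esub> homology_coset p X z = homology_coset p X (scale_chain a z)"
  (is "?l = ?r")
proof
  show "?l \<subseteq> ?r"
  proof
    fix x assume "x \<in> ?l"
    then obtain b c where "b \<in> field_boundaries p X" "c \<in> field_boundaries p X" "x = scale_chain a (z + b) + c"
      by (auto simp: field_homology_def)
    then have "scale_chain a b + c \<in> field_boundaries p X" "x = scale_chain a z + (scale_chain a b + c)"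
      by (auto simp: field_boundaries_add field_boundaries_scale scale_chain_add algebra_simps)
    then show "x \<in> ?r"
      by blast
  qed
  show "?r \<subseteq> ?l"
  proof
    fix x assume "x \<in> ?r"
    then obtain b where b: "b \<in> field_boundaries p X" "x = scale_chain a (z + 0) + b"
      by auto
    moreover have "z + 0 \<in> homology_coset p X z"
      using field_boundaries_zero_mem by blast
    moreover have "?l = {scale_chain a c + d |c d. c \<in> homology_coset p X z \<and> d \<in> field_boundaries p X}"
      by (simp add: field_homology_def)
    ultimately show "x \<in> ?l"
      by blast
  qed
qed

lemma pmap_homology_coset:
  assumes "s \<le> t"
  shows "pmap (sublevel_homology p X f) s t (homology_coset p (sublevel X f s) z) =
    homology_coset p (sublevel X f t) z" (is "?l = ?r")
proof
  have sub: "field_boundaries p (sublevel X f s) \<subseteq> field_boundaries p (sublevel X f t)"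
    unfolding sublevel_def using assms by (intro field_boundaries_mono) auto
  show "?l \<subseteq> ?r"
  proof
    fix x assume "x \<in> ?l"
    then obtain b c where "b \<in> field_boundaries p (sublevel X f s)" "c \<in> field_boundaries p (sublevel X f t)"
      "x = (z + b) + c"
      by (auto simp: sublevel_homology_def)
    then have "b + c \<in> field_boundaries p (sublevel X f t)" "x = z + (b + c)"
      using sub by (auto simp: field_boundaries_add algebra_simps)
    then show "x \<in> ?r"
      by blast
  qed
  show "?r \<subseteq> ?l"
  proof
    fix x assume "x \<in> ?r"
    then obtain b where b: "b \<in> field_boundaries p (sublevel X f t)" "x = (z + 0) + b"
      by auto
    moreover have "z + 0 \<in> homology_coset p (sublevel X f s) z"
      using field_boundaries_zero_mem by blast
    moreover have "?l = {c + d |c d. c \<in> homology_coset p (sublevel X f s) z \<and>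
        d \<in> field_boundaries p (sublevel X f t)}"
      by (simp add: sublevel_homology_def)
    ultimately show "x \<in> ?l"
      by blast
  qed
qed

lemma homology_coset_eq_iff:
  "homology_coset p X z = homology_coset p X w \<longleftrightarrow> z - w \<in> field_boundaries p X"
proof
  assume "homology_coset p X z = homology_coset p X w"
  moreover have "z \<in> homology_coset p X z"
    using field_boundaries_zero_mem by force
  ultimately show "z - w \<in> field_boundaries p X"
    by auto
next
  have *: "homology_coset p X z \<subseteq> homology_coset p X w" if "z - w \<in> field_boundaries p X" for z w
  proof
    fix x assume "x \<in> homology_coset p X z"
    then obtain b where "b \<in> field_boundaries p X" "x = w + ((z - w) + b)"
      by auto
    then show "x \<in> homology_coset p X w"
      using that field_boundaries_add by blast
  qed
  assume "z - w \<in> field_boundaries p X"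
  then show "homology_coset p X z = homology_coset p X w"
    using * [of z w] * [of w z] field_boundaries_minus [of "z - w"] by force
qed

lemma field_homology_closed:
  assumes "A \<in> carrier (field_homology p X)" "B \<in> carrier (field_homology p X)"
  shows "A \<oplus>\<^bsub>field_homology p X\<^esub> B \<in> carrier (field_homology p X)"
    and "a \<odot>\<^bsub>field_homology p X\<^esub> A \<in> carrier (field_homology p X)"
proof -
  obtain z w where zw: "z \<in> field_cycles p X" "w \<in> field_cycles p X"
    and eq: "A = homology_coset p X z" "B = homology_coset p X w"
    using assms unfolding carrier_field_homology by blast
  have "z + w \<in> field_cycles p X" "scale_chain a z \<in> field_cycles p X"
    using zw by (auto simp: field_cycles_def field_chains_add field_chains_scale field_boundary_add field_boundary_scale)
  then show "A \<oplus>\<^bsub>field_homology p X\<^esub> B \<in> carrier (field_homology p X)"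
    "a \<odot>\<^bsub>field_homology p X\<^esub> A \<in> carrier (field_homology p X)"
    unfolding eq add_homology_coset smult_homology_coset unfolding carrier_field_homology by blast+
qed

lemma pmap_sublevel_homology_closed:
  assumes "s \<le> t" "A \<in> carrier (pspace (sublevel_homology p X f) s)"
  shows "pmap (sublevel_homology p X f) s t A \<in> carrier (pspace (sublevel_homology p X f) t)"
proof -
  obtain z where z: "z \<in> field_cycles p (sublevel X f s)" "A = homology_coset p (sublevel X f s) z"
    using assms(2) unfolding sublevel_homology_def by (auto simp: carrier_field_homology)
  have "field_chains p (sublevel X f s) \<subseteq> field_chains p (sublevel X f t)"
    unfolding sublevel_def using assms(1) by (intro field_chains_mono) auto
  then have "z \<in> field_cycles p (sublevel X f t)"
    using z(1) by (auto simp: field_cycles_def)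
  then show ?thesis
    unfolding z(2) pmap_homology_coset [OF assms(1)]
    by (auto simp: sublevel_homology_def carrier_field_homology)
qed

subsection \<open>Linear functionals vanishing on boundaries\<close>

lemma weighted_sum_extend_linear:
  "weighted_sum w (extend_linear f c) = weighted_sum (\<lambda>i. weighted_sum w (f i)) c"
  unfolding extend_linear_def weighted_sum_sum weighted_sum_scale by (simp add: weighted_sum_def)

text \<open>A functional that takes the same value at both ends of every path kills the boundaries.\<close>

lemma weighted_sum_boundary:
  assumes "\<And>\<tau>. singular_simplex (Suc 0) X \<tau> \<Longrightarrow>
      w (singular_face (Suc 0) 0 \<tau>) = w (singular_face (Suc 0) (Suc 0) \<tau>)"
    and "b \<in> field_boundaries 0 X"
  shows "weighted_sum w b = 0"
proof -
  obtain c where c: "c \<in> field_chains (Suc 0) X" "b = field_boundary (Suc 0) c"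
    using assms(2) unfolding field_boundaries_def by blast
  have "weighted_sum w b = weighted_sum (\<lambda>\<tau>. w (singular_face (Suc 0) 0 \<tau>) - w (singular_face (Suc 0) (Suc 0) \<tau>)) c"
    unfolding c(2) by (simp add: field_boundary_eq_extend weighted_sum_extend_linear weighted_sum_add)
  also have "\<dots> = 0"
    using c(1) assms(1) unfolding weighted_sum_def field_chains_def by (intro sum.neutral) auto
  finally show ?thesis .
qed

text \<open>The sum of the coefficients.\<close>

abbreviation augmentation :: "('b \<Rightarrow>\<^sub>0 'k::field) \<Rightarrow> 'k" where
  "augmentation \<equiv> weighted_sum (\<lambda>_. 1)"

lemma extend_linear_const: "extend_linear (\<lambda>_. x) c = scale_chain (augmentation c) x"
  by (rule poly_mapping_eqI) (simp add: extend_linear_def weighted_sum_def lookup_sum sum_distrib_right)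

lemma path_connected_field_boundaries_0:
  assumes X: "path_connected_space X"
  shows "field_boundaries 0 X = {c \<in> field_chains 0 X. augmentation (c :: ('k::field, 'a) field_chain) = 0}"
proof (cases "topspace X = {}")
  case True
  have "field_boundaries 0 X = {0 :: ('k, 'a) field_chain}"
    unfolding field_boundaries_def field_chains_topspace_empty [OF True] by simp
  moreover have "{c \<in> field_chains 0 X. augmentation c = 0} = {0 :: ('k, 'a) field_chain}"
    unfolding field_chains_topspace_empty [OF True] using weighted_sum_0 by blast
  ultimately show ?thesis
    by simp
next
  case False
  have "b \<in> field_chains 0 X" if b: "b \<in> field_boundaries 0 X" for b :: "('k, 'a) field_chain"
  proof -
    obtain c where c: "c \<in> field_chains (Suc 0) X" "b = field_boundary (Suc 0) c"
      using b unfolding field_boundaries_def by blast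
    show ?thesis
      unfolding c(2) field_boundary_eq_extend [OF Suc_not_Zero]
    proof (rule field_chains_extend_linear [OF c(1)])
      fix \<tau> assume "singular_simplex (Suc 0) X \<tau>"
      then have "singular_simplex 0 X (singular_face (Suc 0) k \<tau>)" if "k \<le> 1" for k
        using that singular_simplex_singular_face [of "Suc 0" X \<tau> k] by simp
      then show "(\<Sum>k\<le>Suc 0. Poly_Mapping.single (singular_face (Suc 0) k \<tau>) ((- 1) ^ k)) \<in> (field_chains 0 X :: ('k, 'a) field_chain set)"
        by (simp add: field_chains_add field_chains_single)
    qed
  qed
  moreover have "augmentation b = 0" if "b \<in> field_boundaries 0 X" for b :: "('k, 'a) field_chain"
    by (rule weighted_sum_boundary [OF _ that]) simp
  moreover have "c \<in> field_boundaries 0 X" if c: "c \<in> field_chains 0 X" "augmentation c = 0" for c :: "('k, 'a) field_chain"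
  proof -
    obtain \<sigma>0 K where K: "\<And>\<sigma>. singular_simplex 0 X \<sigma> \<Longrightarrow> singular_chain (Suc 0) X (K \<sigma>)"
      "\<And>\<sigma>. singular_simplex 0 X \<sigma> \<Longrightarrow> chain_boundary (Suc 0) (K \<sigma>) = frag_of \<sigma> - frag_of \<sigma>0"
      using path_connected_0_simplices_homologous [OF X False] by metis
    have "field_boundary (Suc 0) (extend_linear (\<lambda>\<sigma>. of_int_chain (K \<sigma>)) c) =
        extend_linear (\<lambda>\<sigma>. field_boundary (Suc 0) (of_int_chain (K \<sigma>))) c"
      by (simp add: field_boundary_eq_extend extend_linear_extend_linear)
    also have "\<dots> = extend_linear (\<lambda>\<sigma>. Poly_Mapping.single \<sigma> 1 - Poly_Mapping.single \<sigma>0 1) c"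
      by (rule extend_linear_cong)
        (use c K(2) in \<open>auto simp: field_chains_def field_boundary_of_int_chain of_int_chain_diff\<close>)
    also have "\<dots> = c"
      unfolding extend_linear_minus_fun extend_linear_singles extend_linear_const c(2)
      by (intro poly_mapping_eqI) (simp add: lookup_minus)
    finally have eq: "field_boundary (Suc 0) (extend_linear (\<lambda>\<sigma>. of_int_chain (K \<sigma>)) c) = c" .
    have "extend_linear (\<lambda>\<sigma>. of_int_chain (K \<sigma>)) c \<in> field_chains (Suc 0) X"
      using c(1) by (rule field_chains_extend_linear) (intro field_chains_of_int_chain K(1))
    then have "field_boundary (Suc 0) (extend_linear (\<lambda>\<sigma>. of_int_chain (K \<sigma>)) c) \<in> field_boundaries 0 X"
      unfolding field_boundaries_def by (rule imageI)
    then show ?thesis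
      unfolding eq .
  qed
  ultimately show ?thesis
    by blast
qed

lemma path_connected_homology_coset:
  assumes X: "path_connected_space X" and z: "z \<in> field_chains 0 X"
  shows "homology_coset 0 X z = {c \<in> field_chains 0 X. augmentation c = augmentation z}"
    (is "?l = ?r")
proof
  note bd = path_connected_field_boundaries_0 [OF X]
  show "?l \<subseteq> ?r"
    using z field_chains_add unfolding bd by (auto simp: weighted_sum_add)
  show "?r \<subseteq> ?l"
  proof
    fix c assume "c \<in> ?r"
    then have "c - z \<in> field_boundaries 0 X" "c = z + (c - z)"
      using z unfolding bd by (auto simp: weighted_sum_diff field_chains_diff)
    then show "c \<in> ?l"
      by blast
  qed
qed

section \<open>Sublevel sets detected by homology in degree zero\<close>

text \<open>All sublevel sets are path connected, and those at level \<open>m\<close> or higher are exactly the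
  nonempty ones. The empty space counts as path connected.\<close>

definition path_connected_sublevels :: "'a topology \<Rightarrow> ('a \<Rightarrow> real) \<Rightarrow> real \<Rightarrow> bool" where
  "path_connected_sublevels X f m \<longleftrightarrow>
     (\<forall>t. path_connected_space (sublevel X f t)) \<and>
     (\<forall>t. topspace (sublevel X f t) \<noteq> {} \<longleftrightarrow> m \<le> t)"

lemma augmentation_range:
  assumes "topspace X \<noteq> {}"
  shows "\<exists>z \<in> field_chains 0 X. augmentation z = (a::'k::field)"
proof -
  obtain x where "x \<in> topspace X"
    using assms by blast
  then have "singular_simplex 0 X (restrict (\<lambda>_. x) (standard_simplex 0))"
    unfolding singular_simplex_def by (auto intro!: continuous_map_eq [of _ X "\<lambda>_. x"])
  then have "Poly_Mapping.single (restrict (\<lambda>_. x) (standard_simplex 0)) a \<in> field_chains 0 X"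
    by (rule field_chains_single)
  then show ?thesis
    by (rule bexI [rotated]) simp
qed

text \<open>The augmentation identifies the homology of a nonempty path-connected space with the field,
  compatibly with inclusions.\<close>

lemma persistence_iso_interval_module:
  assumes "path_connected_sublevels X f m"
  shows "persistence_iso
    (sublevel_homology 0 X f :: ('k::field, ('k, 'a) field_chain set) persistence_module)
    (interval_module {m..})"
proof -
  have pc: "path_connected_space (sublevel X f t)" for t
    using assms by (simp add: path_connected_sublevels_def)
  have ne: "topspace (sublevel X f t) \<noteq> {} \<longleftrightarrow> m \<le> t" for t
    using assms by (simp add: path_connected_sublevels_def)
  define \<phi> :: "('k, 'a) field_chain set \<Rightarrow> 'k" where "\<phi> A = the_elem (augmentation ` A)" for A
  have \<phi>: "\<phi> (homology_coset 0 (sublevel X f t) z) = augmentation z" if z: "z \<in> field_chains 0 (sublevel X f t)" for t z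
  proof -
    have "augmentation ` homology_coset 0 (sublevel X f t) z = {augmentation z}"
      unfolding path_connected_homology_coset [OF pc z] using z by auto
    then show ?thesis
      by (simp add: \<phi>_def)
  qed
  have H: "pspace (sublevel_homology 0 X f) t = field_homology 0 (sublevel X f t)" for t
    by (simp add: sublevel_homology_def)
  have N: "carrier (pspace (interval_module {m..}) t) = (if m \<le> t then UNIV else {0 :: 'k})"
    "x \<oplus>\<^bsub>pspace (interval_module {m..}) t\<^esub> y = x + (y::'k)"
    "x \<odot>\<^bsub>pspace (interval_module {m..}) t\<^esub> y = x * (y::'k)"
    "pmap (interval_module {m..}) s t x = (if m \<le> s \<and> m \<le> t then x else 0)" for s t x y
    by (simp_all add: interval_module_def)
  have bij: "bij_betw \<phi> (carrier (field_homology 0 (sublevel X f t)))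
      (if m \<le> t then UNIV else {0})" for t
    unfolding carrier_field_homology field_cycles_0
  proof (rule bij_betw_imageI)
    let ?Y = "sublevel X f t"
    show "inj_on \<phi> (homology_coset 0 ?Y ` field_chains 0 ?Y)"
    proof (rule inj_onI, elim imageE)
      fix A B z w
      assume *: "\<phi> A = \<phi> B" "A = homology_coset 0 ?Y z" "z \<in> field_chains 0 ?Y"
        "B = homology_coset 0 ?Y w" "w \<in> field_chains 0 ?Y"
      then have "augmentation z = augmentation w"
        by (simp add: \<phi>)
      then show "A = B"
        unfolding *(2,4) path_connected_homology_coset [OF pc *(3)] path_connected_homology_coset [OF pc *(5)] by simp
    qed
    have "\<phi> ` homology_coset 0 ?Y ` field_chains 0 ?Y = augmentation ` field_chains 0 ?Y"
      unfolding image_image by (rule image_cong) (simp_all add: \<phi>)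
    also have "\<dots> = (if m \<le> t then UNIV else {0})"
    proof (cases "m \<le> t")
      case True
      then have "a \<in> augmentation ` field_chains 0 ?Y" for a :: 'k
        using augmentation_range [of ?Y a] ne by blast
      then show ?thesis
        using True by (auto simp: UNIV_eq_I)
    next
      case False
      then show ?thesis
        using ne [of t] by (auto simp: field_chains_topspace_empty)
    qed
    finally show "\<phi> ` homology_coset 0 ?Y ` field_chains 0 ?Y = (if m \<le> t then UNIV else {0})" .
  qed
  have add: "\<phi> (A \<oplus>\<^bsub>field_homology 0 (sublevel X f t)\<^esub> B) = \<phi> A + \<phi> B"
    and scale: "\<phi> (a \<odot>\<^bsub>field_homology 0 (sublevel X f t)\<^esub> A) = a * \<phi> A"
    if AB: "A \<in> carrier (field_homology 0 (sublevel X f t))" "B \<in> carrier (field_homology 0 (sublevel X f t))"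
    for t A B a
  proof -
    obtain z w where "z \<in> field_chains 0 (sublevel X f t)" "w \<in> field_chains 0 (sublevel X f t)"
      "A = homology_coset 0 (sublevel X f t) z" "B = homology_coset 0 (sublevel X f t) w"
      using AB unfolding carrier_field_homology field_cycles_0 by blast
    then show "\<phi> (A \<oplus>\<^bsub>field_homology 0 (sublevel X f t)\<^esub> B) = \<phi> A + \<phi> B"
      "\<phi> (a \<odot>\<^bsub>field_homology 0 (sublevel X f t)\<^esub> A) = a * \<phi> A"
      by (simp_all only: add_homology_coset smult_homology_coset \<phi> field_chains_add
          field_chains_scale weighted_sum_add weighted_sum_scale)
  qed
  have nat: "\<phi> (pmap (sublevel_homology 0 X f) s t A) = (if m \<le> s \<and> m \<le> t then \<phi> A else 0)"
    if "s \<le> t" and A: "A \<in> carrier (field_homology 0 (sublevel X f s))" for s t A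
  proof -
    obtain z where z: "z \<in> field_chains 0 (sublevel X f s)" "A = homology_coset 0 (sublevel X f s) z"
      using A unfolding carrier_field_homology field_cycles_0 by blast
    have "field_chains 0 (sublevel X f s) \<subseteq> field_chains 0 (sublevel X f t)"
      unfolding sublevel_def using \<open>s \<le> t\<close> by (intro field_chains_mono) auto
    then have zt: "z \<in> field_chains 0 (sublevel X f t)"
      using z by blast
    have "augmentation z = 0" if "\<not> m \<le> s"
      using z(1) that ne [of s] by (simp add: field_chains_topspace_empty)
    then show ?thesis
      unfolding z(2) pmap_homology_coset [OF \<open>s \<le> t\<close>] \<phi> [OF zt] \<phi> [OF z(1)] using \<open>s \<le> t\<close> by auto
  qed
  show ?thesis
    unfolding persistence_iso_def H N
    using bij add scale nat by (intro exI [of _ "\<lambda>_. \<phi>"]) blast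
qed

lemma persistence_iso_trans:
  assumes "persistence_iso M N" "persistence_iso N P"
  shows "persistence_iso M P"
proof -
  obtain \<phi> where
    \<phi>: "\<And>t. bij_betw (\<phi> t) (carrier (pspace M t)) (carrier (pspace N t))"
      "\<And>t x y. x \<in> carrier (pspace M t) \<Longrightarrow> y \<in> carrier (pspace M t) \<Longrightarrow>
        \<phi> t (x \<oplus>\<^bsub>pspace M t\<^esub> y) = \<phi> t x \<oplus>\<^bsub>pspace N t\<^esub> \<phi> t y"
      "\<And>t a x. x \<in> carrier (pspace M t) \<Longrightarrow>
        \<phi> t (a \<odot>\<^bsub>pspace M t\<^esub> x) = a \<odot>\<^bsub>pspace N t\<^esub> \<phi> t x"
      "\<And>s t x. s \<le> t \<Longrightarrow> x \<in> carrier (pspace M s) \<Longrightarrow>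
        \<phi> t (pmap M s t x) = pmap N s t (\<phi> s x)"
    using assms(1) unfolding persistence_iso_def by blast
  obtain \<psi> where
    \<psi>: "\<And>t. bij_betw (\<psi> t) (carrier (pspace N t)) (carrier (pspace P t))"
      "\<And>t x y. x \<in> carrier (pspace N t) \<Longrightarrow> y \<in> carrier (pspace N t) \<Longrightarrow>
        \<psi> t (x \<oplus>\<^bsub>pspace N t\<^esub> y) = \<psi> t x \<oplus>\<^bsub>pspace P t\<^esub> \<psi> t y"
      "\<And>t a x. x \<in> carrier (pspace N t) \<Longrightarrow>
        \<psi> t (a \<odot>\<^bsub>pspace N t\<^esub> x) = a \<odot>\<^bsub>pspace P t\<^esub> \<psi> t x"
      "\<And>s t x. s \<le> t \<Longrightarrow> x \<in> carrier (pspace N s) \<Longrightarrow>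
        \<psi> t (pmap N s t x) = pmap P s t (\<psi> s x)"
    using assms(2) unfolding persistence_iso_def by blast
  have [simp]: "\<phi> t x \<in> carrier (pspace N t)" if "x \<in> carrier (pspace M t)" for t x
    using \<phi>(1) [of t] that bij_betwE by blast
  show ?thesis
    unfolding persistence_iso_def
  proof (rule exI [of _ "\<lambda>t. \<psi> t \<circ> \<phi> t"], intro conjI allI ballI impI)
    show "bij_betw (\<psi> t \<circ> \<phi> t) (carrier (pspace M t)) (carrier (pspace P t))" for t
      using \<phi>(1) \<psi>(1) by (rule bij_betw_trans)
  qed (simp_all add: \<phi> \<psi>)
qed

text \<open>Two modules isomorphic to the same third one are isomorphic. The target \<open>N\<close> is not
  assumed to be closed under its operations.\<close>

lemma persistence_iso_cospan:
  assumes "persistence_iso M N" "persistence_iso P N"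
    and closed: "\<And>t x y. x \<in> carrier (pspace P t) \<Longrightarrow> y \<in> carrier (pspace P t) \<Longrightarrow>
        x \<oplus>\<^bsub>pspace P t\<^esub> y \<in> carrier (pspace P t)"
      "\<And>t a x. x \<in> carrier (pspace P t) \<Longrightarrow> a \<odot>\<^bsub>pspace P t\<^esub> x \<in> carrier (pspace P t)"
      "\<And>s t x. s \<le> t \<Longrightarrow> x \<in> carrier (pspace P s) \<Longrightarrow> pmap P s t x \<in> carrier (pspace P t)"
  shows "persistence_iso M P"
proof -
  obtain \<phi> where
    \<phi>: "\<And>t. bij_betw (\<phi> t) (carrier (pspace M t)) (carrier (pspace N t))"
      "\<And>t x y. x \<in> carrier (pspace M t) \<Longrightarrow> y \<in> carrier (pspace M t) \<Longrightarrow>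
        \<phi> t (x \<oplus>\<^bsub>pspace M t\<^esub> y) = \<phi> t x \<oplus>\<^bsub>pspace N t\<^esub> \<phi> t y"
      "\<And>t a x. x \<in> carrier (pspace M t) \<Longrightarrow>
        \<phi> t (a \<odot>\<^bsub>pspace M t\<^esub> x) = a \<odot>\<^bsub>pspace N t\<^esub> \<phi> t x"
      "\<And>s t x. s \<le> t \<Longrightarrow> x \<in> carrier (pspace M s) \<Longrightarrow>
        \<phi> t (pmap M s t x) = pmap N s t (\<phi> s x)"
    using assms(1) unfolding persistence_iso_def by blast
  obtain \<psi> where
    \<psi>: "\<And>t. bij_betw (\<psi> t) (carrier (pspace P t)) (carrier (pspace N t))"
      "\<And>t x y. x \<in> carrier (pspace P t) \<Longrightarrow> y \<in> carrier (pspace P t) \<Longrightarrow>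
        \<psi> t (x \<oplus>\<^bsub>pspace P t\<^esub> y) = \<psi> t x \<oplus>\<^bsub>pspace N t\<^esub> \<psi> t y"
      "\<And>t a x. x \<in> carrier (pspace P t) \<Longrightarrow>
        \<psi> t (a \<odot>\<^bsub>pspace P t\<^esub> x) = a \<odot>\<^bsub>pspace N t\<^esub> \<psi> t x"
      "\<And>s t x. s \<le> t \<Longrightarrow> x \<in> carrier (pspace P s) \<Longrightarrow>
        \<psi> t (pmap P s t x) = pmap N s t (\<psi> s x)"
    using assms(2) unfolding persistence_iso_def by blast
  define \<theta> where "\<theta> t = inv_into (carrier (pspace P t)) (\<psi> t)" for t
  have \<theta>_bij: "bij_betw (\<theta> t) (carrier (pspace N t)) (carrier (pspace P t))" for t
    unfolding \<theta>_def using \<psi>(1) by (rule bij_betw_inv_into)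
  have \<phi>_in: "\<phi> t x \<in> carrier (pspace N t)" if "x \<in> carrier (pspace M t)" for t x
    using \<phi>(1) [of t] that bij_betwE by blast
  have \<theta>_in: "\<theta> t (\<phi> t x) \<in> carrier (pspace P t)" if "x \<in> carrier (pspace M t)" for t x
    using \<theta>_bij [of t] \<phi>_in [OF that] bij_betwE by blast
  have \<psi>_\<theta>: "\<psi> t (\<theta> t (\<phi> t x)) = \<phi> t x" if "x \<in> carrier (pspace M t)" for t x
    unfolding \<theta>_def using \<psi>(1) [of t] \<phi>_in [OF that] by (rule bij_betw_inv_into_right)
  have \<theta>I: "\<theta> t y = z" if "z \<in> carrier (pspace P t)" "\<psi> t z = y" for t y z
    unfolding \<theta>_def using \<psi>(1) [of t] that by (auto simp: bij_betw_def)
  show ?thesis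
    unfolding persistence_iso_def
  proof (rule exI [of _ "\<lambda>t. \<theta> t \<circ> \<phi> t"], intro conjI allI ballI impI)
    show "bij_betw (\<theta> t \<circ> \<phi> t) (carrier (pspace M t)) (carrier (pspace P t))" for t
      using \<phi>(1) \<theta>_bij by (rule bij_betw_trans)
  next
    fix t x y assume "x \<in> carrier (pspace M t)" "y \<in> carrier (pspace M t)"
    then show "(\<theta> t \<circ> \<phi> t) (x \<oplus>\<^bsub>pspace M t\<^esub> y) = (\<theta> t \<circ> \<phi> t) x \<oplus>\<^bsub>pspace P t\<^esub> (\<theta> t \<circ> \<phi> t) y"
      unfolding comp_def by (intro \<theta>I) (simp_all add: closed \<theta>_in \<psi>_\<theta> \<psi>(2) \<phi>(2))
  next
    fix t a x assume "x \<in> carrier (pspace M t)"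
    then show "(\<theta> t \<circ> \<phi> t) (a \<odot>\<^bsub>pspace M t\<^esub> x) = a \<odot>\<^bsub>pspace P t\<^esub> (\<theta> t \<circ> \<phi> t) x"
      unfolding comp_def by (intro \<theta>I) (simp_all add: closed \<theta>_in \<psi>_\<theta> \<psi>(3) \<phi>(3))
  next
    fix s t :: real and x assume "s \<le> t" "x \<in> carrier (pspace M s)"
    then show "(\<theta> t \<circ> \<phi> t) (pmap M s t x) = pmap P s t ((\<theta> s \<circ> \<phi> s) x)"
      unfolding comp_def by (intro \<theta>I) (simp_all add: closed \<theta>_in \<psi>_\<theta> \<psi>(4) \<phi>(4))
  qed
qed

lemma persistence_iso_sublevel_homology_cospan:
  assumes "persistence_iso M N" "persistence_iso (sublevel_homology p X f) N"
  shows "persistence_iso M (sublevel_homology p X f)"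
proof (rule persistence_iso_cospan [OF assms])
  have H: "pspace (sublevel_homology p X f) t = field_homology p (sublevel X f t)" for t
    by (simp add: sublevel_homology_def)
  show "x \<oplus>\<^bsub>pspace (sublevel_homology p X f) t\<^esub> y \<in> carrier (pspace (sublevel_homology p X f) t)"
    if "x \<in> carrier (pspace (sublevel_homology p X f) t)"
      "y \<in> carrier (pspace (sublevel_homology p X f) t)" for t x y
    using field_homology_closed(1) that unfolding H .
  show "a \<odot>\<^bsub>pspace (sublevel_homology p X f) t\<^esub> x \<in> carrier (pspace (sublevel_homology p X f) t)"
    if "x \<in> carrier (pspace (sublevel_homology p X f) t)" for t a x
    using field_homology_closed(2) that unfolding H by blast
qed (rule pmap_sublevel_homology_closed)

text \<open>The vertex of the standard \<open>0\<close>-simplex.\<close>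

abbreviation simplex_vertex :: "nat \<Rightarrow> real" where
  "simplex_vertex \<equiv> (\<lambda>j. if j = 0 then 1 else 0)"

lemma faces_in_same_path_component:
  assumes \<tau>: "singular_simplex (Suc 0) X \<tau>" and k: "k \<le> 1" and l: "l \<le> 1"
  shows "path_component_of X (singular_face (Suc 0) k \<tau> simplex_vertex) (singular_face (Suc 0) l \<tau> simplex_vertex)"
proof -
  have v: "simplex_vertex \<in> standard_simplex 0"
    by (simp add: standard_simplex_0)
  have "simplical_face k simplex_vertex \<in> standard_simplex (Suc 0)" if "k \<le> 1" for k
    using simplical_face_in_standard_simplex [of "Suc 0" k simplex_vertex] v that by simp
  moreover have "path_connectedin X (\<tau> ` standard_simplex (Suc 0))"
    using \<tau> unfolding singular_simplex_def
    by (intro path_connectedin_continuous_map_image [where X = "subtopology (powertop_real UNIV) (standard_simplex (Suc 0))"])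
      (auto simp: path_connectedin_subtopology path_connectedin_standard_simplex)
  ultimately show ?thesis
    using k l v unfolding singular_face_def
    by (intro path_component_of_maximal [THEN subsetD, of X "\<tau> ` standard_simplex (Suc 0)", unfolded mem_Collect_eq]) auto
qed

text \<open>In a one-dimensional homology space the classes of two points \<open>x\<close>, \<open>y\<close> are proportional,
  and the augmentation forces the factor \<open>1\<close>. So the two points are homologous, and the
  functional that counts the points in the path component of \<open>x\<close> also takes the value \<open>1\<close>
  at \<open>y\<close>.\<close>

lemma path_connected_sublevels_of_persistence_iso:
  assumes "persistence_iso
    (sublevel_homology 0 X f :: ('k::field, ('k, 'a) field_chain set) persistence_module)
    (interval_module {m..})"
  shows "path_connected_sublevels X f m"
proof -
  obtain \<phi> :: "real \<Rightarrow> ('k, 'a) field_chain set \<Rightarrow> 'k" where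
    bij: "\<And>t. bij_betw (\<phi> t) (carrier (field_homology 0 (sublevel X f t))) (if m \<le> t then UNIV else {0})"
    and scale: "\<And>t a A. A \<in> carrier (field_homology 0 (sublevel X f t)) \<Longrightarrow>
        \<phi> t (a \<odot>\<^bsub>field_homology 0 (sublevel X f t)\<^esub> A) = a * \<phi> t A"
    using assms unfolding persistence_iso_def by (force simp: sublevel_homology_def interval_module_def)
  define point where "point x = restrict (\<lambda>_. x) (standard_simplex 0)" for x :: 'a
  have point: "singular_simplex 0 Y (point x)" if "x \<in> topspace Y" for x Y
    using that unfolding singular_simplex_def point_def
    by (auto intro!: continuous_map_eq [of _ Y "\<lambda>_. x"])
  have point_v: "point x simplex_vertex = x" for x
    by (simp add: point_def standard_simplex_0)
  let ?\<sigma> = "\<lambda>x. Poly_Mapping.single (point x) (1 :: 'k)"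
  have carr: "homology_coset 0 Y (?\<sigma> x) \<in> carrier (field_homology 0 Y)" if "x \<in> topspace Y" for x Y
    using point [OF that] unfolding carrier_field_homology field_cycles_0 by (intro imageI field_chains_single)
  have aug0: "augmentation b = 0" if "b \<in> field_boundaries 0 Y" for b :: "('k, 'a) field_chain" and Y
    by (rule weighted_sum_boundary [OF _ that]) simp
  have ne: "topspace (sublevel X f t) \<noteq> {} \<longleftrightarrow> m \<le> t" for t
  proof
    let ?Y = "sublevel X f t"
    assume "topspace ?Y \<noteq> {}"
    then obtain x where x: "x \<in> topspace ?Y"
      by blast
    have zero: "homology_coset 0 ?Y 0 \<in> carrier (field_homology 0 ?Y)"
      unfolding carrier_field_homology field_cycles_0 by (intro imageI field_chains_0)
    show "m \<le> t"
    proof (rule ccontr)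
      assume "\<not> m \<le> t"
      then have *: "\<phi> t A = 0" if "A \<in> carrier (field_homology 0 ?Y)" for A
        using bij_betwE [OF bij [of t]] that by simp
      have "\<phi> t (homology_coset 0 ?Y (?\<sigma> x)) = \<phi> t (homology_coset 0 ?Y 0)"
        by (rule trans [OF * [OF carr [OF x]] * [OF zero, symmetric]])
      then have "homology_coset 0 ?Y (?\<sigma> x) = homology_coset 0 ?Y 0"
        by (rule inj_onD [OF bij_betw_imp_inj_on [OF bij [of t]] _ carr [OF x] zero])
      then have "?\<sigma> x - 0 \<in> field_boundaries 0 ?Y"
        unfolding homology_coset_eq_iff .
      then show False
        using aug0 [of "?\<sigma> x" ?Y] by simp
    qed
  next
    let ?Y = "sublevel X f t"
    assume mt: "m \<le> t"
    show "topspace ?Y \<noteq> {}"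
    proof
      assume "topspace ?Y = {}"
      then have "carrier (field_homology 0 ?Y) = {homology_coset 0 ?Y (0 :: ('k, 'a) field_chain)}"
        unfolding carrier_field_homology field_cycles_0 by (simp only: field_chains_topspace_empty image_insert image_empty)
      then have "{\<phi> t (homology_coset 0 ?Y 0)} = UNIV"
        using bij [of t] mt by (auto simp: bij_betw_def)
      then have "(0::'k) = \<phi> t (homology_coset 0 ?Y 0)" "(1::'k) = \<phi> t (homology_coset 0 ?Y 0)"
        by blast+
      then show False
        by (metis zero_neq_one)
    qed
  qed
  have "path_connected_space (sublevel X f t)" for t
    unfolding path_connected_space_iff_path_component
  proof (intro ballI)
    let ?Y = "sublevel X f t"
    fix x y assume x: "x \<in> topspace ?Y" and y: "y \<in> topspace ?Y"
    then have mt: "m \<le> t"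
      using ne by blast
    let ?a = "\<phi> t (homology_coset 0 ?Y (?\<sigma> x))" and ?b = "\<phi> t (homology_coset 0 ?Y (?\<sigma> y))"
    have inj: "inj_on (\<phi> t) (carrier (field_homology 0 ?Y))"
      using bij [of t] by (rule bij_betw_imp_inj_on)
    have \<phi>_scale: "\<phi> t (homology_coset 0 ?Y (scale_chain c (?\<sigma> x))) = c * ?a" for c
      using scale [OF carr [OF x]] unfolding smult_homology_coset .
    have carr_scale: "homology_coset 0 ?Y (scale_chain c (?\<sigma> x)) \<in> carrier (field_homology 0 ?Y)" for c
      unfolding smult_homology_coset [symmetric] by (rule field_homology_closed [OF carr [OF x] carr [OF x]])
    have "?a \<noteq> 0"
    proof
      assume "?a = 0"
      then have "\<phi> t (homology_coset 0 ?Y (scale_chain 0 (?\<sigma> x))) = ?a"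
        unfolding \<phi>_scale by simp
      then have "homology_coset 0 ?Y (scale_chain 0 (?\<sigma> x)) = homology_coset 0 ?Y (?\<sigma> x)"
        by (rule inj_onD [OF inj _ carr_scale carr [OF x]])
      then have "scale_chain 0 (?\<sigma> x) - ?\<sigma> x \<in> field_boundaries 0 ?Y"
        unfolding homology_coset_eq_iff .
      then have "augmentation (scale_chain 0 (?\<sigma> x) - ?\<sigma> x) = 0"
        by (rule aug0)
      then show False
        unfolding weighted_sum_diff weighted_sum_scale by simp
    qed
    define c where "c = ?b / ?a"
    have "\<phi> t (homology_coset 0 ?Y (scale_chain c (?\<sigma> x))) = ?b"
      unfolding \<phi>_scale c_def using \<open>?a \<noteq> 0\<close> by simp
    then have "homology_coset 0 ?Y (scale_chain c (?\<sigma> x)) = homology_coset 0 ?Y (?\<sigma> y)"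
      by (rule inj_onD [OF inj _ carr_scale carr [OF y]])
    then have bd: "scale_chain c (?\<sigma> x) - ?\<sigma> y \<in> field_boundaries 0 ?Y"
      unfolding homology_coset_eq_iff .
    have "augmentation (scale_chain c (?\<sigma> x) - ?\<sigma> y) = 0"
      using bd by (rule aug0)
    then have c: "c = 1"
      unfolding weighted_sum_diff weighted_sum_scale by simp
    define w :: "((nat \<Rightarrow> real) \<Rightarrow> 'a) \<Rightarrow> 'k"
      where "w \<sigma> = of_bool (path_component_of ?Y x (\<sigma> simplex_vertex))" for \<sigma>
    have "weighted_sum w (scale_chain c (?\<sigma> x) - ?\<sigma> y) = 0"
    proof (rule weighted_sum_boundary [OF _ bd])
      fix \<tau> assume "singular_simplex (Suc 0) ?Y \<tau>"
      then have 01: "path_component_of ?Y (singular_face (Suc 0) 0 \<tau> simplex_vertex)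
          (singular_face (Suc 0) (Suc 0) \<tau> simplex_vertex)"
        by (rule faces_in_same_path_component) simp_all
      have "path_component_of ?Y x (singular_face (Suc 0) 0 \<tau> simplex_vertex) \<longleftrightarrow>
          path_component_of ?Y x (singular_face (Suc 0) (Suc 0) \<tau> simplex_vertex)"
        using path_component_of_trans [OF _ 01]
          path_component_of_trans [OF _ path_component_of_sym [OF 01]] by blast
      then show "w (singular_face (Suc 0) 0 \<tau>) = w (singular_face (Suc 0) (Suc 0) \<tau>)"
        by (simp add: w_def)
    qed
    then have "w (point x) = w (point y)"
      unfolding weighted_sum_diff weighted_sum_scale c by simp
    moreover have "w (point x) = 1"
      using x by (simp add: w_def point_v path_component_of_refl)
    ultimately show "path_component_of ?Y x y"
      by (simp add: w_def point_v of_bool_def split: if_splits)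
  qed
  then show ?thesis
    unfolding path_connected_sublevels_def using ne by blast
qed

theorem persistence_iso_interval_module_iff:
  "persistence_iso
    (sublevel_homology 0 X f :: ('k::field, ('k, 'a) field_chain set) persistence_module)
    (interval_module {m..}) \<longleftrightarrow> path_connected_sublevels X f m"
  using persistence_iso_interval_module path_connected_sublevels_of_persistence_iso by blast

section \<open>Finite dimensionality\<close>

lemma finite_dimensional_trivial:
  assumes "carrier M = {\<zero>\<^bsub>M\<^esub>}"
  shows "finite_dimensional M"
  unfolding finite_dimensional_def
proof (intro exI [of _ "{}"] conjI ballI exI)
  fix x assume "x \<in> carrier M"
  then show "x = (\<Oplus>\<^bsub>M\<^esub>b\<in>{}. undefined b \<odot>\<^bsub>M\<^esub> b)"
    using assms by (simp add: finsum_def finprod_def)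
qed auto

lemma field_homology_abelian_monoid: "abelian_monoid (field_homology p X)"
proof (rule abelian_monoidI)
  let ?M = "field_homology p X"
  have zero: "\<zero>\<^bsub>?M\<^esub> = homology_coset p X 0"
    by (simp add: field_homology_def)
  have coset: "\<exists>z. A = homology_coset p X z" if "A \<in> carrier ?M" for A
    using that unfolding carrier_field_homology by blast
  show "x \<oplus>\<^bsub>?M\<^esub> y \<in> carrier ?M" if "x \<in> carrier ?M" "y \<in> carrier ?M" for x y
    using that by (rule field_homology_closed)
  show "\<zero>\<^bsub>?M\<^esub> \<in> carrier ?M"
    unfolding zero carrier_field_homology by (rule imageI) (simp add: field_cycles_def)
  show "(x \<oplus>\<^bsub>?M\<^esub> y) \<oplus>\<^bsub>?M\<^esub> z = x \<oplus>\<^bsub>?M\<^esub> (y \<oplus>\<^bsub>?M\<^esub> z)"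
    if "x \<in> carrier ?M" "y \<in> carrier ?M" "z \<in> carrier ?M" for x y z
    using that [THEN coset] by (elim exE) (simp only: add_homology_coset, simp only: add.assoc)
  show "\<zero>\<^bsub>?M\<^esub> \<oplus>\<^bsub>?M\<^esub> x = x" if "x \<in> carrier ?M" for x
    using coset [OF that] unfolding zero by (elim exE) (simp only: add_homology_coset, simp only: add_0_left)
  show "x \<oplus>\<^bsub>?M\<^esub> y = y \<oplus>\<^bsub>?M\<^esub> x" if "x \<in> carrier ?M" "y \<in> carrier ?M" for x y
    using that [THEN coset] by (elim exE) (simp only: add_homology_coset, simp only: add.commute)
qed

lemma finite_dimensional_field_homology_0:
  assumes X: "path_connected_space X"
  shows "finite_dimensional (field_homology 0 X :: ('k::field, ('k, 'a) field_chain set) module)"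
proof (cases "topspace X = {}")
  case True
  have "carrier (field_homology 0 X :: ('k, ('k, 'a) field_chain set) module) = {\<zero>\<^bsub>field_homology 0 X\<^esub>}"
    unfolding carrier_field_homology field_cycles_0
    by (simp add: field_chains_topspace_empty [OF True] field_homology_def)
  then show ?thesis
    by (rule finite_dimensional_trivial)
next
  case False
  let ?M = "field_homology 0 X :: ('k, ('k, 'a) field_chain set) module"
  interpret abelian_monoid ?M
    by (rule field_homology_abelian_monoid)
  obtain z where z: "z \<in> field_chains 0 X" "augmentation z = (1::'k)"
    using augmentation_range [OF False] by blast
  let ?B = "homology_coset 0 X z"
  have B: "?B \<in> carrier ?M"
    unfolding carrier_field_homology field_cycles_0 using z(1) by (rule imageI)
  show ?thesis
    unfolding finite_dimensional_def
  proof (intro exI [of _ "{?B}"] conjI ballI)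
    fix A assume "A \<in> carrier ?M"
    then obtain w where w: "w \<in> field_chains 0 X" "A = homology_coset 0 X w"
      unfolding carrier_field_homology field_cycles_0 by blast
    let ?a = "augmentation w"
    have "?a \<odot>\<^bsub>?M\<^esub> ?B = A"
      unfolding w(2) smult_homology_coset path_connected_homology_coset [OF X w(1)]
        path_connected_homology_coset [OF X field_chains_scale [OF z(1)]]
      by (simp add: weighted_sum_scale z(2))
    moreover have "(\<Oplus>\<^bsub>?M\<^esub>b\<in>{?B}. ?a \<odot>\<^bsub>?M\<^esub> b) = ?a \<odot>\<^bsub>?M\<^esub> ?B"
      using field_homology_closed(2) [OF B B]
      by (subst finsum_insert) (auto simp del: r_zero intro!: r_zero)
    ultimately show "\<exists>a. A = (\<Oplus>\<^bsub>?M\<^esub>b\<in>{?B}. a b \<odot>\<^bsub>?M\<^esub> b)"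
      by (intro exI [of _ "\<lambda>_. ?a"]) simp
  qed (use B in auto)
qed

lemma finite_dimensional_field_homology_contractible:
  assumes "contractible_space X"
  shows "finite_dimensional (field_homology p X :: ('k::field, ('k, 'a) field_chain set) module)"
proof (cases p)
  case 0
  then show ?thesis
    using assms by (simp add: finite_dimensional_field_homology_0 contractible_imp_path_connected_space)
next
  case (Suc q)
  let ?M = "field_homology p X :: ('k, ('k, 'a) field_chain set) module"
  have "homology_coset p X z = \<zero>\<^bsub>?M\<^esub>" if "z \<in> field_cycles p X" for z :: "('k, 'a) field_chain"
  proof -
    have "homology_coset p X z = homology_coset p X 0"
      unfolding homology_coset_eq_iff
      using contractible_field_cycle_bounds [OF assms] that Suc by simp
    then show ?thesis
      by (simp add: field_homology_def)
  qed
  moreover have "(0 :: ('k, 'a) field_chain) \<in> field_cycles p X"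
    by (simp add: field_cycles_def)
  ultimately have "carrier ?M = {\<zero>\<^bsub>?M\<^esub>}"
    unfolding carrier_field_homology by (auto intro!: image_eqI)
  then show ?thesis
    by (rule finite_dimensional_trivial)
qed

section \<open>Finite trees\<close>

lemma is_tree_edgeD:
  assumes "is_tree V E" "{u, v} \<in> E"
  shows "u \<in> V" "v \<in> V" "u \<noteq> v"
proof -
  have "{u, v} \<subseteq> V" "card {u, v} = 2"
    using assms unfolding is_tree_def finite_graph_def by blast+
  then show "u \<in> V" "v \<in> V" "u \<noteq> v"
    by auto
qed

text \<open>The last vertex of a longest path from the root is a leaf.\<close>

lemma tree_has_leaf:
  assumes tree: "is_tree V E" and r: "r \<in> V" and ne: "V \<noteq> {r}"
  obtains v p where "v \<in> V" "v \<noteq> r" "{v, p} \<in> E" "\<And>w. {v, w} \<in> E \<Longrightarrow> w = p"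
proof -
  define path where "path xs \<longleftrightarrow> xs \<noteq> [] \<and> hd xs = r \<and> distinct xs \<and> set xs \<subseteq> V \<and>
    (\<forall>i. Suc i < length xs \<longrightarrow> {xs ! i, xs ! Suc i} \<in> E)" for xs
  have finV: "finite V"
    using tree by (simp add: is_tree_def finite_graph_def)
  obtain u where u: "u \<in> V" "u \<noteq> r"
    using r ne by blast
  then have "(r, u) \<in> (adjacency E)\<^sup>*"
    using tree r by (auto simp: is_tree_def connected_graph_def)
  then obtain w where "{r, w} \<in> E"
    using u(2) by (auto simp: adjacency_def elim: converse_rtranclE)
  then have rw: "path [r, w]"
    using is_tree_edgeD [OF tree] by (auto simp: path_def)
  have bound: "length xs < Suc (card V)" if "path xs" for xs
    using that finV card_mono [of V "set xs"] by (auto simp: path_def distinct_card)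
  define n where "n = Max (length ` Collect path)"
  have "finite (length ` Collect path)"
    by (rule finite_subset [of _ "{..card V}"]) (use bound in force)+
  then have max: "length xs \<le> n" if "path xs" for xs
    using that by (simp add: n_def)
  have "n \<in> length ` Collect path"
    unfolding n_def using \<open>finite (length ` Collect path)\<close> rw by (intro Max_in) auto
  then obtain xs where xs: "path xs" "length xs = n"
    by blast
  have "2 \<le> n"
    using max [OF rw] by simp
  let ?v = "xs ! (n - 1)" and ?p = "xs ! (n - 2)"
  have Suc: "Suc (n - 2) = n - 1"
    using \<open>2 \<le> n\<close> by simp
  have edge: "{?v, ?p} \<in> E"
    using xs \<open>2 \<le> n\<close> Suc unfolding path_def
    by (metis diff_less insert_commute less_numeral_extra(1) order_less_le_trans zero_less_numeral)
  have hd: "xs ! 0 = r"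
    using xs by (auto simp: path_def hd_conv_nth)
  show ?thesis
  proof
    show "?v \<in> V"
      using is_tree_edgeD [OF tree edge] by blast
    show "?v \<noteq> r"
      using xs \<open>2 \<le> n\<close> hd nth_eq_iff_index_eq [of xs "n - 1" 0] by (auto simp: path_def)
    show "{?v, ?p} \<in> E"
      by (rule edge)
    show "w = ?p" if w: "{?v, w} \<in> E" for w
    proof (rule ccontr)
      assume wp: "w \<noteq> ?p"
      have wV: "w \<in> V" "?v \<noteq> w"
        using is_tree_edgeD [OF tree w] by auto
      have "w \<in> set xs"
      proof (rule ccontr)
        assume "w \<notin> set xs"
        then have "path (xs @ [w])"
          using xs w wV
          by (auto simp: path_def nth_append not_less less_Suc_eq) (metis diff_Suc_Suc diff_zero)
        then show False
          using max xs(2) by fastforce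
      qed
      then obtain j where j: "j < n" "xs ! j = w"
        using xs(2) by (auto simp: in_set_conv_nth)
      then have "j \<noteq> n - 1" "j \<noteq> n - 2"
        using wp wV by auto
      then have j3: "Suc (Suc j) < n"
        using j by linarith
      \<comment> \<open>An edge from the last vertex back to an earlier one than its predecessor closes a cycle.\<close>
      have "graph_cycle E (drop j xs)"
        unfolding graph_cycle_def
      proof (intro conjI allI impI)
        show "3 \<le> length (drop j xs)"
          using j3 xs by simp
        show "distinct (drop j xs)"
          using xs by (simp add: path_def)
        fix i assume i: "i < length (drop j xs)"
        show "{drop j xs ! i, drop j xs ! (Suc i mod length (drop j xs))} \<in> E"
        proof (cases "Suc i < length (drop j xs)")
          case True
          then have "Suc (j + i) < length xs"
            by simp
          then have "{xs ! (j + i), xs ! Suc (j + i)} \<in> E"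
            using xs(1) unfolding path_def by blast
          then show ?thesis
            using True i by (simp add: mod_less)
        next
          case False
          then have "Suc i = n - j"
            using i xs by simp
          then have "j + i = n - 1"
            using j by simp
          then show ?thesis
            using \<open>Suc i = n - j\<close> w j xs by simp
        qed
      qed
      then show False
        using tree by (auto simp: is_tree_def)
    qed
  qed
qed

lemma tree_remove_leaf:
  assumes tree: "is_tree V E" and r: "r \<in> V" "v \<noteq> r" and v: "v \<in> V" "{v, p} \<in> E"
    and leaf: "\<And>w. {v, w} \<in> E \<Longrightarrow> w = p"
  shows "is_tree (V - {v}) (E - {{v, p}})"
proof -
  let ?V = "V - {v}" and ?E = "E - {{v, p}}"
  have no_v: "v \<notin> e" if "e \<in> ?E" for e
  proof
    assume "v \<in> e"
    moreover have "card e = 2"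
      using that tree by (auto simp: is_tree_def finite_graph_def)
    ultimately obtain w where "e = {v, w}"
      by (auto simp: card_2_iff)
    then show False
      using that leaf by auto
  qed
  have "finite_graph ?V ?E"
    using tree no_v by (auto simp: is_tree_def finite_graph_def)
  moreover have "connected_graph ?V ?E"
  proof -
    \<comment> \<open>Moving \<open>v\<close> to \<open>p\<close> turns walks in the tree into walks that avoid \<open>v\<close>.\<close>
    define \<rho> where "\<rho> x = (if x = v then p else x)" for x
    have step: "(\<rho> a, \<rho> b) \<in> (adjacency ?E)\<^sup>*" if "(a, b) \<in> adjacency E" for a b
    proof (cases "a = v \<or> b = v")
      case True
      moreover have "b = p" if "a = v"
        using leaf [of b] that \<open>(a, b) \<in> adjacency E\<close> by (simp add: adjacency_def)
      moreover have "a = p" if "b = v"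
        using leaf [of a] that \<open>(a, b) \<in> adjacency E\<close> by (simp add: adjacency_def insert_commute)
      ultimately have "\<rho> a = \<rho> b"
        by (auto simp: \<rho>_def)
      then show ?thesis
        by simp
    next
      case False
      then have "(\<rho> a, \<rho> b) \<in> adjacency ?E"
        using that by (auto simp: \<rho>_def adjacency_def doubleton_eq_iff)
      then show ?thesis
        by blast
    qed
    have walk: "(\<rho> a, \<rho> b) \<in> (adjacency ?E)\<^sup>*" if "(a, b) \<in> (adjacency E)\<^sup>*" for a b
      using that by (induction rule: rtrancl_induct) (auto intro: rtrancl_trans step)
    have "(a, b) \<in> (adjacency ?E)\<^sup>*" if "a \<in> ?V" "b \<in> ?V" for a b
    proof -
      have "(a, b) \<in> (adjacency E)\<^sup>*"
        using that tree unfolding is_tree_def connected_graph_def by blast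
      from walk [OF this] show ?thesis
        using that by (simp add: \<rho>_def)
    qed
    then show ?thesis
      using r unfolding connected_graph_def by blast
  qed
  moreover have "\<not> graph_cycle ?E q" for q
    using tree by (auto simp: is_tree_def graph_cycle_def)
  ultimately show ?thesis
    by (simp add: is_tree_def)
qed

text \<open>Every finite tree grows from its root by attaching one leaf at a time.\<close>

lemma rooted_tree_induct [consumes 2, case_names root leaf]:
  assumes "is_tree V E" "r \<in> V"
    and base: "P {r} {}"
    and step: "\<And>V E v p. is_tree V E \<Longrightarrow> r \<in> V \<Longrightarrow> v \<notin> V \<Longrightarrow> p \<in> V \<Longrightarrow> P V E \<Longrightarrow>
        P (insert v V) (insert {v, p} E)"
  shows "P V E"
  using assms(1,2)
proof (induction "card V" arbitrary: V E rule: less_induct)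
  case less
  show ?case
  proof (cases "V = {r}")
    case True
    have "e \<notin> E" for e
    proof
      assume "e \<in> E"
      then have "e \<subseteq> {r}" "card e = 2"
        using less.prems(1) unfolding True is_tree_def finite_graph_def by blast+
      then show False
        by (auto simp: subset_singleton_iff)
    qed
    then have "E = {}"
      by blast
    then show ?thesis
      using True base by simp
  next
    case False
    then obtain v p where v: "v \<in> V" "v \<noteq> r" "{v, p} \<in> E" "\<And>w. {v, w} \<in> E \<Longrightarrow> w = p"
      using tree_has_leaf [OF less.prems] by blast
    have fin: "finite V"
      using less.prems by (simp add: is_tree_def finite_graph_def)
    have tree': "is_tree (V - {v}) (E - {{v, p}})"
      using tree_remove_leaf [OF less.prems v(2,1,3,4)] .
    have "P (V - {v}) (E - {{v, p}})"
      using less.hyps [OF card_Diff1_less [OF fin v(1)] tree'] less.prems(2) v(2) by blast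
    moreover have "p \<in> V - {v}"
      using is_tree_edgeD [OF less.prems(1) v(3)] by blast
    ultimately have "P (insert v (V - {v})) (insert {v, p} (E - {{v, p}}))"
      using v(2) less.prems(2) by (intro step [OF tree']) simp_all
    then show ?thesis
      unfolding insert_Diff [OF v(1)] insert_Diff [OF v(3)] .
  qed
qed

text \<open>When a leaf \<open>v\<close> is attached at \<open>p\<close>, every leaf of the old tree other than \<open>p\<close> stays a
  leaf. If \<open>v\<close> is to be the only leaf, then \<open>p\<close> was the only leaf before, that is, the end
  of the path.\<close>

lemma one_leaf_tree_is_path:
  assumes "is_tree W F" "r \<in> W" "card (leaves W F r) = 1"
  obtains ws where "ws \<noteq> []" "distinct ws" "hd ws = r" "W = set ws"
    "F = {{ws ! i, ws ! Suc i} |i. Suc i < length ws}"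
proof -
  obtain l where "leaves W F r = {l}"
    using assms(3) by (auto simp: card_1_singleton_iff)
  then have "\<exists>l. leaves W F r \<subseteq> {l}"
    by blast
  with assms(1,2) have "\<exists>ws. ws \<noteq> [] \<and> distinct ws \<and> hd ws = r \<and> W = set ws \<and>
      F = {{ws ! i, ws ! Suc i} |i. Suc i < length ws}"
  proof (induction W F rule: rooted_tree_induct)
    case root
    show ?case
      by (rule exI [of _ "[r]"]) auto
  next
    case (leaf W F v p)
    have vF: "{v, w} \<notin> F" for w
      using is_tree_edgeD [OF leaf(1)] leaf(3) by blast
    have vr: "v \<noteq> r"
      using leaf by blast
    have "{w. {v, w} \<in> insert {v, p} F} = {p}"
      using vF leaf(3,4) by (auto simp: doubleton_eq_iff)
    then have "v \<in> leaves (insert v W) (insert {v, p} F) r"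
      using vr leaf by (auto simp: leaves_def)
    then have only: "leaves (insert v W) (insert {v, p} F) r \<subseteq> {v}"
      using leaf.prems by blast
    have sub: "leaves W F r \<subseteq> {p}"
    proof (cases "W = {r}")
      case True
      then show ?thesis
        using leaf by (simp add: leaves_def)
    next
      case False
      show ?thesis
      proof (rule ccontr)
        assume "\<not> leaves W F r \<subseteq> {p}"
        then obtain u where u: "u \<in> leaves W F r" "u \<noteq> p"
          by blast
        then have u': "u \<in> W" "u \<noteq> r" "card {w. {u, w} \<in> F} = 1" "u \<noteq> v"
          using False leaf by (auto simp: leaves_def)
        have "{w. {u, w} \<in> insert {v, p} F} = {w. {u, w} \<in> F}"
          using u(2) u'(4) by (auto simp: doubleton_eq_iff)
        then have "u \<in> leaves (insert v W) (insert {v, p} F) r"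
          using u' vr by (auto simp: leaves_def)
        then show False
          using only u' by blast
      qed
    qed
    then obtain ws where ws: "ws \<noteq> []" "distinct ws" "hd ws = r" "W = set ws"
      "F = {{ws ! i, ws ! Suc i} |i. Suc i < length ws}"
      using leaf.IH by blast
    have p: "p = last ws"
    proof (cases "W = {r}")
      case True
      then show ?thesis
        using ws leaf by (metis last_in_set singletonD)
    next
      case False
      define n where "n = length ws - 1"
      have "length ws \<noteq> 1"
      proof
        assume "length ws = 1"
        then obtain a where "ws = [a]"
          by (auto simp: length_Suc_conv)
        then show False
          using ws False by simp
      qed
      then have n: "length ws = Suc n" "0 < n"
        using ws(1) by (auto simp: n_def) (metis One_nat_def Suc_lessI length_greater_0_conv)
      have lst: "last ws = ws ! n"
        using ws(1) by (simp add: last_conv_nth n_def)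
      have "ws ! n \<noteq> ws ! 0"
        using ws(2) n by (simp add: nth_eq_iff_index_eq)
      then have "last ws \<noteq> r"
        using ws(1,3) lst by (simp add: hd_conv_nth)
      have "{w. {ws ! n, w} \<in> F} = {ws ! (n - 1)}"
      proof (intro equalityI subsetI)
        fix w assume "w \<in> {w. {ws ! n, w} \<in> F}"
        then obtain i where i: "{ws ! n, w} = {ws ! i, ws ! Suc i}" "Suc i < Suc n"
          using ws(5) n by auto
        then have "ws ! n = ws ! Suc i"
          using ws(2) n by (auto simp: doubleton_eq_iff nth_eq_iff_index_eq)
        then have "n = Suc i"
          using ws(2) n i by (simp add: nth_eq_iff_index_eq)
        then show "w \<in> {ws ! (n - 1)}"
          using i by (auto simp: doubleton_eq_iff)
      next
        fix w assume w: "w \<in> {ws ! (n - 1)}"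
        have "{ws ! n, ws ! (n - 1)} = {ws ! (n - 1), ws ! Suc (n - 1)} \<and> Suc (n - 1) < length ws"
          using n by auto
        then show "w \<in> {w. {ws ! n, w} \<in> F}"
          using w unfolding ws(5) by blast
      qed
      then have "last ws \<in> leaves W F r"
        using False ws(1,4) n(1) \<open>last ws \<noteq> r\<close> by (simp add: leaves_def lst)
      then show ?thesis
        using sub by blast
    qed
    show ?case
    proof (intro exI [of _ "ws @ [v]"] conjI)
      show "insert {v, p} F = {{(ws @ [v]) ! i, (ws @ [v]) ! Suc i} |i. Suc i < length (ws @ [v])}" (is "_ = ?R")
      proof (intro equalityI subsetI)
        fix e assume "e \<in> insert {v, p} F"
        then consider "e = {v, p}" | i where "e = {ws ! i, ws ! Suc i}" "Suc i < length ws"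
          using ws(5) by blast
        then show "e \<in> ?R"
        proof cases
          case 1
          have "{v, p} = {(ws @ [v]) ! (length ws - 1), (ws @ [v]) ! Suc (length ws - 1)} \<and>
              Suc (length ws - 1) < length (ws @ [v])"
            using ws(1) p by (auto simp: nth_append last_conv_nth)
          then show ?thesis
            using 1 by blast
        next
          case 2
          then have "e = {(ws @ [v]) ! i, (ws @ [v]) ! Suc i} \<and> Suc i < length (ws @ [v])"
            by (simp add: nth_append)
          then show ?thesis
            by blast
        qed
      next
        fix e assume "e \<in> ?R"
        then obtain i where i: "e = {(ws @ [v]) ! i, (ws @ [v]) ! Suc i}" "Suc i < length (ws @ [v])"
          by blast
        show "e \<in> insert {v, p} F"
        proof (cases "Suc i < length ws")
          case True
          then have "e = {ws ! i, ws ! Suc i}"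
            using i by (simp add: nth_append)
          then show ?thesis
            using True ws(5) by blast
        next
          case False
          then have "i = length ws - 1" "Suc i = length ws"
            using i by simp_all
          then have "e = {p, v}"
            using i(1) ws(1) p by (simp add: nth_append last_conv_nth)
          then show ?thesis
            by blast
        qed
      qed
    qed (use ws leaf in auto)
  qed
  then show ?thesis
    using that by blast
qed

lemma path_edge_away:
  assumes ws: "distinct ws" "hd ws = r" "F = {{ws ! i, ws ! Suc i} |i. Suc i < length ws}"
    and i: "Suc i < length ws"
  shows "edge_away F r (ws ! i) (ws ! Suc i)"
proof -
  have r: "ws ! 0 = r"
    using ws i by (cases ws) auto
  have reach: "(r, ws ! j) \<in> adjacency F ^^ j" if "j < length ws" for j
    using that
  proof (induction j)
    case (Suc j)
    then have "(ws ! j, ws ! Suc j) \<in> adjacency F"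
      using ws(3) by (auto simp: adjacency_def)
    with Suc show ?case
      by auto
  qed (simp add: r)
  have bound: "\<exists>j\<le>n. j < length ws \<and> x = ws ! j" if "(r, x) \<in> adjacency F ^^ n" for n x
    using that
  proof (induction n arbitrary: x)
    case 0
    then show ?case
      using r i by auto
  next
    case (Suc n)
    then obtain y where "(r, y) \<in> adjacency F ^^ n" "(y, x) \<in> adjacency F"
      by auto
    then obtain j where j: "j \<le> n" "j < length ws" "y = ws ! j"
      using Suc.IH by blast
    have "{y, x} \<in> F"
      using \<open>(y, x) \<in> adjacency F\<close> by (simp add: adjacency_def)
    then obtain k where k: "{y, x} = {ws ! k, ws ! Suc k}" "Suc k < length ws"
      unfolding ws(3) by blast
    have "x = ws ! Suc k \<and> k = j \<or> x = ws ! k \<and> Suc k = j"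
      using k j ws(1) by (auto simp: doubleton_eq_iff nth_eq_iff_index_eq)
    then show ?case
    proof
      assume "x = ws ! Suc k \<and> k = j"
      then show ?thesis
        using j k(2) by (intro exI [of _ "Suc k"]) simp
    next
      assume "x = ws ! k \<and> Suc k = j"
      then show ?thesis
        using j k(2) by (intro exI [of _ k]) simp
    qed
  qed
  have dist: "graph_dist F r (ws ! j) = j" if j: "j < length ws" for j
    unfolding graph_dist_def
  proof (rule Least_equality)
    show "(r, ws ! j) \<in> adjacency F ^^ j"
      by (rule reach [OF j])
    fix n assume "(r, ws ! j) \<in> adjacency F ^^ n"
    then show "j \<le> n"
      using bound [of "ws ! j" n] j ws(1) by (auto simp: nth_eq_iff_index_eq)
  qed
  have "{ws ! i, ws ! Suc i} \<in> F"
    using ws(3) i by blast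
  then show ?thesis
    using i by (simp add: edge_away_def dist)
qed

section \<open>The realization of a finite tree\<close>

lemma topspace_realization [simp]: "topspace (realization V E) = realization_set V E"
  by (simp add: realization_def)

text \<open>The points of the realization are the points of the edges. The degenerate case
  \<open>v = u\<close> accounts for the vertices, in particular for an isolated vertex.\<close>

lemma realization_set_iff:
  assumes "finite_graph V E"
  shows "x \<in> realization_set V E \<longleftrightarrow>
    (\<exists>u\<in>V. \<exists>v. (v = u \<or> {u, v} \<in> E) \<and> (\<exists>s\<in>{0..1}. x = edge_point u v s))" (is "?l \<longleftrightarrow> ?r")
proof
  assume ?l
  then obtain e where x: "\<And>v. 0 \<le> x v" "(\<Sum>v\<in>V. x v) = 1"
    and e: "e \<in> (\<lambda>v. {v}) ` V \<union> E" "{v. x v \<noteq> 0} \<subseteq> e"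
    by (auto simp: realization_set_def)
  have eV: "e \<subseteq> V" and fin: "finite V"
    using e assms by (auto simp: finite_graph_def)
  have sum: "(\<Sum>v\<in>e. x v) = 1"
    using x(2) sum.mono_neutral_right [OF fin eV, of x] e(2) by auto
  have out: "x w = 0" if "w \<notin> e" for w
    using e(2) that by auto
  show ?r
  proof (cases "e \<in> E")
    case True
    then have "card e = 2"
      using assms by (auto simp: finite_graph_def)
    then obtain u v where uv: "e = {u, v}" "u \<noteq> v"
      by (auto simp: card_2_iff)
    then have s: "x u = 1 - x v" "x v \<in> {0..1}"
      using sum x(1) [of u] x(1) [of v] by auto
    have "x = edge_point u v (x v)"
      by (rule ext) (use uv s out in \<open>auto simp: edge_point_def\<close>)
    then show ?thesis
      using s uv True eV by blast
  next
    case False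
    then obtain u where "u \<in> V" "e = {u}"
      using e by blast
    then have "x = edge_point u u 0"
      using sum out by (auto simp: edge_point_def)
    then show ?thesis
      using \<open>u \<in> V\<close> by force
  qed
next
  assume ?r
  then obtain u v s where u: "u \<in> V" "v = u \<or> {u, v} \<in> E" "s \<in> {0..1}" "x = edge_point u v s"
    by blast
  have fin: "finite V" and "v \<in> V"
    using u assms by (auto simp: finite_graph_def)
  have "(\<Sum>w\<in>V. x w) = (1 - s) * (\<Sum>w\<in>V. of_bool (w = u)) + s * (\<Sum>w\<in>V. of_bool (w = v))"
    unfolding u(4) edge_point_def by (simp add: sum.distrib sum_distrib_left)
  also have "\<dots> = 1"
    using fin u(1) \<open>v \<in> V\<close> by (simp add: of_bool_def)
  finally have "(\<Sum>w\<in>V. x w) = 1" .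
  moreover have "{w. x w \<noteq> 0} \<subseteq> {u, v}"
    by (auto simp: u(4) edge_point_def)
  moreover have "{u, v} \<in> (\<lambda>v. {v}) ` V \<union> E"
    using u by auto
  moreover have "0 \<le> x w" for w
    using u(3) by (simp add: u(4) edge_point_def)
  ultimately show ?l
    unfolding realization_set_def by blast
qed

lemma vertex_point_in_realization_set:
  assumes "finite_graph V E" "v \<in> V"
  shows "vertex_point v \<in> realization_set V E"
  unfolding realization_set_iff [OF assms(1)]
proof (intro bexI exI conjI disjI1)
  show "vertex_point v = edge_point v v 0"
    by (auto simp: edge_point_def vertex_point_def)
qed (use assms(2) in auto)

lemma continuous_map_edge_point:
  "continuous_map (top_of_set S) (powertop_real UNIV) (edge_point u v)"
  unfolding continuous_map_componentwise_UNIV edge_point_def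
  by (auto intro!: continuous_intros)

lemma compact_space_realization:
  assumes "finite_graph V E"
  shows "compact_space (realization V E)"
proof -
  have "realization_set V E =
      (\<Union>(u, v)\<in>{(u, v). u \<in> V \<and> v \<in> V \<and> (v = u \<or> {u, v} \<in> E)}. edge_point u v ` {0..1})"
  proof (intro equalityI subsetI)
    fix x assume "x \<in> realization_set V E"
    then obtain u v s where uv: "u \<in> V" "v = u \<or> {u, v} \<in> E" "s \<in> {0..1}" "x = edge_point u v s"
      unfolding realization_set_iff [OF assms] by blast
    then have "v \<in> V"
      using assms by (auto simp: finite_graph_def)
    then show "x \<in> (\<Union>(u, v)\<in>{(u, v). u \<in> V \<and> v \<in> V \<and> (v = u \<or> {u, v} \<in> E)}. edge_point u v ` {0..1})"
      using uv by blast
  next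
    fix x assume "x \<in> (\<Union>(u, v)\<in>{(u, v). u \<in> V \<and> v \<in> V \<and> (v = u \<or> {u, v} \<in> E)}. edge_point u v ` {0..1})"
    then show "x \<in> realization_set V E"
      unfolding realization_set_iff [OF assms] by blast
  qed
  moreover have "finite {(u, v). u \<in> V \<and> v \<in> V \<and> (v = u \<or> {u, v} \<in> E)}"
    by (rule finite_subset [of _ "V \<times> V"]) (use assms in \<open>auto simp: finite_graph_def\<close>)
  moreover have "compactin (powertop_real UNIV) (edge_point u v ` {0..1})" for u v :: 'a
    by (rule image_compactin [OF _ continuous_map_edge_point [of UNIV]]) simp
  ultimately have "compactin (powertop_real UNIV) (realization_set V E)"
    by (auto intro!: compactin_Union)
  then show ?thesis
    by (simp add: realization_def compact_space_subtopology)
qed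

lemma realization_set_attach_leaf:
  assumes tree: "is_tree V E" and v: "v \<notin> V" and p: "p \<in> V"
  shows "realization_set (insert v V) (insert {v, p} E) = realization_set V E \<union> edge_point p v ` {0..1}"
    and "\<And>x. x \<in> realization_set V E \<Longrightarrow> x v = 0"
proof -
  have fg: "finite_graph V E"
    using tree by (simp add: is_tree_def)
  have fg': "finite_graph (insert v V) (insert {v, p} E)"
    using fg v p by (auto simp: finite_graph_def card_insert_if)
  have sym: "edge_point v p s = edge_point p v (1 - s)" for s
    by (auto simp: edge_point_def)
  have vE: "{v, w} \<notin> E" "{w, v} \<notin> E" for w
    using is_tree_edgeD [OF tree] v by blast+
  show "realization_set (insert v V) (insert {v, p} E) = realization_set V E \<union> edge_point p v ` {0..1}"
  proof (intro equalityI subsetI)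
    fix x assume "x \<in> realization_set (insert v V) (insert {v, p} E)"
    then obtain u w s where u: "u \<in> insert v V" "w = u \<or> {u, w} \<in> insert {v, p} E" "s \<in> {0..1}" "x = edge_point u w s"
      unfolding realization_set_iff [OF fg'] by blast
    consider "w = u" "u = v" | "w = u" "u \<in> V" | "u = v" "w = p" | "u = p" "w = v" | "{u, w} \<in> E"
      using u by (auto simp: doubleton_eq_iff)
    then show "x \<in> realization_set V E \<union> edge_point p v ` {0..1}"
    proof cases
      case 1
      then have "x = edge_point p v 1"
        using u by (auto simp: edge_point_def)
      then show ?thesis
        by auto
    next
      case 3
      then have "x = edge_point p v (1 - s)"
        using u sym by simp
      then show ?thesis
        using u(3) by auto
    next
      case 4
      then show ?thesis
        using u by blast
    next
      case 5
      then have "u \<in> V"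
        using is_tree_edgeD [OF tree] by blast
      then have "x \<in> realization_set V E"
        using 5 u(3,4) unfolding realization_set_iff [OF fg] by blast
      then show ?thesis ..
    next
      case 2
      then have "x \<in> realization_set V E"
        using u(3,4) unfolding realization_set_iff [OF fg] by blast
      then show ?thesis ..
    qed
  next
    fix x assume "x \<in> realization_set V E \<union> edge_point p v ` {0..1}"
    then show "x \<in> realization_set (insert v V) (insert {v, p} E)"
    proof
      assume "x \<in> edge_point p v ` {0..1}"
      moreover have "{p, v} \<in> insert {v, p} E"
        by (simp add: insert_commute)
      ultimately show ?thesis
        using p unfolding realization_set_iff [OF fg'] by blast
    next
      assume "x \<in> realization_set V E"
      then show ?thesis
        unfolding realization_set_iff [OF fg'] realization_set_iff [OF fg] by blast
    qed
  qed
  show "x v = 0" if x: "x \<in> realization_set V E" for x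
  proof -
    obtain u w s where "u \<in> V" "w = u \<or> {u, w} \<in> E" "x = edge_point u w s"
      using x unfolding realization_set_iff [OF fg] by blast
    then show ?thesis
      using v vE by (auto simp: edge_point_def)
  qed
qed

lemma contractible_space_homotopy_into:
  assumes h: "homotopic_with (\<lambda>_. True) X X id k" and k: "continuous_map X (subtopology X S) k"
    and S: "contractible_space (subtopology X S)"
  shows "contractible_space X"
proof -
  obtain c where "homotopic_with (\<lambda>_. True) X X (id \<circ> k) (\<lambda>_. c)"
    using nullhomotopic_through_contractible_space [OF k _ S, of X id] continuous_map_id_subt by blast
  then show ?thesis
    unfolding contractible_space_def using homotopic_with_trans [OF h] by auto
qed

text \<open>The slide along the edge from \<open>v\<close> to \<open>p\<close>: at time \<open>1\<close> the whole edge is at \<open>p\<close>.\<close>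

definition edge_slide :: "'v \<Rightarrow> 'v \<Rightarrow> real \<Rightarrow> ('v \<Rightarrow> real) \<Rightarrow> 'v \<Rightarrow> real" where
  "edge_slide v p s x = (\<lambda>w. if w = v then (1 - s) * x v else if w = p then x p + s * x v else x w)"

lemma edge_slide_fixes: "x v = 0 \<Longrightarrow> edge_slide v p s x = x"
  by (auto simp: edge_slide_def)

lemma edge_slide_edge_point: "p \<noteq> v \<Longrightarrow> edge_slide v p s (edge_point p v c) = edge_point p v ((1 - s) * c)"
  by (auto simp: edge_slide_def edge_point_def algebra_simps)

lemma continuous_map_edge_slide:
  "continuous_map (prod_topology (top_of_set {0..1}) (subtopology (powertop_real UNIV) Y)) (powertop_real UNIV)
     (\<lambda>z. edge_slide v p (fst z) (snd z))"
proof -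
  let ?P = "prod_topology (top_of_set {0..1::real}) (subtopology (powertop_real UNIV) Y)"
  have snd: "continuous_map ?P euclideanreal (\<lambda>z. snd z w)" for w
  proof -
    have "continuous_map (subtopology (powertop_real UNIV) Y) euclideanreal (\<lambda>x. x w)"
      by (intro continuous_map_from_subtopology continuous_map_product_projection) simp
    from continuous_map_compose [OF continuous_map_snd this] show ?thesis
      by (simp add: comp_def)
  qed
  have fst: "continuous_map ?P euclideanreal fst"
    using continuous_map_fst continuous_map_into_fulltopology by fastforce
  have "continuous_map ?P euclideanreal (\<lambda>z. edge_slide v p (fst z) (snd z) w)" for w
  proof -
    consider "w = v" | "w \<noteq> v" "w = p" | "w \<noteq> v" "w \<noteq> p"
      by blast
    then show ?thesis
      by cases (simp_all add: edge_slide_def snd fst continuous_map_add continuous_map_diff continuous_map_real_mult)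
  qed
  then show ?thesis
    by (simp add: continuous_map_componentwise_UNIV)
qed

lemma contractible_connected_subset_of_edge:
  assumes Y: "Y \<subseteq> edge_point p v ` {0..1}" "connectedin (powertop_real UNIV) Y" and "p \<noteq> v"
  shows "contractible_space (subtopology (powertop_real UNIV) Y)"
proof -
  let ?c = "\<lambda>x::'a \<Rightarrow> real. x v"
  have c: "continuous_map (powertop_real UNIV) euclideanreal ?c"
    by (intro continuous_map_product_projection) simp
  have e: "?c (edge_point p v s) = s" for s
    using \<open>p \<noteq> v\<close> by (simp add: edge_point_def)
  have y: "edge_point p v (?c y) = y" if "y \<in> Y" for y
    using Y(1) that e by auto
  have "is_interval (?c ` Y)"
    using connectedin_continuous_map_image [OF c Y(2)] by (simp add: is_interval_connected_1)
  moreover have "homeomorphic_maps (subtopology (powertop_real UNIV) Y) (top_of_set (?c ` Y)) ?c (edge_point p v)"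
    unfolding homeomorphic_maps_def
    using continuous_map_from_subtopology [OF c] continuous_map_edge_point y e
    by (auto simp: continuous_map_in_subtopology)
  ultimately show ?thesis
    using homeomorphic_maps_imp_homeomorphic_space homeomorphic_space_contractibility
      contractible_space_subtopology_euclideanreal by blast
qed

text \<open>Connected subsets of a tree are contractible. When the edge from \<open>p\<close> to a new leaf \<open>v\<close> is
  attached, a connected subset that contains \<open>p\<close> meets the edge in an initial segment and
  deforms into the old tree along the edge; one that avoids \<open>p\<close> lies on one side of it.\<close>

lemma tree_realization_subsets:
  assumes "is_tree V E"
  shows "connectedin (powertop_real UNIV) (realization_set V E) \<and>
    (\<forall>Y\<subseteq>realization_set V E. connectedin (powertop_real UNIV) Y \<longrightarrow>
       contractible_space (subtopology (powertop_real UNIV) Y))"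
proof -
  obtain r where "r \<in> V"
    using assms by (auto simp: is_tree_def connected_graph_def)
  with assms show ?thesis
  proof (induction V E rule: rooted_tree_induct)
    case root
    have "realization_set {r} {} = {vertex_point r}"
      by (auto simp: realization_set_iff finite_graph_def edge_point_def vertex_point_def algebra_simps intro!: exI)
    then show ?case
      by (auto intro!: contractible_space_subset_singleton [of _ "vertex_point r"])
  next
    case (leaf V E v p)
    let ?P = "powertop_real UNIV :: ('a \<Rightarrow> real) topology"
    let ?R = "realization_set V E"
    let ?R' = "realization_set (insert v V) (insert {v, p} E)"
    note R' = realization_set_attach_leaf(1) [OF leaf(1,3,4)]
    note Rv = realization_set_attach_leaf(2) [OF leaf(1,3,4)]
    have pv: "p \<noteq> v"
      using leaf by blast
    have fg: "finite_graph V E"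
      using leaf by (simp add: is_tree_def)
    have e_v: "edge_point p v s v = s" and e_p: "edge_point p v s p = 1 - s" for s
      using pv by (auto simp: edge_point_def)
    have pR: "edge_point p v 0 \<in> ?R"
    proof -
      have "edge_point p v 0 = edge_point p p 0"
        by (auto simp: edge_point_def)
      then show ?thesis
        using leaf(4) by (force simp: realization_set_iff [OF fg])
    qed
    have cont: "continuous_map ?P euclideanreal (\<lambda>x. x w)" for w
      by (intro continuous_map_product_projection) simp
    have edge_conn: "connectedin ?P (edge_point p v ` {0..1})"
      by (rule connectedin_continuous_map_image [OF continuous_map_edge_point [of UNIV]]) simp
    have "connectedin ?P ?R'"
      unfolding R'
    proof (rule connectedin_Un)
      have "edge_point p v 0 \<in> ?R \<inter> edge_point p v ` {0..1}"
        using pR by simp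
      then show "?R \<inter> edge_point p v ` {0..1} \<noteq> {}"
        by blast
    qed (use leaf.IH edge_conn in blast)+
    moreover have "contractible_space (subtopology ?P Y)" if Y: "Y \<subseteq> ?R'" "connectedin ?P Y" for Y
    proof (cases "edge_point p v 0 \<in> Y")
      case True
      let ?X = "subtopology ?P Y"
      have in_Y: "edge_slide v p s x \<in> Y" if x: "x \<in> Y" and s: "s \<in> {0..1}" for s x
      proof (cases "x v = 0")
        case True
        then show ?thesis
          using x by (simp add: edge_slide_fixes)
      next
        case False
        then obtain c where c: "x = edge_point p v c" "c \<in> {0..1}"
          using x Y(1) Rv unfolding R' by blast
        have "connected ((\<lambda>x. x v) ` Y)"
          using connectedin_continuous_map_image [OF cont Y(2)] by simp
        moreover have "0 \<in> (\<lambda>x. x v) ` Y" "c \<in> (\<lambda>x. x v) ` Y"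
          by (rule image_eqI [OF _ \<open>edge_point p v 0 \<in> Y\<close>], simp add: e_v)
            (rule image_eqI [OF _ x], simp add: c e_v)
        moreover have "0 \<le> (1 - s) * c" "(1 - s) * c \<le> c"
          using s c by (auto intro: mult_left_le_one_le)
        ultimately have "(1 - s) * c \<in> (\<lambda>x. x v) ` Y"
          using connected_contains_Icc [of "(\<lambda>x. x v) ` Y" 0 c] by (auto simp: subset_iff)
        then obtain y where y: "y \<in> Y" "y v = (1 - s) * c"
          by force
        have "edge_point p v ((1 - s) * c) \<in> Y"
        proof (cases "y v = 0")
          case True
          then have "(1 - s) * c = 0"
            using y(2) by linarith
          then show ?thesis
            using \<open>edge_point p v 0 \<in> Y\<close> by (simp only:)
        next
          case False
          then obtain d where "y = edge_point p v d"
            using y Y(1) Rv unfolding R' by blast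
          then show ?thesis
            using y e_v by simp
        qed
        then show ?thesis
          by (simp add: c edge_slide_edge_point pv)
      qed
      have slide1: "edge_slide v p 1 x \<in> ?R" if x: "x \<in> Y" for x
      proof (cases "x \<in> ?R")
        case True
        then show ?thesis
          by (simp add: edge_slide_fixes Rv)
      next
        case False
        then obtain c where "x = edge_point p v c"
          using x Y(1) unfolding R' by blast
        then show ?thesis
          using pR by (simp add: edge_slide_edge_point pv)
      qed
      have cont1: "continuous_map ?X ?X (edge_slide v p 1)"
        and hom: "homotopic_with (\<lambda>_. True) ?X ?X id (edge_slide v p 1)"
      proof -
        have cY: "continuous_map (prod_topology (top_of_set {0..1}) ?X) ?X (\<lambda>z. edge_slide v p (fst z) (snd z))"
          using continuous_map_edge_slide in_Y by (auto simp: continuous_map_in_subtopology)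
        have "edge_slide v p 0 x = x" for x
          by (auto simp: edge_slide_def)
        then show "homotopic_with (\<lambda>_. True) ?X ?X id (edge_slide v p 1)"
          unfolding homotopic_with_def
          using cY by (intro exI [of _ "\<lambda>z. edge_slide v p (fst z) (snd z)"]) auto
        then show "continuous_map ?X ?X (edge_slide v p 1)"
          by (simp add: homotopic_with_imp_continuous_maps)
      qed
      have img: "edge_slide v p 1 ` Y = Y \<inter> ?R"
      proof (intro equalityI subsetI)
        fix x assume "x \<in> edge_slide v p 1 ` Y"
        then show "x \<in> Y \<inter> ?R"
          using in_Y [of _ 1] slide1 by auto
      next
        fix x assume "x \<in> Y \<inter> ?R"
        then have "x = edge_slide v p 1 x" "x \<in> Y"
          using Rv by (auto simp: edge_slide_fixes)
        then show "x \<in> edge_slide v p 1 ` Y"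
          by (rule image_eqI)
      qed
      have "connectedin ?X (edge_slide v p 1 ` Y)"
        using Y(2) by (intro connectedin_continuous_map_image [OF cont1]) (simp add: connectedin_subtopology)
      then have "connectedin ?P (Y \<inter> ?R)"
        unfolding img by (simp add: connectedin_subtopology)
      then have "contractible_space (subtopology ?P (Y \<inter> ?R))"
        using leaf.IH by blast
      then have "contractible_space (subtopology ?X ?R)"
        by (simp add: subtopology_subtopology)
      moreover have "continuous_map ?X (subtopology ?X ?R) (edge_slide v p 1)"
        using cont1 slide1 by (auto simp: continuous_map_in_subtopology)
      ultimately show ?thesis
        using contractible_space_homotopy_into [OF hom] by blast
    next
      case False
      \<comment> \<open>Without \<open>p\<close>, the edge is where the coordinate \<open>v\<close> is positive, and the old tree is where
        the coordinates of \<open>p\<close> and \<open>v\<close> do not add up to \<open>1\<close>; both conditions are open.\<close>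
      let ?A = "{x \<in> topspace ?P. x v \<in> {0<..}}" and ?B = "{x \<in> topspace ?P. x p + x v \<in> {..<1}}"
      have "openin ?P ?A" "openin ?P ?B"
        by (rule openin_continuous_map_preimage [where Y = euclideanreal];
            simp add: cont continuous_map_add)+
      moreover have BY: "?B \<inter> Y \<subseteq> ?R"
      proof
        fix x assume x: "x \<in> ?B \<inter> Y"
        have "x \<noteq> edge_point p v c" for c
          using x by (auto simp: e_v e_p)
        then show "x \<in> ?R"
          using x Y(1) unfolding R' by blast
      qed
      moreover have AY: "?A \<inter> Y \<subseteq> edge_point p v ` {0..1}"
      proof
        fix x assume x: "x \<in> ?A \<inter> Y"
        then have "x \<notin> ?R"
          using Rv [of x] by auto
        then show "x \<in> edge_point p v ` {0..1}"
          using x Y(1) unfolding R' by blast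
      qed
      moreover have cover: "Y \<subseteq> ?A \<union> ?B"
      proof
        fix x assume x: "x \<in> Y"
        show "x \<in> ?A \<union> ?B"
        proof (cases "x \<in> ?R")
          case True
          then have "x v = 0"
            by (rule Rv)
          obtain u w s where uw: "u \<in> V" "w = u \<or> {u, w} \<in> E" "s \<in> {0..1}" "x = edge_point u w s"
            using True unfolding realization_set_iff [OF fg] by blast
          have "x p \<noteq> 1"
          proof
            assume "x p = 1"
            then have "x = edge_point p v 0"
              using uw by (auto simp: edge_point_def of_bool_def fun_eq_iff split: if_splits)
            then show False
              using False x by simp
          qed
          moreover have "x p \<le> 1"
            using uw by (auto simp: edge_point_def of_bool_def)
          ultimately show ?thesis
            using \<open>x v = 0\<close> by simp
        next
          case False
          then obtain c where c: "x = edge_point p v c" "c \<in> {0..1}"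
            using x Y(1) unfolding R' by blast
          then have "c \<noteq> 0"
            using \<open>edge_point p v 0 \<notin> Y\<close> x by blast
          then show ?thesis
            using c e_v by simp
        qed
      qed
      moreover have "?A \<inter> ?B \<inter> Y = {}"
      proof -
        have "x \<notin> ?A" if "x \<in> ?B" "x \<in> Y" for x
          using BY Rv [of x] that by auto
        then show ?thesis
          by blast
      qed
      ultimately have "?A \<inter> Y = {} \<or> ?B \<inter> Y = {}"
        using Y(2) unfolding connectedin by blast
      then have "Y \<subseteq> ?R \<or> Y \<subseteq> edge_point p v ` {0..1}"
        using BY AY cover by blast
      then show ?thesis
        using leaf.IH Y(2) contractible_connected_subset_of_edge [OF _ Y(2) pv] by blast
    qed
    ultimately show ?case
      by blast
  qed
qed

section \<open>Star-shaped spaces of functions\<close>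

lemma continuous_functions_subset_mspace_cfunspace:
  assumes X: "compact_space X"
    and S: "S \<subseteq> {f \<in> extensional (topspace X). continuous_map X euclideanreal f}"
  shows "S \<subseteq> mspace (cfunspace X (euclidean_metric :: real metric))"
proof
  fix f assume "f \<in> S"
  then have f: "f \<in> extensional (topspace X)" "continuous_map X euclideanreal f"
    using S by auto
  have "compactin (mtopology_of (euclidean_metric :: real metric)) (f ` topspace X)"
    using X f(2) image_compactin [of X "topspace X" euclideanreal f]
    by (simp add: compact_space_def)
  then have "Metric_space.mbounded (mspace euclidean_metric) (mdist euclidean_metric) (f ` topspace X)"
    unfolding mtopology_of_def by (rule Metric_space.compactin_imp_mbounded [OF Metric_space_mspace_mdist])
  then show "f \<in> mspace (cfunspace X euclidean_metric)"
    using f by simp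
qed

text \<open>The straight-line homotopy to the constant function \<open>m\<close>. The case \<open>s = 0\<close> is separate because
  the functions of interest stay in the space under positive rescaling.\<close>

lemma contractible_star_shaped_function_space:
  fixes m :: real
  assumes X: "compact_space X" "topspace X \<noteq> {}"
    and S: "S \<subseteq> {f \<in> extensional (topspace X). continuous_map X euclideanreal f}"
    and const: "(\<lambda>x\<in>topspace X. m) \<in> S"
    and star: "\<And>f s. f \<in> S \<Longrightarrow> 0 < s \<Longrightarrow> s \<le> 1 \<Longrightarrow> (\<lambda>x\<in>topspace X. m + s * (f x - m)) \<in> S"
  shows "contractible_nonempty (sup_topology X S)"
proof -
  let ?C = "cfunspace X (euclidean_metric :: real metric)"
  let ?M = "submetric ?C S"
  have SC: "S \<subseteq> mspace ?C"
    by (rule continuous_functions_subset_mspace_cfunspace [OF X(1) S])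
  have M: "mspace ?M = S"
    using SC by auto
  have top: "topspace (sup_topology X S) = S"
    unfolding sup_topology_def using M by simp
  interpret Metric_space S "mdist ?C"
    using Metric_space_mspace_mdist [of ?M] unfolding M by simp
  have mtop: "sup_topology X S = mtopology"
    unfolding sup_topology_def mtopology_of_def M by simp
  have dist_le: "mdist ?C f g \<le> a \<longleftrightarrow> (\<forall>x\<in>topspace X. \<bar>f x - g x\<bar> \<le> a)" if "f \<in> S" "g \<in> S" for f g a
    using cfunspace_mdist_le [of f X euclidean_metric g a] that SC X(2) by (auto simp: dist_real_def)
  define h where "h z = (\<lambda>x\<in>topspace X. m + (1 - fst z) * (snd z x - m))" for z :: "real \<times> ('a \<Rightarrow> real)"
  have hS: "h (s, f) \<in> S" if "s \<in> {0..1}" "f \<in> S" for s f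
  proof (cases "s = 1")
    case True
    then have "h (s, f) = (\<lambda>x\<in>topspace X. m)"
      by (simp add: h_def)
    then show ?thesis
      using const by simp
  next
    case False
    then show ?thesis
      using star [of f "1 - s"] that by (simp add: h_def)
  qed
  have "continuous_map (prod_topology (top_of_set {0..1::real}) mtopology) mtopology h"
    unfolding continuous_map_to_metric
  proof (intro ballI allI impI)
    fix z and e :: real
    assume z: "z \<in> topspace (prod_topology (top_of_set {0..1::real}) mtopology)" and e: "0 < e"
    obtain s f where sf: "z = (s, f)" "s \<in> {0..1}" "f \<in> S"
      using z by (cases z) auto
    have "\<forall>x\<in>topspace X. \<bar>f x - (\<lambda>x\<in>topspace X. m) x\<bar> \<le> mdist ?C f (\<lambda>x\<in>topspace X. m)"
      using dist_le [OF sf(3) const] by blast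
    then have bound: "\<bar>f x - m\<bar> \<le> mdist ?C f (\<lambda>x\<in>topspace X. m)" if "x \<in> topspace X" for x
      using that by auto
    define B where "B = mdist ?C f (\<lambda>x\<in>topspace X. m) + 1"
    have "0 \<le> mdist ?C f (\<lambda>x\<in>topspace X. m)"
      by (rule nonneg)
    then have B: "0 < B" "\<And>x. x \<in> topspace X \<Longrightarrow> \<bar>f x - m\<bar> \<le> B"
      unfolding B_def using bound by (linarith, fastforce)
    \<comment> \<open>Both summands of the estimate below stay under \<open>e / 3\<close>: \<open>B\<close> bounds the distance from
      \<open>f\<close> to \<open>m\<close> and is made positive to divide by it.\<close>
    let ?U = "({0..1} \<inter> ball s (e / (3 * B))) \<times> mball f (e / 3)"
    show "\<exists>U. openin (prod_topology (top_of_set {0..1::real}) mtopology) U \<and> z \<in> U \<and> (\<forall>y\<in>U. h y \<in> mball (h z) e)"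
    proof (intro exI [of _ ?U] conjI ballI)
      show "openin (prod_topology (top_of_set {0..1::real}) mtopology) ?U"
        by (simp add: openin_prod_Times_iff openin_open_Int)
      show "z \<in> ?U"
        using sf B(1) e by simp
      fix y assume "y \<in> ?U"
      then obtain t g where tg: "y = (t, g)" "t \<in> {0..1}" "\<bar>s - t\<bar> < e / (3 * B)" "g \<in> S" "mdist ?C f g < e / 3"
        by (auto simp: dist_real_def)
      have "\<bar>h (s, f) x - h (t, g) x\<bar> \<le> 2 * e / 3" if x: "x \<in> topspace X" for x
      proof -
        have fg: "\<bar>f x - g x\<bar> \<le> e / 3"
          using dist_le [OF sf(3) tg(4), of "e / 3"] tg(5) x by simp
        have "h (s, f) x - h (t, g) x = (1 - t) * (f x - g x) + (t - s) * (f x - m)"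
          using x by (simp add: h_def algebra_simps)
        then have "\<bar>h (s, f) x - h (t, g) x\<bar> \<le> \<bar>1 - t\<bar> * \<bar>f x - g x\<bar> + \<bar>t - s\<bar> * \<bar>f x - m\<bar>"
          by (metis abs_mult abs_triangle_ineq)
        also have "\<dots> \<le> 1 * (e / 3) + (e / (3 * B)) * B"
          using tg fg B(1) B(2) [OF x] e by (intro add_mono mult_mono) auto
        also have "\<dots> = 2 * e / 3"
          using B(1) by simp
        finally show ?thesis .
      qed
      then have "mdist ?C (h (s, f)) (h (t, g)) \<le> 2 * e / 3"
        using dist_le [OF hS [OF sf(2,3)] hS [OF tg(2,4)], of "2 * e / 3"] by blast
      then show "h y \<in> mball (h z) e"
        using hS [OF sf(2,3)] hS [OF tg(2,4)] e by (simp add: sf(1) tg(1))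
    qed
  qed
  moreover have "h (0, f) = f" if "f \<in> S" for f
  proof
    show "h (0, f) x = f x" for x
      using that S by (cases "x \<in> topspace X") (auto simp: h_def extensional_def)
  qed
  moreover have "h (1, f) = (\<lambda>x\<in>topspace X. m)" for f
    by (simp add: h_def)
  ultimately have "homotopic_with (\<lambda>_. True) mtopology mtopology id (\<lambda>_. \<lambda>x\<in>topspace X. m)"
    by (subst homotopic_with) (auto intro!: exI [of _ h])
  then have "contractible_space (sup_topology X S)"
    unfolding contractible_space_def mtop by blast
  then show ?thesis
    unfolding contractible_nonempty_def top using const by blast
qed

section \<open>Functions whose merge tree is a half-line\<close>

lemma topspace_sublevel [simp]: "topspace (sublevel X f t) = {x \<in> topspace X. f x \<le> t}"
  by (auto simp: sublevel_def)

lemma topspace_epigraph: "topspace (epigraph X f) = {(x, t). x \<in> topspace X \<and> f x \<le> t}"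
  by (auto simp: epigraph_def)

lemma MT_rel_image:
  "MT_rel X f `` {(x, t)} = {y. connected_component_of (sublevel X f t) x y} \<times> {t}"
  by (auto simp: MT_rel_def)

lemma MT_height_class:
  assumes "x \<in> topspace X" "f x \<le> t"
  shows "MT_height (MT_rel X f `` {(x, t)}) = t"
proof -
  have "x \<in> topspace (sublevel X f t)"
    using assms by simp
  then have "connected_component_of (sublevel X f t) x x"
    using connected_component_of_refl by metis
  then have "snd ` (MT_rel X f `` {(x, t)}) = {t}"
    unfolding MT_rel_image by force
  then show ?thesis
    by (simp add: MT_height_def)
qed

lemma topspace_MT: "C \<in> topspace (MT X f) \<longleftrightarrow> (\<exists>x t. x \<in> topspace X \<and> f x \<le> t \<and> C = MT_rel X f `` {(x, t)})"
  unfolding MT_def topspace_quotient_topology quotient_def topspace_epigraph by auto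

text \<open>All sublevel sets are connected, and those at level \<open>m\<close> or higher are exactly the nonempty
  ones. The empty space counts as connected.\<close>

definition connected_sublevels :: "'a topology \<Rightarrow> ('a \<Rightarrow> real) \<Rightarrow> real \<Rightarrow> bool" where
  "connected_sublevels X f m \<longleftrightarrow>
     (\<forall>t. connected_space (sublevel X f t)) \<and>
     (\<forall>t. topspace (sublevel X f t) \<noteq> {} \<longleftrightarrow> m \<le> t)"

lemma connected_sublevels_imp_MT_height_homeomorphic:
  assumes f: "continuous_map X euclideanreal f" and conn: "connected_sublevels X f m"
  shows "homeomorphic_map (MT X f) (top_of_set {m..}) MT_height"
proof -
  have ne: "(\<exists>x\<in>topspace X. f x \<le> t) \<longleftrightarrow> m \<le> t" for t
    using conn by (auto simp: connected_sublevels_def)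
  obtain x0 where x0: "x0 \<in> topspace X" "f x0 \<le> m"
    using ne by blast
  let ?g = "\<lambda>t. MT_rel X f `` {(x0, t)}"
  have q: "quotient_map (epigraph X f) (MT X f) (\<lambda>z. MT_rel X f `` {z})"
    unfolding MT_def by (rule quotient_map_quotient_topology)
  have "continuous_map (epigraph X f) euclideanreal (MT_height \<circ> (\<lambda>z. MT_rel X f `` {z}))"
  proof (rule continuous_map_eq)
    show "continuous_map (epigraph X f) euclideanreal snd"
      unfolding epigraph_def by (intro continuous_map_from_subtopology continuous_map_snd)
    show "snd z = (MT_height \<circ> (\<lambda>z. MT_rel X f `` {z})) z" if "z \<in> topspace (epigraph X f)" for z
      using that by (cases z) (simp add: topspace_epigraph MT_height_class)
  qed
  then have "continuous_map (MT X f) euclideanreal MT_height"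
    using continuous_compose_quotient_map_eq [OF q] by blast
  moreover have "MT_height C \<in> {m..}" if "C \<in> topspace (MT X f)" for C
  proof -
    obtain x t where "x \<in> topspace X" "f x \<le> t" "C = MT_rel X f `` {(x, t)}"
      using \<open>C \<in> topspace (MT X f)\<close> unfolding topspace_MT by blast
    then show ?thesis
      using ne [of t] by (auto simp: MT_height_class)
  qed
  ultimately have 1: "continuous_map (MT X f) (top_of_set {m..}) MT_height"
    by (auto simp: continuous_map_in_subtopology)
  have "continuous_map (top_of_set {m..}) (epigraph X f) (\<lambda>t. (x0, t))"
    using x0 unfolding epigraph_def
    by (auto simp: continuous_map_in_subtopology continuous_map_pairwise comp_def)
  from continuous_map_compose [OF this quotient_imp_continuous_map [OF q]]
  have 2: "continuous_map (top_of_set {m..}) (MT X f) ?g"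
    by (simp add: comp_def)
  have 3: "?g (MT_height C) = C" if "C \<in> topspace (MT X f)" for C
  proof -
    obtain x t where C: "x \<in> topspace X" "f x \<le> t" "C = MT_rel X f `` {(x, t)}"
      using \<open>C \<in> topspace (MT X f)\<close> unfolding topspace_MT by blast
    then have "m \<le> t"
      using ne by blast
    then have "x0 \<in> topspace (sublevel X f t)" "x \<in> topspace (sublevel X f t)"
      using x0 C by auto
    moreover have "connected_space (sublevel X f t)"
      using conn by (simp add: connected_sublevels_def)
    ultimately have "connected_component_of (sublevel X f t) x0 = connected_component_of (sublevel X f t) x"
      by (metis connected_component_of_eq connected_space_iff_connected_component)
    moreover have "MT_height C = t"
      using C by (simp add: MT_height_class)
    ultimately show ?thesis
      by (simp add: C(3) MT_rel_image)
  qed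
  have 4: "MT_height (?g t) = t" if "t \<in> {m..}" for t
    using that x0 by (simp add: MT_height_class)
  have "homeomorphic_maps (MT X f) (top_of_set {m..}) MT_height ?g"
    unfolding homeomorphic_maps_def using 1 2 3 4 by simp
  then show ?thesis
    using homeomorphic_map_maps by blast
qed

text \<open>The points of the merge tree at height \<open>t\<close> are the components of the sublevel set at
  level \<open>t\<close>, and over a half-line there is one for \<open>t \<ge> m\<close> and none otherwise.\<close>

lemma isomorphic_MT_iff_connected_sublevels:
  assumes f: "continuous_map X euclideanreal f"
    and \<pi>: "homeomorphic_map T (top_of_set {m..}) \<pi>"
  shows "isomorphic_over_real (MT X f) MT_height T \<pi> \<longleftrightarrow> connected_sublevels X f m"
proof
  assume "isomorphic_over_real (MT X f) MT_height T \<pi>"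
  then obtain h where h: "homeomorphic_map (MT X f) T h"
    and \<pi>h: "\<And>C. C \<in> topspace (MT X f) \<Longrightarrow> \<pi> (h C) = MT_height C"
    unfolding isomorphic_over_real_def by blast
  have hT: "h C \<in> topspace T" if "C \<in> topspace (MT X f)" for C
    using h that homeomorphic_imp_surjective_map by blast
  have \<pi>T: "\<pi> ` topspace T = {m..}"
    using homeomorphic_imp_surjective_map [OF \<pi>] by simp
  have cls: "MT_rel X f `` {(x, t)} \<in> topspace (MT X f)" if "x \<in> topspace X" "f x \<le> t" for x t
    using that unfolding topspace_MT by blast
  have "connected_component_of (sublevel X f t) x y"
    if x: "x \<in> topspace (sublevel X f t)" and y: "y \<in> topspace (sublevel X f t)" for x y t
  proof -
    let ?C = "MT_rel X f `` {(x, t)}" and ?D = "MT_rel X f `` {(y, t)}"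
    have CD: "?C \<in> topspace (MT X f)" "?D \<in> topspace (MT X f)"
      using x y cls by auto
    then have "\<pi> (h ?C) = \<pi> (h ?D)"
      using x y by (simp add: \<pi>h MT_height_class)
    then have "h ?C = h ?D"
      using homeomorphic_imp_injective_map [OF \<pi>] CD hT by (meson inj_onD)
    then have "?C = ?D"
      using homeomorphic_imp_injective_map [OF h] CD by (meson inj_onD)
    moreover have "connected_component_of (sublevel X f t) y y"
      using connected_component_of_refl [of "sublevel X f t" y] y by simp
    then have "(y, t) \<in> ?D"
      unfolding MT_rel_image by blast
    ultimately show ?thesis
      unfolding MT_rel_image by blast
  qed
  moreover have "topspace (sublevel X f t) \<noteq> {} \<longleftrightarrow> m \<le> t" for t
  proof
    assume "topspace (sublevel X f t) \<noteq> {}"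
    then obtain x where x: "x \<in> topspace X" "f x \<le> t"
      by auto
    then have "\<pi> (h (MT_rel X f `` {(x, t)})) \<in> {m..}"
      using \<pi>T hT [OF cls [OF x]] by blast
    then show "m \<le> t"
      using x by (simp add: \<pi>h cls MT_height_class)
  next
    assume "m \<le> t"
    then have "t \<in> \<pi> ` topspace T"
      unfolding \<pi>T by simp
    then obtain z where z: "z \<in> topspace T" "\<pi> z = t"
      by blast
    have "z \<in> h ` topspace (MT X f)"
      unfolding homeomorphic_imp_surjective_map [OF h] by (rule z(1))
    then obtain C where C: "C \<in> topspace (MT X f)" "h C = z"
      by blast
    obtain x s where xs: "x \<in> topspace X" "f x \<le> s" "C = MT_rel X f `` {(x, s)}"
      using C(1) unfolding topspace_MT by blast
    have "s = t"
      using \<pi>h [OF C(1)] C z xs by (simp add: MT_height_class)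
    then show "topspace (sublevel X f t) \<noteq> {}"
      using xs by auto
  qed
  ultimately show "connected_sublevels X f m"
    unfolding connected_sublevels_def connected_space_iff_connected_component by blast
next
  assume "connected_sublevels X f m"
  then have MT: "homeomorphic_map (MT X f) (top_of_set {m..}) MT_height"
    by (rule connected_sublevels_imp_MT_height_homeomorphic [OF f])
  obtain g where g: "homeomorphic_maps T (top_of_set {m..}) \<pi> g"
    using \<pi> by (auto simp: homeomorphic_map_maps)
  then have "homeomorphic_map (top_of_set {m..}) T g"
    by (rule homeomorphic_maps_imp_map [OF homeomorphic_maps_sym [THEN iffD1]])
  then have "homeomorphic_map (MT X f) T (g \<circ> MT_height)"
    using MT by (rule homeomorphic_map_compose [rotated])
  moreover have "\<pi> ((g \<circ> MT_height) C) = MT_height C" if "C \<in> topspace (MT X f)" for C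
  proof -
    have "MT_height C \<in> {m..}"
      using homeomorphic_imp_surjective_map [OF MT] that by auto
    then show ?thesis
      using g by (simp add: homeomorphic_maps_def)
  qed
  ultimately show "isomorphic_over_real (MT X f) MT_height T \<pi>"
    unfolding isomorphic_over_real_def by blast
qed

lemma connected_sublevels_const:
  assumes "connected_space X" "topspace X \<noteq> {}"
  shows "connected_sublevels X (\<lambda>x\<in>topspace X. m) m"
proof -
  have "sublevel X (\<lambda>x\<in>topspace X. m) t = (if m \<le> t then X else trivial_topology)" for t
    unfolding sublevel_def by (auto intro!: subtopology_superset)
  then show ?thesis
    using assms by (auto simp: connected_sublevels_def)
qed

lemma connected_sublevels_rescale:
  assumes "connected_sublevels X f m" "0 < s"
  shows "connected_sublevels X (\<lambda>x\<in>topspace X. m + s * (f x - m)) m"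
proof -
  have eq: "sublevel X (\<lambda>x\<in>topspace X. m + s * (f x - m)) t = sublevel X f (m + (t - m) / s)" for t
  proof -
    have "m + s * (f x - m) \<le> t \<longleftrightarrow> f x \<le> m + (t - m) / s" for x
      using assms(2) by (auto simp: field_simps)
    then show ?thesis
      unfolding sublevel_def by (intro arg_cong [where f = "subtopology X"]) auto
  qed
  have "m \<le> m + (t - m) / s \<longleftrightarrow> m \<le> t" for t
    using assms(2) by (auto simp: zero_le_divide_iff)
  then show ?thesis
    using assms(1) unfolding connected_sublevels_def eq by simp
qed

section \<open>A cellular merge tree with one leaf is a half-line\<close>

lemma continuous_map_Inl: "continuous_map X (disjoint_union_topology X Y) Inl"
  unfolding continuous_map_def topspace_disjoint_union_topology openin_disjoint_union_topology
proof (intro conjI allI impI)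
  fix U assume "openin X (Inl -` U) \<and> openin Y (Inr -` U)"
  moreover have "{x \<in> topspace X. Inl x \<in> U} = topspace X \<inter> Inl -` U"
    by auto
  ultimately show "openin X {x \<in> topspace X. Inl x \<in> U}"
    by (simp add: openin_Int)
qed auto

lemma continuous_map_Inr: "continuous_map Y (disjoint_union_topology X Y) Inr"
  unfolding continuous_map_def topspace_disjoint_union_topology openin_disjoint_union_topology
proof (intro conjI allI impI)
  fix U assume "openin X (Inl -` U) \<and> openin Y (Inr -` U)"
  moreover have "{y \<in> topspace Y. Inr y \<in> U} = topspace Y \<inter> Inr -` U"
    by auto
  ultimately show "openin Y {y \<in> topspace Y. Inr y \<in> U}"
    by (simp add: openin_Int)
qed auto

text \<open>A point on a path has an address \<open>(i, s)\<close> with \<open>0 \<le> s < 1\<close>: it is the point with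
  parameter \<open>s\<close> on the edge that starts at vertex \<open>i\<close>. At the last vertex, where no edge
  starts, only \<open>s = 0\<close> occurs. The function \<open>g\<close> decreases strictly in the lexicographic
  order of addresses.\<close>

lemma path_realization_decreasing:
  fixes g :: "('w \<Rightarrow> real) \<Rightarrow> real"
  assumes W: "W = set ws" "ws \<noteq> []" "distinct ws"
    and F: "F = {{ws ! i, ws ! Suc i} |i. Suc i < length ws}"
    and fg: "finite_graph W F"
    and g: "\<And>i. Suc i < length ws \<Longrightarrow>
        strict_antimono_on {0..1} (\<lambda>s. g (edge_point (ws ! i) (ws ! Suc i) s))"
  shows "inj_on g (realization_set W F)"
    and "\<And>x. x \<in> realization_set W F \<Longrightarrow> g x \<le> g (vertex_point (hd ws))"
    and "\<And>x. x \<in> realization_set W F \<Longrightarrow> g (vertex_point (last ws)) \<le> g x"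
proof -
  define a where "a i = g (vertex_point (ws ! i))" for i
  define pt where "pt i s = edge_point (ws ! i) (ws ! Suc i) s" for i s
  have pt0: "pt i 0 = vertex_point (ws ! i)" and pt1: "pt i 1 = vertex_point (ws ! Suc i)" for i
    by (auto simp: pt_def edge_point_def vertex_point_def)
  have less: "g (pt i t) < g (pt i s)" if "Suc i < length ws" "0 \<le> s" "s < t" "t \<le> 1" for i s t
    using g [OF that(1)] that unfolding pt_def monotone_on_def by simp
  have a_Suc: "a (Suc i) < a i" if "Suc i < length ws" for i
    using less [OF that, of 0 1] by (simp add: a_def pt0 pt1)
  have a_mono: "a j \<le> a i" if "i \<le> j" "j < length ws" for i j
    using that
  proof (induction j rule: dec_induct)
    case (step n)
    then show ?case
      using a_Suc [of n] by simp
  qed simp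
  have address: "\<exists>i s. i < length ws \<and> 0 \<le> s \<and> s < 1 \<and> (s = 0 \<or> Suc i < length ws) \<and> x = pt i s"
    if x: "x \<in> realization_set W F" for x
  proof -
    obtain u v s where u: "u \<in> W" "v = u \<or> {u, v} \<in> F" "s \<in> {0..1}" "x = edge_point u v s"
      using x unfolding realization_set_iff [OF fg] by blast
    have vertex: ?thesis if "i < length ws" "x = vertex_point (ws ! i)" for i
      using that by (intro exI [of _ i] exI [of _ "0 :: real"]) (simp add: pt0)
    have edge: ?thesis if "Suc i < length ws" "c \<in> {0..1}" "x = pt i c" for i c
    proof (cases "c = 1")
      case True
      then show ?thesis
        using vertex [of "Suc i"] that by (simp add: pt1)
    next
      case False
      then show ?thesis
        using that by (intro exI [of _ i] exI [of _ c]) auto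
    qed
    show ?thesis
    proof (cases "v = u")
      case True
      then have "x = vertex_point u"
        using u by (auto simp: edge_point_def vertex_point_def algebra_simps)
      then show ?thesis
        using u(1) W vertex by (auto simp: in_set_conv_nth)
    next
      case False
      then obtain i where i: "{u, v} = {ws ! i, ws ! Suc i}" "Suc i < length ws"
        using u(2) F by blast
      then consider "u = ws ! i" "v = ws ! Suc i" | "v = ws ! i" "u = ws ! Suc i"
        by (auto simp: doubleton_eq_iff)
      then show ?thesis
      proof cases
        case 1
        then show ?thesis
          using edge [OF i(2), of s] u by (simp add: pt_def)
      next
        case 2
        then have "x = pt i (1 - s)"
          using u(4) by (auto simp: pt_def edge_point_def)
        then show ?thesis
          using edge [OF i(2), of "1 - s"] u(3) by simp
      qed
    qed
  qed
  have le: "g (pt i s) \<le> a i" if "i < length ws" "0 \<le> s" "s < 1" "s = 0 \<or> Suc i < length ws" for i s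
  proof (cases "s = 0")
    case False
    then show ?thesis
      using less [of i 0 s] that by (simp add: a_def pt0)
  qed (simp add: a_def pt0)
  have gt: "a (Suc i) < g (pt i s)" if "Suc i < length ws" "0 \<le> s" "s < 1" for i s
    using less [of i s 1] that by (simp add: a_def pt1)
  have sep: "g (pt j t) < g (pt i s)"
    if "i < j" "j < length ws" "0 \<le> s" "s < 1" "0 \<le> t" "t < 1" "t = 0 \<or> Suc j < length ws" for i j s t
    using gt [of i s] le [of j t] a_mono [of "Suc i" j] that by linarith
  show "inj_on g (realization_set W F)"
  proof (rule inj_onI)
    fix x y assume x: "x \<in> realization_set W F" and y: "y \<in> realization_set W F" and eq: "g x = g y"
    obtain i s where i: "i < length ws" "0 \<le> s" "s < 1" "s = 0 \<or> Suc i < length ws" "x = pt i s"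
      using address [OF x] by blast
    obtain j t where j: "j < length ws" "0 \<le> t" "t < 1" "t = 0 \<or> Suc j < length ws" "y = pt j t"
      using address [OF y] by blast
    have "i = j"
      using sep [of i j s t] sep [of j i t s] i j eq by (cases i j rule: linorder_cases) auto
    moreover have "s = t"
    proof (cases s t rule: linorder_cases)
      case less
      then show ?thesis
        using \<open>\<And>i s t. Suc i < length ws \<Longrightarrow> 0 \<le> s \<Longrightarrow> s < t \<Longrightarrow> t \<le> 1 \<Longrightarrow> g (pt i t) < g (pt i s)\<close> [of i s t]
          i j \<open>i = j\<close> eq by auto
    next
      case greater
      then show ?thesis
        using less [of i t s] i j \<open>i = j\<close> eq by auto
    qed
    ultimately show "x = y"
      using i j by simp
  qed
  have ends: "vertex_point (hd ws) = vertex_point (ws ! 0)" "vertex_point (last ws) = vertex_point (ws ! (length ws - 1))"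
    using W(2) by (simp_all add: hd_conv_nth last_conv_nth)
  show "g x \<le> g (vertex_point (hd ws))" if x: "x \<in> realization_set W F" for x
  proof -
    obtain i s where i: "i < length ws" "0 \<le> s" "s < 1" "s = 0 \<or> Suc i < length ws" "x = pt i s"
      using address [OF x] by blast
    show ?thesis
      using le [OF i(1-4)] a_mono [of 0 i] i(1,5) unfolding ends by (simp add: a_def)
  qed
  show "g (vertex_point (last ws)) \<le> g x" if x: "x \<in> realization_set W F" for x
  proof -
    obtain i s where i: "i < length ws" "0 \<le> s" "s < 1" "s = 0 \<or> Suc i < length ws" "x = pt i s"
      using address [OF x] by blast
    show ?thesis
    proof (cases "s = 0")
      case True
      then show ?thesis
        using a_mono [of i "length ws - 1"] i(1,5) unfolding ends by (simp add: a_def pt0)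
    next
      case False
      then have "Suc i < length ws"
        using i by blast
      then have "a (length ws - 1) \<le> a (Suc i)" "a (Suc i) < g x"
        using a_mono [of "Suc i" "length ws - 1"] gt [of i s] i by auto
      then show ?thesis
        unfolding ends by (simp add: a_def)
    qed
  qed
qed

text \<open>A set of reals is closed if below every bound it agrees with a closed subset of itself.\<close>

lemma closed_if_closed_below:
  fixes S :: "real set"
  assumes "\<And>c. \<exists>K. closed K \<and> K \<subseteq> S \<and> S \<inter> {..<c} \<subseteq> K"
  shows "closed S"
proof -
  have "x \<in> S" if x: "x \<in> closure S" for x
  proof -
    obtain K where K: "closed K" "K \<subseteq> S" "S \<inter> {..<x + 1} \<subseteq> K"
      using assms by blast
    have "x \<in> {..<x + 1} \<inter> closure S"
      using x by simp
    then have "x \<in> closure ({..<x + 1} \<inter> S)"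
      using open_Int_closure_subset [OF open_lessThan] by blast
    also have "\<dots> \<subseteq> K"
      using K by (intro closure_minimal) auto
    finally show ?thesis
      using K(2) by blast
  qed
  then show ?thesis
    using closure_subset_eq [of S] by blast
qed

lemma image_of_ray:
  fixes k :: "real \<Rightarrow> real"
  assumes cont: "continuous_on {0..<1} k" and mono: "strict_mono_on {0..<1} k"
    and lim: "filterlim k at_top (at_left 1)"
  shows "k ` {0..<1} = {k 0..}"
    and "\<And>B. closedin (top_of_set {0..<1}) B \<Longrightarrow> closed (k ` B)"
proof -
  have k_le: "k s \<le> k t" if "0 \<le> s" "s \<le> t" "t < 1" for s t
    using strict_mono_on_leD [OF mono, of s t] that by simp
  have large: "\<exists>s\<in>{0..<1}. y \<le> k s" for y
  proof -
    have "eventually (\<lambda>s. y \<le> k s) (at_left 1)"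
      using lim by (simp add: filterlim_at_top)
    then obtain b where b: "b < 1" "\<And>s. b < s \<Longrightarrow> s < 1 \<Longrightarrow> y \<le> k s"
      unfolding eventually_at_left_field by blast
    show ?thesis
      using b(1) by (intro bexI [of _ "max (1 / 2) ((b + 1) / 2)"] b(2)) (auto simp: max_def)
  qed
  have conn: "connected (k ` {0..<1})"
    using cont by (intro connected_continuous_image) simp_all
  show "k ` {0..<1} = {k 0..}"
  proof (intro equalityI subsetI)
    fix y assume "y \<in> {k 0..}"
    moreover obtain s where "s \<in> {0..<1}" "y \<le> k s"
      using large by blast
    ultimately have "{k 0..k s} \<subseteq> k ` {0..<1}" "y \<in> {k 0..k s}"
      using connected_contains_Icc [OF conn, of "k 0" "k s"] by auto
    then show "y \<in> k ` {0..<1}"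
      by blast
  qed (use k_le in force)
  show "closed (k ` B)" if B: "closedin (top_of_set {0..<1}) B" for B
  proof (rule closed_if_closed_below)
    fix c
    obtain s where s: "s \<in> {0..<1}" "c \<le> k s"
      using large by blast
    obtain D where D: "closed D" "B = {0..<1} \<inter> D"
      using B by (auto simp: closedin_closed)
    have sub: "D \<inter> {0..s} \<subseteq> B"
      using D s by auto
    have "compact (D \<inter> {0..s})"
      using D(1) by (rule closed_Int_compact) simp
    moreover have "continuous_on (D \<inter> {0..s}) k"
      using s by (intro continuous_on_subset [OF cont]) auto
    ultimately have "closed (k ` (D \<inter> {0..s}))"
      using compact_continuous_image compact_imp_closed by blast
    moreover have "k ` B \<inter> {..<c} \<subseteq> k ` (D \<inter> {0..s})"
    proof
      fix y assume "y \<in> k ` B \<inter> {..<c}"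
      then obtain b where b: "b \<in> B" "y = k b" "k b < c"
        by auto
      then have "b \<le> s"
        using k_le [of s b] s D by force
      then show "y \<in> k ` (D \<inter> {0..s})"
        using b D by auto
    qed
    ultimately show "\<exists>K. closed K \<and> K \<subseteq> k ` B \<and> k ` B \<inter> {..<c} \<subseteq> K"
      using sub by blast
  qed
qed

text \<open>The rooted tree is a path, on which \<open>\<pi>\<close> descends from the root to the minimum \<open>m\<close>, and on the
  half-open interval \<open>\<pi>\<close> ascends from the root to infinity; so \<open>\<pi>\<close> is a continuous bijection
  onto \<open>[m, \<infinity>)\<close>. It is closed because the tree is compact and \<open>\<pi>\<close> tends to infinity on the
  interval.\<close>

theorem one_leaf_merge_tree_homeomorphic:
  assumes cmt: "cellular_merge_tree W F r \<pi>" and one: "card (leaves W F r) = 1"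
  shows "\<exists>m. homeomorphic_map (merge_tree_space W F r) (top_of_set {m..}) \<pi>"
proof -
  let ?T = "merge_tree_space W F r" and ?R = "realization W F"
  let ?U = "disjoint_union_topology ?R (top_of_set {0..<1::real})"
  let ?q = "\<lambda>z. glue_rel W F r `` {z}"
  define g where "g x = \<pi> (?q (Inl x))" for x
  define k where "k s = \<pi> (?q (Inr s))" for s
  have tree: "is_tree W F" and r: "r \<in> W" and \<pi>: "continuous_map ?T euclideanreal \<pi>"
    and edges: "\<And>u v. edge_away F r u v \<Longrightarrow> strict_antimono_on {0..1} (\<lambda>s. g (edge_point u v s))"
    and k_mono: "strict_mono_on {0..<1} k" and k_lim: "filterlim k at_top (at_left 1)"
    using cmt by (simp_all add: cellular_merge_tree_def g_def [abs_def] k_def [abs_def])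
  have fg: "finite_graph W F"
    using tree by (simp add: is_tree_def)
  obtain ws where ws: "ws \<noteq> []" "distinct ws" "hd ws = r" "W = set ws"
    "F = {{ws ! i, ws ! Suc i} |i. Suc i < length ws}"
    using one_leaf_tree_is_path [OF tree r one] .
  have anti: "strict_antimono_on {0..1} (\<lambda>s. g (edge_point (ws ! i) (ws ! Suc i) s))"
    if "Suc i < length ws" for i
    by (rule edges [OF path_edge_away [OF ws(2,3,5) that]])
  have dec: "inj_on g (realization_set W F)"
    "\<And>x. x \<in> realization_set W F \<Longrightarrow> g x \<le> g (vertex_point (hd ws))"
    "\<And>x. x \<in> realization_set W F \<Longrightarrow> g (vertex_point (last ws)) \<le> g x"
    using path_realization_decreasing [OF ws(4,1,2,5) fg, of g] anti by blast+
  define m where "m = g (vertex_point (last ws))"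
  note vertex = vertex_point_in_realization_set [OF fg]
  have quot: "quotient_map ?U ?T ?q"
    unfolding merge_tree_space_def by (rule quotient_map_quotient_topology)
  have q_cont: "continuous_map ?U ?T ?q"
    by (rule quotient_imp_continuous_map [OF quot])
  have qL: "continuous_map ?R ?T (\<lambda>x. ?q (Inl x))"
    using continuous_map_compose [OF continuous_map_Inl q_cont] by (simp add: comp_def)
  have qR: "continuous_map (top_of_set {0..<1}) ?T (\<lambda>s. ?q (Inr s))"
    using continuous_map_compose [OF continuous_map_Inr q_cont] by (simp add: comp_def)
  have g_cont: "continuous_map ?R euclideanreal g"
    using continuous_map_compose [OF qL \<pi>] by (simp add: comp_def g_def [abs_def])
  have k_cont: "continuous_on {0..<1} k"
    using continuous_map_compose [OF qR \<pi>] by (simp add: comp_def k_def [abs_def])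
  have top: "topspace ?T = (\<lambda>x. ?q (Inl x)) ` realization_set W F \<union> (\<lambda>s. ?q (Inr s)) ` {0..<1}"
    using quotient_imp_surjective_map [OF quot]
    by (simp add: topspace_disjoint_union_topology image_Un image_image)
  have glue: "?q (Inl (vertex_point r)) = ?q (Inr 0)"
    using vertex [OF r] by (auto simp: glue_rel_def topspace_disjoint_union_topology)
  have k0: "k 0 = g (vertex_point r)"
    by (simp add: g_def k_def glue)
  have k_img: "k ` {0..<1} = {k 0..}"
    and k_closed: "\<And>B. closedin (top_of_set {0..<1}) B \<Longrightarrow> closed (k ` B)"
    using image_of_ray [OF k_cont k_mono k_lim] by blast+
  have g_le: "g x \<le> k 0" if "x \<in> realization_set W F" for x
    using dec(2) [OF that] by (simp add: ws(3) k0)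
  have g_img: "g ` realization_set W F = {m..k 0}"
  proof
    show "g ` realization_set W F \<subseteq> {m..k 0}"
      using g_le dec(3) by (auto simp: m_def)
    have "connectedin ?R (realization_set W F)"
      using tree_realization_subsets [OF tree] by (simp add: realization_def connectedin_subtopology)
    then have "connected (g ` realization_set W F)"
      using connectedin_continuous_map_image [OF g_cont] by simp
    moreover have "m \<in> g ` realization_set W F" "k 0 \<in> g ` realization_set W F"
      unfolding m_def k0 using vertex ws(1,4) r by auto
    ultimately show "{m..k 0} \<subseteq> g ` realization_set W F"
      by (rule connected_contains_Icc)
  qed
  have "m \<le> k 0"
    unfolding m_def k0 by (rule dec(3) [OF vertex [OF r]])
  have \<pi>L: "\<pi> (?q (Inl x)) = g x" and \<pi>R: "\<pi> (?q (Inr s)) = k s" for x s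
    by (simp_all add: g_def k_def)
  have \<pi>_img: "\<pi> ` topspace ?T = {m..}"
  proof -
    have "\<pi> ` topspace ?T = g ` realization_set W F \<union> k ` {0..<1}"
      unfolding top by (simp add: image_Un image_image \<pi>L \<pi>R)
    then show ?thesis
      unfolding g_img k_img using \<open>m \<le> k 0\<close> by auto
  qed
  have cross: "?q (Inl x) = ?q (Inr s)" if x: "x \<in> realization_set W F" and s: "s \<in> {0..<1}" and eq: "g x = k s" for x s
  proof -
    have "k 0 \<le> k s"
      using k_img s by auto
    then have "k s = k 0"
      using g_le [OF x] eq by simp
    then have "s = 0"
      using strict_mono_on_eqD [OF k_mono, of s 0] s by simp
    moreover have "x = vertex_point r"
      using inj_onD [OF dec(1) _ x vertex [OF r]] eq \<open>k s = k 0\<close> k0 by simp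
    ultimately show ?thesis
      using glue by simp
  qed
  have inj: "inj_on \<pi> (topspace ?T)"
  proof (rule inj_onI)
    fix c d assume c: "c \<in> topspace ?T" and d: "d \<in> topspace ?T" and eq: "\<pi> c = \<pi> d"
    consider x y where "x \<in> realization_set W F" "c = ?q (Inl x)" "y \<in> realization_set W F" "d = ?q (Inl y)"
      | x s where "x \<in> realization_set W F" "c = ?q (Inl x)" "s \<in> {0..<1}" "d = ?q (Inr s)"
      | s y where "s \<in> {0..<1}" "c = ?q (Inr s)" "y \<in> realization_set W F" "d = ?q (Inl y)"
      | s t where "s \<in> {0..<1}" "c = ?q (Inr s)" "t \<in> {0..<1}" "d = ?q (Inr t)"
      using c d unfolding top by blast
    then show "c = d"
    proof cases
      case 1
      then have "x = y"
        using eq inj_onD [OF dec(1), of x y] by (simp add: \<pi>L)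
      then show ?thesis
        using 1 by simp
    next
      case 2
      then show ?thesis
        using cross [of x s] eq by (simp add: \<pi>L \<pi>R)
    next
      case 3
      then show ?thesis
        using cross [of y s] eq by (simp add: \<pi>L \<pi>R)
    next
      case 4
      then have "s = t"
        using eq strict_mono_on_eqD [OF k_mono, of s t] by (simp add: \<pi>R)
      then show ?thesis
        using 4 by simp
    qed
  qed
  have "closed_map ?T (top_of_set {m..}) \<pi>"
    unfolding closed_map_def
  proof (intro allI impI)
    fix C assume C: "closedin ?T C"
    let ?A = "{x \<in> topspace ?R. ?q (Inl x) \<in> C}" and ?B = "{s \<in> topspace (top_of_set {0..<1}). ?q (Inr s) \<in> C}"
    have A: "closedin ?R ?A"
      by (rule closedin_continuous_map_preimage [OF qL C])
    have B: "closedin (top_of_set {0..<1}) ?B"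
      by (rule closedin_continuous_map_preimage [OF qR C])
    have "compactin ?R ?A"
      by (rule closedin_compact_space [OF compact_space_realization [OF fg] A])
    then have "closed (g ` ?A)"
      using image_compactin [OF _ g_cont] compact_imp_closed by fastforce
    moreover have "closed (k ` ?B)"
      by (rule k_closed [OF B])
    moreover have "\<pi> ` C = g ` ?A \<union> k ` ?B"
    proof -
      have "C = (\<lambda>x. ?q (Inl x)) ` ?A \<union> (\<lambda>s. ?q (Inr s)) ` ?B"
        using closedin_subset [OF C] unfolding top by auto
      then have "\<pi> ` C = \<pi> ` ((\<lambda>x. ?q (Inl x)) ` ?A \<union> (\<lambda>s. ?q (Inr s)) ` ?B)"
        by (rule arg_cong)
      then show ?thesis
        by (simp only: image_Un image_image \<pi>L \<pi>R)
    qed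
    ultimately have "closed (\<pi> ` C)"
      by auto
    moreover have "\<pi> ` C \<subseteq> {m..}"
      using closedin_subset [OF C] \<pi>_img by blast
    ultimately show "closedin (top_of_set {m..}) (\<pi> ` C)"
      by (simp add: closed_subset)
  qed
  moreover have "continuous_map ?T (top_of_set {m..}) \<pi>"
    using \<pi> \<pi>_img by (auto simp: continuous_map_in_subtopology)
  ultimately have "homeomorphic_map ?T (top_of_set {m..}) \<pi>"
    using \<pi>_img inj by (intro bijective_closed_imp_homeomorphic_map) simp_all
  then show ?thesis
    by blast
qed

section \<open>The two fibres\<close>

lemma one_leaf_merge_tree_path_connected_sublevels:
  assumes \<pi>: "homeomorphic_map T (top_of_set {m..}) \<pi>"
  shows "path_connected_sublevels T \<pi> m"
proof -
  have surj: "\<pi> ` topspace T = {m..}"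
    using homeomorphic_imp_surjective_map [OF \<pi>] by simp
  have "path_connected_space (sublevel T \<pi> t)" for t
  proof -
    let ?S = "{x \<in> topspace T. \<pi> x \<le> t}"
    have "\<pi> ` (topspace T \<inter> ?S) = topspace (top_of_set {m..}) \<inter> {..t}"
    proof -
      have "\<pi> ` (topspace T \<inter> ?S) = \<pi> ` topspace T \<inter> {..t}"
        by auto
      then show ?thesis
        by (simp add: surj)
    qed
    then have "homeomorphic_map (subtopology T ?S) (subtopology (top_of_set {m..}) {..t}) \<pi>"
      by (rule homeomorphic_map_subtopologies [OF \<pi>])
    moreover have "path_connected_space (top_of_set {m..t})"
      by simp
    then have "path_connected_space (subtopology (top_of_set {m..}) {..t})"
      by (simp add: subtopology_subtopology atLeastAtMost_def)
    ultimately show ?thesis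
      unfolding sublevel_def
      using homeomorphic_map_imp_homeomorphic_space homeomorphic_path_connected_space by blast
  qed
  moreover have "topspace (sublevel T \<pi> t) \<noteq> {} \<longleftrightarrow> m \<le> t" for t
  proof -
    have "topspace (sublevel T \<pi> t) \<noteq> {} \<longleftrightarrow> \<pi> ` topspace T \<inter> {..t} \<noteq> {}"
      by auto
    then show ?thesis
      unfolding surj by auto
  qed
  ultimately show ?thesis
    by (simp add: path_connected_sublevels_def)
qed

lemma tree_connected_sublevel_contractible:
  assumes "is_tree V E" "connected_space (sublevel (realization V E) f t)"
  shows "contractible_space (sublevel (realization V E) f t)"
proof -
  let ?Y = "{x \<in> realization_set V E. f x \<le> t}"
  have eq: "sublevel (realization V E) f t = subtopology (powertop_real UNIV) ?Y"
    unfolding sublevel_def topspace_realization unfolding realization_def subtopology_subtopology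
    by (rule arg_cong [where f = "subtopology _"]) auto
  have Y: "connectedin (powertop_real UNIV) ?Y"
    using assms(2) unfolding eq by (simp add: connectedin_def)
  show ?thesis
    unfolding eq
    by (rule tree_realization_subsets [OF assms(1), THEN conjunct2, rule_format, OF _ Y]) auto
qed

lemma tree_path_connected_sublevels_iff:
  assumes "is_tree V E"
  shows "path_connected_sublevels (realization V E) f m \<longleftrightarrow> connected_sublevels (realization V E) f m"
proof -
  have "path_connected_space (sublevel (realization V E) f t) \<longleftrightarrow> connected_space (sublevel (realization V E) f t)" for t
  proof
    assume "connected_space (sublevel (realization V E) f t)"
    then show "path_connected_space (sublevel (realization V E) f t)"
      by (intro contractible_imp_path_connected_space tree_connected_sublevel_contractible [OF assms])
  qed (rule path_connected_imp_connected_space)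
  then show ?thesis
    by (simp only: path_connected_sublevels_def connected_sublevels_def)
qed

lemma tree_connected_sublevels_pfd:
  fixes V :: "'a set"
  assumes "is_tree V E" "connected_sublevels (realization V E) f m"
  shows "pfd TYPE('k::field) (realization V E) f"
  unfolding pfd_def
proof (intro allI)
  fix i t
  have "connected_space (sublevel (realization V E) f t)"
    using assms(2) by (simp only: connected_sublevels_def)
  then show "finite_dimensional (field_homology i (sublevel (realization V E) f t) ::
      ('k, ('k, 'a \<Rightarrow> real) field_chain set) module)"
    by (intro finite_dimensional_field_homology_contractible tree_connected_sublevel_contractible [OF assms(1)])
qed

text \<open>Uniqueness of barcodes plays no role: \<open>f\<close> and \<open>\<pi>\<close> have isomorphic persistence modules as
  soon as both are isomorphic to the direct sum given by \<open>D\<close>, and the module of \<open>\<pi>\<close> is the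
  interval module of \<open>[m, \<infinity>)\<close>.\<close>

lemma has_PH0_iff_path_connected_sublevels:
  fixes X :: "'a topology" and T :: "'b topology"
  assumes \<pi>: "path_connected_sublevels T \<pi> m" and D: "has_PH0 TYPE('k::field) T \<pi> D"
  shows "has_PH0 TYPE('k) X f D \<longleftrightarrow> path_connected_sublevels X f m"
proof -
  let ?Hf = "sublevel_homology 0 X f :: ('k, ('k, 'a) field_chain set) persistence_module"
  let ?H\<pi> = "sublevel_homology 0 T \<pi> :: ('k, ('k, 'b) field_chain set) persistence_module"
  let ?I = "interval_module {m..} :: ('k, 'k) persistence_module"
  let ?D = "persistence_direct_sum {(I, n). n < D I} (\<lambda>(I, n). interval_module I) ::
      ('k, real set \<times> nat \<Rightarrow> 'k) persistence_module"
  have D': "\<forall>I. 0 < D I \<longrightarrow> is_interval I \<and> I \<noteq> {}" "persistence_iso ?H\<pi> ?D"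
    using D by (simp_all add: has_PH0_def is_barcode_of_def)
  have I: "persistence_iso ?H\<pi> ?I"
    using \<pi> by (simp add: persistence_iso_interval_module_iff)
  have "has_PH0 TYPE('k) X f D \<longleftrightarrow> persistence_iso ?Hf ?D"
    using D'(1) by (simp add: has_PH0_def is_barcode_of_def)
  also have "\<dots> \<longleftrightarrow> persistence_iso ?Hf ?H\<pi>"
    using persistence_iso_sublevel_homology_cospan [OF _ D'(2)] persistence_iso_trans [OF _ D'(2)] by blast
  also have "\<dots> \<longleftrightarrow> persistence_iso ?Hf ?I"
    using persistence_iso_sublevel_homology_cospan [OF _ I] persistence_iso_trans [OF _ I] by blast
  finally show ?thesis
    by (simp add: persistence_iso_interval_module_iff)
qed

theorem corollary34:
  fixes V :: "'v set" and E :: "'v set set"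
    and W :: "'w set" and F :: "'w set set" and r :: 'w
    and \<pi> :: "(('w \<Rightarrow> real) + real) set \<Rightarrow> real"
    and D :: barcode
  assumes "is_tree V E"
    and "cellular_merge_tree W F r \<pi>"
    and "card (leaves W F r) = 1"
    and "has_PH0 TYPE('k::field) (merge_tree_space W F r) \<pi> D"
  shows "MT_fiber (realization V E) (merge_tree_space W F r) \<pi> =
           PH_fiber TYPE('k) (realization V E) D \<and>
         contractible_nonempty (sup_topology (realization V E)
           (MT_fiber (realization V E) (merge_tree_space W F r) \<pi>)) \<and>
         contractible_nonempty (sup_topology (realization V E)
           (PH_fiber TYPE('k) (realization V E) D))"
proof -
  let ?X = "realization V E" and ?T = "merge_tree_space W F r"
  obtain m where \<pi>: "homeomorphic_map ?T (top_of_set {m..}) \<pi>"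
    using one_leaf_merge_tree_homeomorphic [OF assms(2,3)] by blast
  have T: "path_connected_sublevels ?T \<pi> m"
    by (rule one_leaf_merge_tree_path_connected_sublevels [OF \<pi>])
  have MT: "MT_fiber ?X ?T \<pi> = {f \<in> extensional (topspace ?X).
      continuous_map ?X euclideanreal f \<and> connected_sublevels ?X f m}" (is "_ = ?S")
    unfolding MT_fiber_def using isomorphic_MT_iff_connected_sublevels [OF _ \<pi>] by blast
  have PH: "PH_fiber TYPE('k) ?X D = ?S"
    unfolding PH_fiber_def has_PH0_iff_path_connected_sublevels [OF T assms(4)]
      tree_path_connected_sublevels_iff [OF assms(1)]
    using tree_connected_sublevels_pfd [OF assms(1)] by blast
  have conn: "connectedin (powertop_real UNIV) (realization_set V E)"
    using tree_realization_subsets [OF assms(1)] by blast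
  have X: "connected_space ?X" "compact_space ?X" "topspace ?X \<noteq> {}"
  proof -
    show "connected_space ?X"
      using conn by (simp add: realization_def connectedin_def)
    show "compact_space ?X"
      using assms(1) by (intro compact_space_realization) (simp add: is_tree_def)
    obtain v where "v \<in> V"
      using assms(1) by (auto simp: is_tree_def connected_graph_def)
    then have "vertex_point v \<in> realization_set V E"
      using assms(1) by (intro vertex_point_in_realization_set) (simp add: is_tree_def)
    then show "topspace ?X \<noteq> {}"
      by auto
  qed
  have "contractible_nonempty (sup_topology ?X ?S)"
  proof (rule contractible_star_shaped_function_space [OF X(2,3)])
    show "?S \<subseteq> {f \<in> extensional (topspace ?X). continuous_map ?X euclideanreal f}"
      by blast
    have "continuous_map ?X euclideanreal (\<lambda>x\<in>topspace ?X. m)"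
      by (rule continuous_map_eq [of _ _ "\<lambda>_. m"]) auto
    then show "(\<lambda>x\<in>topspace ?X. m) \<in> ?S"
      using connected_sublevels_const [OF X(1,3)] by simp
    fix f and s :: real
    assume f: "f \<in> ?S" and s: "0 < s" "s \<le> 1"
    have "continuous_map ?X euclideanreal (\<lambda>x. m + s * (f x - m))"
      using f by (intro continuous_map_add continuous_map_real_mult continuous_map_diff) auto
    then have "continuous_map ?X euclideanreal (\<lambda>x\<in>topspace ?X. m + s * (f x - m))"
      by (rule continuous_map_eq) simp
    then show "(\<lambda>x\<in>topspace ?X. m + s * (f x - m)) \<in> ?S"
      using connected_sublevels_rescale [OF _ s(1), of ?X f m] f by simp
  qed
  then show ?thesis
    by (simp only: MT PH simp_thms)
qed

end
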